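(* Let $\mathcal X=\{x_1,x_2,\dots\}$ be a countable set, $r\in\mathcal P(\mathcal X)$ a probability measure and $f\colon\mathcal X\to(0,\infty)$ a positive function. Define the function classes $\mathcal F_1=\{\tilde f\colon\mathcal X\to\mathbb R:|\tilde f|\le f\}$ and $\mathcal F_2=\{f\}\cup\{f\,\mathbf 1_{\mathcal X\setminus\{x_1,\dots,x_n\}}:n\in\mathbb N\}$, and let $\mathcal F_3,\mathcal F_4$ be two arbitrary function classes on $\mathcal X$. Then: (i) $\mathcal F_1$ is $r$-Donsker if and only if $\sum_{x\in\mathcal X}f(x)\sqrt{r_x}<\infty$. (ii) $\mathcal F_2$ is $r$-Donsker if and only if $\sum_{x\in\mathcal X}f(x)^2r_x<\infty$. (iii) $\mathcal F_3\cup\mathcal F_4$ is $r$-Donsker if and only if both $\mathcal F_3$ and $\mathcal F_4$ are $r$-Donsker.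
   Context: A class $\mathcal F$ of real functions on $\mathcal X$ is $r$-Donsker if, for $\hat r_n=\frac1n\sum_{i=1}^n\delta_{X_i}$ with $X_i$ i.i.d. $\sim r$, the empirical process $\big(\sqrt n\,\langle f,\hat r_n-r\rangle\big)_{f\in\mathcal F}$ converges weakly (in the sense of Hoffmann-Jørgensen) in $\ell^\infty(\mathcal F)$, the space of bounded functionals on $\mathcal F$ with supremum norm, to a tight limit (necessarily a centered Gaussian process with covariance $\langle fg,r\rangle-\langle f,r\rangle\langle g,r\rangle$). Here $\langle f,r\rangle=\sum_xf(x)r_x$. *)

theory Defs
  imports "HOL-Probability.Probability"
begin

definition metric_borel :: "'d metric \<Rightarrow> 'd measure" where
  "metric_borel m = sigma (mspace m) {U. openin (mtopology_of m) U}"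

text \<open>
  The outer expectation is used only for bounded real functions \<open>T\<close>, for which the infimum
  may be restricted to real-valued integrable majorants.  No measurability of \<open>T\<close> is assumed.
\<close>

definition outer_expectation :: "'w measure \<Rightarrow> ('w \<Rightarrow> real) \<Rightarrow> real" where
  "outer_expectation M T =
     Inf {integral\<^sup>L M U | U. integrable M U \<and> (\<forall>\<omega>\<in>space M. T \<omega> \<le> U \<omega>)}"

text \<open>
  The maps \<open>Z n\<close> need not be measurable, but must take values in the metric space at every
  sample point; the limit is given by its law \<open>L\<close>, a Borel probability measure.
\<close>

definition HJ_weakly_converges ::
    "'w measure \<Rightarrow> 'd metric \<Rightarrow> (nat \<Rightarrow> 'w \<Rightarrow> 'd) \<Rightarrow> 'd measure \<Rightarrow> bool" where
  "HJ_weakly_converges M m Z L \<longleftrightarrow>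
     (\<forall>n. Z n \<in> space M \<rightarrow> mspace m) \<and>
     prob_space L \<and> space L = mspace m \<and> sets L = sets (metric_borel m) \<and>
     (\<forall>H. continuous_map (mtopology_of m) euclideanreal H \<and> bounded (H ` mspace m) \<longrightarrow>
          (\<lambda>n. outer_expectation M (\<lambda>\<omega>. H (Z n \<omega>))) \<longlonglongrightarrow> integral\<^sup>L L H)"

definition tight_law :: "'d metric \<Rightarrow> 'd measure \<Rightarrow> bool" where
  "tight_law m L \<longleftrightarrow>
     (\<forall>\<epsilon>>0. \<exists>K. compactin (mtopology_of m) K \<and> measure L K \<ge> 1 - \<epsilon>)"

definition pairing :: "('a \<Rightarrow> real) \<Rightarrow> ('a \<Rightarrow> real) \<Rightarrow> real" where
  "pairing g q = (\<Sum>\<^sub>\<infinity>y. g y * q y)"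

definition empirical_measure :: "nat \<Rightarrow> (nat \<Rightarrow> 'a) \<Rightarrow> 'a \<Rightarrow> real" where
  "empirical_measure n \<omega> y = (1 / real n) * (\<Sum>i<n. indicator {\<omega> i} y)"

definition empirical_process ::
    "'a pmf \<Rightarrow> ('a \<Rightarrow> real) set \<Rightarrow> nat \<Rightarrow> (nat \<Rightarrow> 'a) \<Rightarrow> ('a \<Rightarrow> real) \<Rightarrow> real" where
  "empirical_process r F n \<omega> =
     (\<lambda>g\<in>F. sqrt (real n) * pairing g (\<lambda>y. empirical_measure n \<omega> y - pmf r y))"

text \<open>
  \<open>funspace F euclidean_metric\<close> is the space of bounded functionals on \<open>F\<close> with the supremum
  metric (functionals being extended by \<open>undefined\<close> off \<open>F\<close>).  The i.i.d. sample is given by the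
  coordinates of the infinite product space.  The summability conjunct says that
  all pairings with \<open>r\<close> exist, which \<open>infsum\<close>, being 0 for divergent sums, would not ensure.
\<close>

definition Donsker :: "'a pmf \<Rightarrow> ('a \<Rightarrow> real) set \<Rightarrow> bool" where
  "Donsker r F \<longleftrightarrow>
     (\<forall>g\<in>F. (\<lambda>y. g y * pmf r y) summable_on UNIV) \<and>
     (\<exists>L. HJ_weakly_converges (PiM (UNIV :: nat set) (\<lambda>_. measure_pmf r))
            (funspace F euclidean_metric) (empirical_process r F) L \<and>
          tight_law (funspace F euclidean_metric) L)"

definition envelope_class :: "('a \<Rightarrow> real) \<Rightarrow> ('a \<Rightarrow> real) set" where
  "envelope_class f = {g. \<forall>y. \<bar>g y\<bar> \<le> f y}"

text \<open>
  The enumeration \<open>x\<close> starts at 0, so that the first \<open>n\<close> points are \<open>x ` {..<n}\<close>.  It may repeat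
  points, so that finite spaces are covered; repetitions do not enlarge the class.
\<close>

definition tail_class :: "(nat \<Rightarrow> 'a) \<Rightarrow> ('a \<Rightarrow> real) \<Rightarrow> ('a \<Rightarrow> real) set" where
  "tail_class x f = {f} \<union> {\<lambda>y. f y * indicator (- (x ` {..<n})) y | n. True}"

end

theory Submission
  imports Defs
begin

text \<open>
  A class is Donsker if and only if, up to an error small in outer probability, it can be replaced
  by functions supported in a common finite set and uniformly bounded there.  For sufficiency, the
  counts of finitely many cells obey the multinomial central limit theorem, which is obtained from
  the one-dimensional one through Stone-Weierstrass approximation by trigonometric polynomials.
  Their Gaussian limit is built from independent normals, and the limit law on
  \<open>\<ell>\<^sup>\<infinity>(F)\<close> is the law of the almost sure limit of the finite approximations.  Necessity follows by
  discretising a compact set that carries most of the limit law; the members of a Donsker class are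
  square integrable by the converse of the central limit theorem, proved by symmetrisation.

  Unions inherit this criterion at once.  For the envelope class, a tail of
  \<open>\<Sum>y. f y * sqrt (r y)\<close> bounds the expected supremum of the error, and conversely the Gaussian limit has
  expected supremum of the order of that sum.  For the tail class, disjointly supported increments
  have product moments of the size required by Billingsley's fluctuation inequality, which
  controls the maximum over all far tails by \<open>\<Sum>y. (f y)\<^sup>2 * r y\<close>.
\<close>

section \<open>The empirical process as an i.i.d. sum\<close>

text \<open>The obstacle is that the space of bounded functionals on \<open>F\<close> is in general
  not separable and that the processes in it need not be measurable. No law of the process at finite
  n is ever formed: errors are carried by integrable majorants, and the limit is not extracted by
  compactness of laws but built on the Gaussian space, where almost sure convergence of finite
  approximations yields a Borel random element together with its tightness. Only Lipschitz test
  functions see the approximation error directly; continuous ones are reached by one-sided Lipschitz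
  envelopes, for which monotonicity of the outer expectation is enough. Besides approximation,
  \<open>Donsker_iff\<close> asks for boundedness of every sample path, because weak convergence is
  stated for maps with values in the metric space at every sample point. The weight
  \<open>sqrt (pmf r y)\<close> is the scale of a single cell count; its exact standard deviation
  has a further factor under the root, which is harmless because at most one point carries more than
  half of the mass.\<close>

lemma indep_vars_PiM_coords:
  assumes "prob_space N"
  shows "prob_space.indep_vars (PiM (UNIV :: 'i set) (\<lambda>_. N)) (\<lambda>_. N) (\<lambda>i \<omega>. \<omega> i) UNIV"
proof -
  interpret N: prob_space N by fact
  interpret P: product_prob_space "\<lambda>_::'i. N" UNIV
    by unfold_locales
  show ?thesis
    by (subst P.indep_vars_iff_distr_eq_PiM')
      (auto simp: P.PiM_component restrict_UNIV)
qed

lemma PiM_coord_integral: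
  fixes \<psi> :: "'b \<Rightarrow> 'c::{banach, second_countable_topology}"
  assumes "prob_space N" and [measurable]: "\<psi> \<in> borel_measurable N"
  shows "(\<integral>\<omega>. \<psi> (\<omega> i) \<partial>PiM (UNIV :: 'i set) (\<lambda>_. N)) = integral\<^sup>L N \<psi>"
    and "integrable (PiM (UNIV :: 'i set) (\<lambda>_. N)) (\<lambda>\<omega>. \<psi> (\<omega> i)) \<longleftrightarrow> integrable N \<psi>"
proof -
  interpret N: prob_space N by fact
  interpret P: product_prob_space "\<lambda>_::'i. N" UNIV
    by unfold_locales
  have d: "distr (PiM (UNIV :: 'i set) (\<lambda>_. N)) N (\<lambda>\<omega>. \<omega> i) = N"
    by (rule P.PiM_component) simp
  show "(\<integral>\<omega>. \<psi> (\<omega> i) \<partial>PiM (UNIV :: 'i set) (\<lambda>_. N)) = integral\<^sup>L N \<psi>"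
    by (subst (2) d[symmetric], subst integral_distr) auto
  show "integrable (PiM (UNIV :: 'i set) (\<lambda>_. N)) (\<lambda>\<omega>. \<psi> (\<omega> i)) \<longleftrightarrow> integrable N \<psi>"
    by (subst (2) d[symmetric], subst integrable_distr_eq) auto
qed

abbreviation sample :: "'a pmf \<Rightarrow> (nat \<Rightarrow> 'a) measure" where
  "sample r \<equiv> PiM (UNIV :: nat set) (\<lambda>_. measure_pmf r)"

abbreviation E :: "'a pmf \<Rightarrow> ('a \<Rightarrow> real) \<Rightarrow> real" where
  "E r g \<equiv> measure_pmf.expectation r g"

lemma prob_space_sample: "prob_space (sample r)"
  by (rule prob_space_PiM) (rule prob_space_measure_pmf)

lemma space_sample [simp]: "space (sample r) = UNIV"
  by (simp add: space_PiM)

lemma measurable_sample_coord: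
  "(\<lambda>\<omega>. g (\<omega> i) :: 'b::topological_space) \<in> borel_measurable (sample r)"
  by (rule measurable_compose[OF measurable_component_singleton]) auto

lemma sample_coord_integral:
  fixes \<psi> :: "'a \<Rightarrow> real"
  shows "(\<integral>\<omega>. \<psi> (\<omega> i) \<partial>sample r) = E r \<psi>"
    and "integrable (sample r) (\<lambda>\<omega>. \<psi> (\<omega> i)) \<longleftrightarrow> integrable (measure_pmf r) \<psi>"
  using PiM_coord_integral[OF prob_space_measure_pmf, of \<psi> r i] by auto

text \<open>Moments of partial sums are computed by adding one observation at a time. Condition
  \<open>dep\<close> makes \<open>F\<close> a function of the restriction to \<open>{..<n}\<close>,
  which is independent of the restriction to \<open>{n}\<close>.\<close>

lemma sample_past_next_indep:
  fixes F :: "(nat \<Rightarrow> 'a) \<Rightarrow> real" and \<psi> :: "'a \<Rightarrow> real"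
  assumes meas: "F \<in> borel_measurable (PiM {..<n} (\<lambda>_. measure_pmf r))"
    and dep: "\<And>\<omega>. F (restrict \<omega> {..<n}) = F \<omega>"
    and "integrable (sample r) F" and "integrable (measure_pmf r) \<psi>"
  shows "(\<integral>\<omega>. F \<omega> * \<psi> (\<omega> n) \<partial>sample r) = (\<integral>\<omega>. F \<omega> \<partial>sample r) * E r \<psi>"
    and "integrable (sample r) (\<lambda>\<omega>. F \<omega> * \<psi> (\<omega> n))"
proof -
  interpret P: prob_space "sample r" by (rule prob_space_sample)
  have ind: "P.indep_var (PiM {..<n} (\<lambda>_. measure_pmf r)) (\<lambda>\<omega>. restrict (\<lambda>i. \<omega> i) {..<n})
      (PiM {n} (\<lambda>_. measure_pmf r)) (\<lambda>\<omega>. restrict (\<lambda>i. \<omega> i) {n})"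
    by (rule P.indep_var_restrict[OF indep_vars_PiM_coords[OF prob_space_measure_pmf]]) auto
  have "P.indep_var borel (F \<circ> (\<lambda>\<omega>. restrict (\<lambda>i. \<omega> i) {..<n}))
      borel ((\<lambda>\<omega>. \<psi> (\<omega> n)) \<circ> (\<lambda>\<omega>. restrict (\<lambda>i. \<omega> i) {n}))"
    by (rule P.indep_var_compose[OF ind meas])
      (rule measurable_compose[OF measurable_component_singleton], auto)
  then have ind': "P.indep_var borel F borel (\<lambda>\<omega>. \<psi> (\<omega> n))"
    by (simp add: comp_def dep)
  show "(\<integral>\<omega>. F \<omega> * \<psi> (\<omega> n) \<partial>sample r) = (\<integral>\<omega>. F \<omega> \<partial>sample r) * E r \<psi>"
    using P.indep_var_lebesgue_integral[OF ind'] assms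
    by (simp add: sample_coord_integral)
  show "integrable (sample r) (\<lambda>\<omega>. F \<omega> * \<psi> (\<omega> n))"
    using P.indep_var_integrable[OF ind'] assms
    by (simp add: sample_coord_integral)
qed

text \<open>Over the reals, unconditional summability is absolute summability, so the summability
  conjunct in \<open>Donsker\<close> is integrability of \<open>g\<close> under
  \<open>r\<close>.\<close>

lemma integrable_pmf_iff_summable:
  fixes g :: "'a \<Rightarrow> real"
  shows "integrable (measure_pmf r) g \<longleftrightarrow> (\<lambda>y. g y * pmf r y) summable_on UNIV"
proof -
  have "integrable (measure_pmf r) g \<longleftrightarrow> integrable (count_space UNIV) (\<lambda>y. pmf r y * g y)"
    by (simp add: measure_pmf_eq_density integrable_density)
  also have "\<dots> \<longleftrightarrow> Infinite_Set_Sum.abs_summable_on (\<lambda>y. pmf r y * g y) UNIV"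
    unfolding abs_summable_on_def by simp
  also have "\<dots> \<longleftrightarrow> Infinite_Sum.abs_summable_on (\<lambda>y. pmf r y * g y) UNIV"
    by (rule abs_summable_equivalent[symmetric])
  also have "\<dots> \<longleftrightarrow> (\<lambda>y. g y * pmf r y) summable_on UNIV"
    by (subst summable_on_iff_abs_summable_on_real) (simp add: mult.commute)
  finally show ?thesis .
qed

lemma pmf_expectation_infsum:
  fixes g :: "'a \<Rightarrow> real"
  assumes "integrable (measure_pmf r) g"
  shows "E r g = (\<Sum>\<^sub>\<infinity>y. g y * pmf r y)"
proof -
  have "Infinite_Set_Sum.abs_summable_on (\<lambda>y. pmf r y * g y) UNIV"
    using assms unfolding abs_summable_on_def
    by (simp add: measure_pmf_eq_density integrable_density)
  then show ?thesis
    by (simp add: pmf_expectation_eq_infsetsum infsetsum_infsum mult.commute)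
qed

lemma infsum_diff':
  fixes c d :: "'a \<Rightarrow> real"
  assumes "c summable_on A" "d summable_on A"
  shows "infsum (\<lambda>y. c y - d y) A = infsum c A - infsum d A"
  using infsum_add[OF assms(1), of "\<lambda>y. - d y"] assms(2)
  by (simp add: infsum_uminus summable_on_uminus)

definition emp :: "'a pmf \<Rightarrow> ('a \<Rightarrow> real) \<Rightarrow> nat \<Rightarrow> (nat \<Rightarrow> 'a) \<Rightarrow> real" where
  "emp r g n \<omega> = (\<Sum>i<n. g (\<omega> i) - E r g) / sqrt (real n)"

text \<open>The empirical part of the pairing is a series supported on the finitely many sampled
  points. Integrability of \<open>g\<close> allows the series of the difference to be split, as both
  parts are then summable.\<close>

lemma empirical_process_eq:
  assumes g: "integrable (measure_pmf r) g" and "g \<in> F"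
  shows "empirical_process r F n \<omega> g = emp r g n \<omega>"
proof (cases "n = 0")
  case True
  then show ?thesis using assms by (simp add: empirical_process_def emp_def)
next
  case False
  let ?c = "\<lambda>y. 1 / real n * (\<Sum>i<n. g y * indicator {\<omega> i} y)"
  have supp: "?c y = 0" if "y \<notin> \<omega> ` {..<n}" for y
    using that by (auto intro!: sum.neutral simp: indicator_def)
  have fin: "?c summable_on UNIV"
    by (subst summable_on_cong_neutral[where T="\<omega> ` {..<n}" and g="?c"]) (use supp in auto)
  have one: "(\<Sum>y\<in>\<omega> ` {..<n}. g y * indicator {\<omega> i} y) = g (\<omega> i)" if "i < n" for i
    using that by (subst sum.remove[of _ "\<omega> i"]) (auto intro!: sum.neutral simp: indicator_def)
  have "infsum ?c UNIV = infsum ?c (\<omega> ` {..<n})"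
    by (rule infsum_cong_neutral) (use supp in auto)
  also have "\<dots> = (\<Sum>y\<in>\<omega> ` {..<n}. ?c y)" by simp
  also have "\<dots> = 1 / real n * (\<Sum>i<n. \<Sum>y\<in>\<omega> ` {..<n}. g y * indicator {\<omega> i} y)"
    by (subst sum.swap) (simp add: sum_distrib_left)
  also have "\<dots> = 1 / real n * (\<Sum>i<n. g (\<omega> i))"
    by (intro arg_cong2[where f="(*)"] refl sum.cong one) simp
  finally have s: "infsum ?c UNIV = 1 / real n * (\<Sum>i<n. g (\<omega> i))" .
  have c: "?c y = g y * (1 / real n * (\<Sum>i<n. indicator {\<omega> i} y))" for y
    by (subst sum_distrib_left[symmetric]) (simp only: mult_ac)
  have "pairing g (\<lambda>y. empirical_measure n \<omega> y - pmf r y) = (\<Sum>\<^sub>\<infinity>y. ?c y - g y * pmf r y)"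
    unfolding pairing_def empirical_measure_def
    by (simp only: right_diff_distrib c)
  also have "\<dots> = 1 / real n * (\<Sum>i<n. g (\<omega> i)) - E r g"
    by (simp only: infsum_diff'[OF fin g[unfolded integrable_pmf_iff_summable]] s
        pmf_expectation_infsum[OF g])
  finally have p: "pairing g (\<lambda>y. empirical_measure n \<omega> y - pmf r y) = 1 / real n * (\<Sum>i<n. g (\<omega> i)) - E r g" .
  have "sqrt (real n) * (1 / real n * a - b) = (a - real n * b) / sqrt (real n)" for a b
    using False by (simp add: field_simps real_sqrt_mult[symmetric] flip: real_sqrt_pow2)
  then show ?thesis
    using \<open>g \<in> F\<close> by (simp add: empirical_process_def emp_def p sum_subtractf)
qed

lemma empirical_process_extensional: "empirical_process r F n \<omega> \<in> extensional F"
  by (simp add: empirical_process_def)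

lemma emp_measurable [measurable]: "emp r g n \<in> borel_measurable (sample r)"
  unfolding emp_def[abs_def]
  by (intro borel_measurable_divide borel_measurable_sum borel_measurable_const measurable_sample_coord)

lemma emp_0 [simp]: "emp r g 0 \<omega> = 0"
  by (simp add: emp_def)

lemma emp_add:
  assumes "integrable (measure_pmf r) g" "integrable (measure_pmf r) h"
  shows "emp r (\<lambda>y. g y + h y) n \<omega> = emp r g n \<omega> + emp r h n \<omega>"
  using assms by (simp add: emp_def sum_subtractf sum.distrib add_divide_distrib diff_divide_distrib distrib_left)

lemma emp_diff:
  assumes "integrable (measure_pmf r) g" "integrable (measure_pmf r) h"
  shows "emp r (\<lambda>y. g y - h y) n \<omega> = emp r g n \<omega> - emp r h n \<omega>"
  using assms by (simp add: emp_def sum_subtractf sum.distrib add_divide_distrib diff_divide_distrib right_diff_distrib)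

lemma emp_cmult: "emp r (\<lambda>y. c * g y) n \<omega> = c * emp r g n \<omega>"
  by (simp add: emp_def sum_distrib_left right_diff_distrib diff_divide_distrib)

lemma emp_zero [simp]: "emp r (\<lambda>y. 0) n \<omega> = 0"
  by (simp add: emp_def)

lemma emp_sum:
  assumes "\<And>j. j \<in> J \<Longrightarrow> integrable (measure_pmf r) (g j)"
  shows "emp r (\<lambda>y. \<Sum>j\<in>J. g j y) n \<omega> = (\<Sum>j\<in>J. emp r (g j) n \<omega>)"
  using assms
proof (induction J rule: infinite_finite_induct)
  case (insert j J)
  then show ?case by (simp add: emp_add)
qed auto

lemma integrable_finite_support:
  fixes g :: "'a \<Rightarrow> real"
  assumes "finite A" "\<And>y. y \<notin> A \<Longrightarrow> g y = 0"
  shows "integrable (measure_pmf r) g"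
proof (rule measure_pmf.integrable_const_bound)
  show "AE y in measure_pmf r. norm (g y) \<le> (\<Sum>y\<in>A. \<bar>g y\<bar>)"
  proof (intro always_eventually allI)
    fix y show "norm (g y) \<le> (\<Sum>y\<in>A. \<bar>g y\<bar>)"
      using assms by (cases "y \<in> A") (auto intro: member_le_sum sum_nonneg)
  qed
qed simp

text \<open>Linearity in the point indicators. A whole class of functions with a common finite
  support is thereby governed by finitely many random numbers.\<close>

lemma emp_finite_support:
  assumes "finite A" "\<And>y. y \<notin> A \<Longrightarrow> g y = 0"
  shows "emp r g n \<omega> = (\<Sum>y\<in>A. g y * emp r (indicator {y}) n \<omega>)"
proof -
  have "g = (\<lambda>z. \<Sum>y\<in>A. g y * indicator {y} z)"
  proof
    fix z show "g z = (\<Sum>y\<in>A. g y * indicator {y} z)"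
      using assms by (cases "z \<in> A") (auto simp: indicator_def sum.remove[of A z] intro!: sum.neutral)
  qed
  then have "emp r g n \<omega> = emp r (\<lambda>z. \<Sum>y\<in>A. g y * indicator {y} z) n \<omega>" by simp
  also have "\<dots> = (\<Sum>y\<in>A. emp r (\<lambda>z. g y * indicator {y} z) n \<omega>)"
  proof (rule emp_sum)
    show "integrable (measure_pmf r) (\<lambda>z. g y * indicator {y} z)" for y
      by (rule integrable_finite_support[of "{y}"]) auto
  qed
  finally show ?thesis by (simp add: emp_cmult)
qed

section \<open>Second and fourth moments\<close>

text \<open>Closed under the ring operations and under inner composition, so that integrability of
  any polynomial in bounded functions is, up to measurability, a matter of syntax.\<close>

definition bnd :: "('b \<Rightarrow> real) \<Rightarrow> bool" where
  "bnd f \<longleftrightarrow> (\<exists>C. \<forall>x. \<bar>f x\<bar> \<le> C)"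

lemma bndI: "(\<And>x. \<bar>f x\<bar> \<le> C) \<Longrightarrow> bnd f"
  by (auto simp: bnd_def)

lemma bnd_const [intro, simp]: "bnd (\<lambda>_. c)"
  by (auto simp: bnd_def)

lemma bnd_add [intro]: "bnd f \<Longrightarrow> bnd g \<Longrightarrow> bnd (\<lambda>x. f x + g x)"
  unfolding bnd_def by (meson abs_triangle_ineq add_mono order_trans)

lemma bnd_mult [intro]: "bnd f \<Longrightarrow> bnd g \<Longrightarrow> bnd (\<lambda>x. f x * g x)"
  unfolding bnd_def abs_mult
  by (meson abs_ge_zero mult_mono order_trans)

lemma bnd_uminus [intro]: "bnd f \<Longrightarrow> bnd (\<lambda>x. - f x)"
  by (auto simp: bnd_def)

lemma bnd_diff [intro]: "bnd f \<Longrightarrow> bnd g \<Longrightarrow> bnd (\<lambda>x. f x - g x)"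
  using bnd_add[of f "\<lambda>x. - g x"] by auto

lemma bnd_power [intro]: "bnd f \<Longrightarrow> bnd (\<lambda>x. f x ^ k)"
  by (induction k) auto

lemma bnd_sum [intro]: "(\<And>i. i \<in> I \<Longrightarrow> bnd (f i)) \<Longrightarrow> bnd (\<lambda>x. \<Sum>i\<in>I. f i x)"
  by (induction I rule: infinite_finite_induct) auto

lemma bnd_comp: "bnd f \<Longrightarrow> bnd (\<lambda>x. f (h x))"
  by (auto simp: bnd_def)

lemma bnd_finite_support:
  assumes "finite A" "\<And>y. y \<notin> A \<Longrightarrow> g y = 0"
  shows "bnd g"
proof (rule bndI)
  fix y show "\<bar>g y\<bar> \<le> (\<Sum>y\<in>A. \<bar>g y\<bar>)"
    using assms by (cases "y \<in> A") (auto intro: member_le_sum sum_nonneg)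
qed

lemma (in prob_space) integrable_bnd:
  "bnd f \<Longrightarrow> f \<in> borel_measurable M \<Longrightarrow> integrable M f"
  unfolding bnd_def by (auto intro!: integrable_const_bound AE_I2)

text \<open>Induction on \<open>n\<close>: the new observation is centred and independent of the
  past, so the cross term of the square has expectation 0.\<close>

lemma partial_sum_moments:
  fixes a :: "'a \<Rightarrow> real"
  assumes a: "integrable (measure_pmf r) a" and a2: "integrable (measure_pmf r) (\<lambda>y. (a y)\<^sup>2)"
    and E0: "E r a = 0"
  shows "integrable (sample r) (\<lambda>\<omega>. \<Sum>i<n. a (\<omega> i))"
    and "(\<integral>\<omega>. (\<Sum>i<n. a (\<omega> i)) \<partial>sample r) = 0"
    and "integrable (sample r) (\<lambda>\<omega>. (\<Sum>i<n. a (\<omega> i))\<^sup>2)"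
    and "(\<integral>\<omega>. (\<Sum>i<n. a (\<omega> i))\<^sup>2 \<partial>sample r) = n * E r (\<lambda>y. (a y)\<^sup>2)"
proof -
  let ?A = "\<lambda>n \<omega>. \<Sum>i<n. a (\<omega> i)"
  have i1: "integrable (sample r) (?A n)" for n
    using a by (intro Bochner_Integration.integrable_sum) (simp add: sample_coord_integral)
  have e1: "integral\<^sup>L (sample r) (?A n) = 0" for n
    using a E0 by (subst Bochner_Integration.integral_sum) (auto simp: sample_coord_integral)
  show "integrable (sample r) (?A n)" "integral\<^sup>L (sample r) (?A n) = 0"
    by (fact i1 e1)+
  have "integrable (sample r) (\<lambda>\<omega>. (?A n \<omega>)\<^sup>2) \<and>
    (\<integral>\<omega>. (?A n \<omega>)\<^sup>2 \<partial>sample r) = n * E r (\<lambda>y. (a y)\<^sup>2)"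
  proof (induction n)
    case (Suc n)
    have meas: "?A n \<in> borel_measurable (PiM {..<n} (\<lambda>_. measure_pmf r))"
      by (rule borel_measurable_sum, rule measurable_compose[OF measurable_component_singleton]) auto
    have dep: "?A n (restrict \<omega> {..<n}) = ?A n \<omega>" for \<omega>
      by simp
    note f = sample_past_next_indep[OF meas dep i1 a]
    have exp: "(?A (Suc n) \<omega>)\<^sup>2 = ((?A n \<omega>)\<^sup>2 + 2 * (?A n \<omega> * a (\<omega> n))) + (a (\<omega> n))\<^sup>2" for \<omega>
      by (simp add: power2_eq_square algebra_simps)
    have c: "integrable (sample r) (\<lambda>\<omega>. (a (\<omega> n))\<^sup>2)"
      "(\<integral>\<omega>. (a (\<omega> n))\<^sup>2 \<partial>sample r) = E r (\<lambda>y. (a y)\<^sup>2)"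
      using a2 sample_coord_integral[where \<psi>="\<lambda>y. (a y)\<^sup>2"] by auto
    show ?case
      unfolding exp using Suc f c
      by (simp add: Bochner_Integration.integral_add E0 algebra_simps)
  qed auto
  then show "integrable (sample r) (\<lambda>\<omega>. (?A n \<omega>)\<^sup>2)"
    "(\<integral>\<omega>. (?A n \<omega>)\<^sup>2 \<partial>sample r) = n * E r (\<lambda>y. (a y)\<^sup>2)" by auto
qed

lemma integrable_of_square:
  fixes g :: "'a \<Rightarrow> real"
  assumes "integrable (measure_pmf r) (\<lambda>y. (g y)\<^sup>2)"
  shows "integrable (measure_pmf r) g"
  using measure_pmf.square_integrable_imp_integrable[OF _ assms] by simp

text \<open>The variance is at most the second moment. The bound is uniform in \<open>n\<close>,
  which is what lets tails be discarded for all sample sizes at once.\<close>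

lemma emp_square:
  fixes g :: "'a \<Rightarrow> real"
  assumes g2: "integrable (measure_pmf r) (\<lambda>y. (g y)\<^sup>2)"
  shows "integrable (sample r) (\<lambda>\<omega>. (emp r g n \<omega>)\<^sup>2)"
    and "(\<integral>\<omega>. (emp r g n \<omega>)\<^sup>2 \<partial>sample r) \<le> E r (\<lambda>y. (g y)\<^sup>2)"
proof -
  have g: "integrable (measure_pmf r) g"
    by (rule integrable_of_square[OF g2])
  let ?a = "\<lambda>y. g y - E r g"
  have a2: "integrable (measure_pmf r) (\<lambda>y. (?a y)\<^sup>2)"
    using g g2 by (simp add: power2_diff)
  have e: "emp r g n \<omega>^2 = (\<Sum>i<n. ?a (\<omega> i))\<^sup>2 / n" for \<omega>
    by (simp add: emp_def power_divide)
  note m = partial_sum_moments[of r ?a, OF _ a2]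
  show "integrable (sample r) (\<lambda>\<omega>. (emp r g n \<omega>)\<^sup>2)"
    unfolding e using m(3) g by simp
  have "(\<integral>\<omega>. (emp r g n \<omega>)\<^sup>2 \<partial>sample r) \<le> E r (\<lambda>y. (?a y)\<^sup>2)"
    unfolding e using m(4) g by (cases "n = 0") auto
  also have "\<dots> = E r (\<lambda>y. (g y)\<^sup>2) - (E r g)\<^sup>2"
    using measure_pmf.variance_eq[OF g g2] .
  finally show "(\<integral>\<omega>. (emp r g n \<omega>)\<^sup>2 \<partial>sample r) \<le> E r (\<lambda>y. (g y)\<^sup>2)"
    using zero_le_power2[of "E r g"] by linarith
qed

text \<open>Nonnegativity of the variance of the absolute value is the required case of the
  Cauchy-Schwarz inequality.\<close>

lemma (in prob_space) integral_abs_le_sqrt: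
  fixes X :: "'a \<Rightarrow> real"
  assumes X: "X \<in> borel_measurable M" "integrable M (\<lambda>x. (X x)\<^sup>2)"
  shows "integrable M (\<lambda>x. \<bar>X x\<bar>)" and "(\<integral>x. \<bar>X x\<bar> \<partial>M) \<le> sqrt (\<integral>x. (X x)\<^sup>2 \<partial>M)"
proof -
  have "integrable M X" using square_integrable_imp_integrable[OF X] .
  then show i': "integrable M (\<lambda>x. \<bar>X x\<bar>)" by simp
  have "0 \<le> variance (\<lambda>x. \<bar>X x\<bar>)" by simp
  also have "\<dots> = (\<integral>x. (X x)\<^sup>2 \<partial>M) - (\<integral>x. \<bar>X x\<bar> \<partial>M)\<^sup>2"
    using variance_eq[OF i'] X by simp
  finally show "(\<integral>x. \<bar>X x\<bar> \<partial>M) \<le> sqrt (\<integral>x. (X x)\<^sup>2 \<partial>M)"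
    by (intro real_le_rsqrt) simp
qed

text \<open>In the fourfold sum only index patterns without an isolated index survive: both
  \<open>a\<close> against both \<open>b\<close>, the two ways of matching each \<open>a\<close>
  with a \<open>b\<close>, and the diagonal. The proof obtains this by recursion in \<open>n\<close>
  instead of counting patterns.\<close>

lemma partial_sum_product_moment:
  fixes a b :: "'a \<Rightarrow> real"
  assumes a: "bnd a" and b: "bnd b" and Ea: "E r a = 0" and Eb: "E r b = 0"
  shows "(\<integral>\<omega>. (\<Sum>i<n. a (\<omega> i))\<^sup>2 * (\<Sum>i<n. b (\<omega> i))\<^sup>2 \<partial>sample r) =
    n * (real n - 1) * (E r (\<lambda>y. (a y)\<^sup>2) * E r (\<lambda>y. (b y)\<^sup>2) + 2 * (E r (\<lambda>y. a y * b y))\<^sup>2)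
    + n * E r (\<lambda>y. (a y)\<^sup>2 * (b y)\<^sup>2)"
proof -
  interpret P: prob_space "sample r" by (rule prob_space_sample)
  let ?A = "\<lambda>n (\<omega> :: nat \<Rightarrow> 'a). \<Sum>i<n. a (\<omega> i)" and ?B = "\<lambda>n (\<omega> :: nat \<Rightarrow> 'a). \<Sum>i<n. b (\<omega> i)"
  have bA: "bnd (?A n)" and bB: "bnd (?B n)" for n
    by (intro bnd_sum bnd_comp[OF a] bnd_comp[OF b])+
  have iA: "integrable (measure_pmf r) a" "integrable (measure_pmf r) b"
    "integrable (measure_pmf r) (\<lambda>y. (a y)\<^sup>2)" "integrable (measure_pmf r) (\<lambda>y. (b y)\<^sup>2)"
    "integrable (measure_pmf r) (\<lambda>y. a y * b y)"
    "integrable (measure_pmf r) (\<lambda>y. (a y)\<^sup>2 * b y)" "integrable (measure_pmf r) (\<lambda>y. a y * (b y)\<^sup>2)"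
    "integrable (measure_pmf r) (\<lambda>y. (a y)\<^sup>2 * (b y)\<^sup>2)"
    using a b by (auto intro!: measure_pmf.integrable_bnd)
  define S where "S i j n = (\<integral>\<omega>. ?A n \<omega> ^ i * ?B n \<omega> ^ j \<partial>sample r)" for i j n
  have mom: "S 1 0 n = 0" "S 0 1 n = 0" "S 2 0 n = n * E r (\<lambda>y. (a y)\<^sup>2)"
    "S 0 2 n = n * E r (\<lambda>y. (b y)\<^sup>2)" for n
    using partial_sum_moments[of r a n] partial_sum_moments[of r b n] iA Ea Eb
    by (auto simp: S_def)
  have meas: "(\<lambda>\<omega>. ?A n \<omega> ^ i * ?B n \<omega> ^ j) \<in> borel_measurable (PiM {..<n} (\<lambda>_. measure_pmf r))" for i j n
    by (intro borel_measurable_times borel_measurable_power borel_measurable_sum;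
        rule measurable_compose[OF measurable_component_singleton]) auto
  have dep: "?A n (restrict \<omega> {..<n}) ^ i * ?B n (restrict \<omega> {..<n}) ^ j = ?A n \<omega> ^ i * ?B n \<omega> ^ j" for \<omega> i j n
    by simp
  have int: "integrable (sample r) (\<lambda>\<omega>. ?A n \<omega> ^ i * ?B n \<omega> ^ j)" for n i j
    using bA bB by (intro P.integrable_bnd bnd_mult bnd_power borel_measurable_times
        borel_measurable_power borel_measurable_sum measurable_sample_coord)
  note f = sample_past_next_indep[OF meas dep int]
  \<comment> \<open>Named functions keep the nine products opaque, so that linearity of the integral
    acts on them termwise.\<close>
  define T where "T i j n \<omega> = ?A n \<omega> ^ i * ?B n \<omega> ^ j" for i j n \<omega>
  define X where "X i j n \<psi> \<omega> = T i j n \<omega> * \<psi> (\<omega> n)" for i j n \<psi> \<omega>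
  have T: "integrable (sample r) (T i j n)" "integral\<^sup>L (sample r) (T i j n) = S i j n" for i j n
    using int by (simp_all add: T_def[abs_def] S_def)
  have X: "integrable (sample r) (X i j n \<psi>)"
    "integral\<^sup>L (sample r) (X i j n \<psi>) = S i j n * E r \<psi>"
    if "integrable (measure_pmf r) \<psi>" for \<psi> i j n
    using f[OF that] by (auto simp: S_def X_def[abs_def] T_def)
  have S00: "S 0 0 n = 1" for n using P.prob_space by (simp add: S_def)
  have AB: "S 1 1 n = n * E r (\<lambda>y. a y * b y)" for n
  proof (induction n)
    case 0 then show ?case by (simp add: S_def)
  next
    case (Suc n)
    have "T 1 1 (Suc n) \<omega> = T 1 1 n \<omega> + (X 1 0 n b \<omega> + (X 0 1 n a \<omega> + X 0 0 n (\<lambda>y. a y * b y) \<omega>))" for \<omega>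
      by (simp add: T_def X_def algebra_simps)
    then have "T 1 1 (Suc n) = (\<lambda>\<omega>. T 1 1 n \<omega> + (X 1 0 n b \<omega> + (X 0 1 n a \<omega> + X 0 0 n (\<lambda>y. a y * b y) \<omega>)))"
      by (rule ext)
    then have "S 1 1 (Suc n) = (\<integral>\<omega>. T 1 1 n \<omega> + (X 1 0 n b \<omega> + (X 0 1 n a \<omega> + X 0 0 n (\<lambda>y. a y * b y) \<omega>)) \<partial>sample r)"
      by (simp only: T(2)[symmetric])
    also have "\<dots> = S 1 1 n + (S 1 0 n * E r b + (S 0 1 n * E r a + S 0 0 n * E r (\<lambda>y. a y * b y)))"
      using T X iA by simp
    finally show ?case using Suc by (simp add: Ea Eb S00 algebra_simps)
  qed
  have "S 2 2 n = n * (real n - 1) * (E r (\<lambda>y. (a y)\<^sup>2) * E r (\<lambda>y. (b y)\<^sup>2) + 2 * (E r (\<lambda>y. a y * b y))\<^sup>2)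
    + n * E r (\<lambda>y. (a y)\<^sup>2 * (b y)\<^sup>2)" for n
  proof (induction n)
    case 0 then show ?case by (simp add: S_def)
  next
    case (Suc n)
    \<comment> \<open>Expansion of \<open>(A + a)\<^sup>2 * (B + b)\<^sup>2\<close>. The terms with
      \<open>E r a\<close>, \<open>E r b\<close>, \<open>S 1 0\<close> or \<open>S 0 1\<close>
      vanish, and the one with \<open>4 * S 1 1\<close> yields the squared covariance.\<close>
    let ?W = "\<lambda>\<omega>. T 2 2 n \<omega> + (2 * X 2 1 n b \<omega> + (X 2 0 n (\<lambda>y. (b y)\<^sup>2) \<omega>
      + (2 * X 1 2 n a \<omega> + (4 * X 1 1 n (\<lambda>y. a y * b y) \<omega> + (2 * X 1 0 n (\<lambda>y. a y * (b y)\<^sup>2) \<omega>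
      + (X 0 2 n (\<lambda>y. (a y)\<^sup>2) \<omega> + (2 * X 0 1 n (\<lambda>y. (a y)\<^sup>2 * b y) \<omega>
      + X 0 0 n (\<lambda>y. (a y)\<^sup>2 * (b y)\<^sup>2) \<omega>)))))))"
    have "T 2 2 (Suc n) \<omega> = ?W \<omega>" for \<omega>
      by (simp add: T_def X_def power2_eq_square algebra_simps)
    then have "T 2 2 (Suc n) = ?W"
      by (rule ext)
    then have "S 2 2 (Suc n) = (\<integral>\<omega>. ?W \<omega> \<partial>sample r)"
      by (simp only: T(2)[symmetric])
    also have "\<dots> = S 2 2 n + (2 * (S 2 1 n * E r b) + (S 2 0 n * E r (\<lambda>y. (b y)\<^sup>2) +
      (2 * (S 1 2 n * E r a) + (4 * (S 1 1 n * E r (\<lambda>y. a y * b y)) +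
      (2 * (S 1 0 n * E r (\<lambda>y. a y * (b y)\<^sup>2)) + (S 0 2 n * E r (\<lambda>y. (a y)\<^sup>2) +
      (2 * (S 0 1 n * E r (\<lambda>y. (a y)\<^sup>2 * b y)) + S 0 0 n * E r (\<lambda>y. (a y)\<^sup>2 * (b y)\<^sup>2))))))))"
      using T X iA by simp
    finally show ?case using Suc by (simp add: mom mom[unfolded One_nat_def] AB[unfolded One_nat_def] S00 Ea Eb algebra_simps power2_eq_square)
  qed
  from this[of n] show ?thesis by (simp add: S_def)
qed

text \<open>Disjoint supports make the mixed fourth moment a product of second moments, up to a
  constant; for overlapping supports this fails for unbounded \<open>n E (g\<^sup>2 h\<^sup>2)\<close>.\<close>

lemma emp_disjoint_product_moment:
  fixes g h :: "'a \<Rightarrow> real"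
  assumes g: "bnd g" and h: "bnd h" and disj: "\<And>y. g y * h y = 0"
  shows "integrable (sample r) (\<lambda>\<omega>. (emp r g n \<omega>)\<^sup>2 * (emp r h n \<omega>)\<^sup>2)"
    and "(\<integral>\<omega>. (emp r g n \<omega>)\<^sup>2 * (emp r h n \<omega>)\<^sup>2 \<partial>sample r)
      \<le> 12 * E r (\<lambda>y. (g y)\<^sup>2) * E r (\<lambda>y. (h y)\<^sup>2)"
proof -
  interpret P: prob_space "sample r" by (rule prob_space_sample)
  define p q where "p = E r g" and "q = E r h"
  define a b where "a y = g y - p" and "b y = h y - q" for y
  define G H where "G = E r (\<lambda>y. (g y)\<^sup>2)" and "H = E r (\<lambda>y. (h y)\<^sup>2)"
  have bab: "bnd a" "bnd b" using g h by (auto simp: a_def[abs_def] b_def[abs_def])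
  have ig: "integrable (measure_pmf r) g" "integrable (measure_pmf r) h"
    "integrable (measure_pmf r) (\<lambda>y. (g y)\<^sup>2)" "integrable (measure_pmf r) (\<lambda>y. (h y)\<^sup>2)"
    using g h by (auto intro!: measure_pmf.integrable_bnd)
  have E0: "E r a = 0" "E r b = 0"
    unfolding a_def[abs_def] b_def[abs_def] using ig by (auto simp: p_def q_def)
  have emp: "(emp r g n \<omega>)\<^sup>2 * (emp r h n \<omega>)\<^sup>2 =
    (\<Sum>i<n. a (\<omega> i))\<^sup>2 * (\<Sum>i<n. b (\<omega> i))\<^sup>2 / (real n)\<^sup>2" for \<omega>
    by (simp add: emp_def a_def b_def p_def q_def power_divide power2_eq_square)
  show "integrable (sample r) (\<lambda>\<omega>. (emp r g n \<omega>)\<^sup>2 * (emp r h n \<omega>)\<^sup>2)"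
    unfolding emp
    by (intro P.integrable_bnd integrable_divide bnd_mult bnd_power bnd_sum
        bnd_comp[OF bab(1)] bnd_comp[OF bab(2)] borel_measurable_times
        borel_measurable_power borel_measurable_sum measurable_sample_coord)
  have G0: "0 \<le> G" "0 \<le> H" by (auto simp: G_def H_def)
  have vg: "E r (\<lambda>y. (a y)\<^sup>2) = G - p\<^sup>2" "E r (\<lambda>y. (b y)\<^sup>2) = H - q\<^sup>2"
    using measure_pmf.variance_eq[OF ig(1,3)] measure_pmf.variance_eq[OF ig(2,4)]
    by (simp_all add: a_def b_def p_def q_def G_def H_def)
  have "0 \<le> E r (\<lambda>y. (a y)\<^sup>2)" "0 \<le> E r (\<lambda>y. (b y)\<^sup>2)" by auto
  then have pG: "p\<^sup>2 \<le> G" "q\<^sup>2 \<le> H" using vg by auto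
  \<comment> \<open>Disjointness enters here: \<open>g y * h y\<close> drops out, and every
    remaining term carries a factor \<open>p\<close> or \<open>q\<close>, whose squares are at most
    \<open>G\<close> and \<open>H\<close>.\<close>
  have ab: "a y * b y = - q * g y - p * h y + p * q" for y
    using disj[of y] by (simp add: a_def b_def algebra_simps)
  have "E r (\<lambda>y. a y * b y) = - (p * q)"
    unfolding ab using ig by (simp add: p_def[symmetric] q_def[symmetric])
  then have Eab: "(E r (\<lambda>y. a y * b y))\<^sup>2 \<le> G * H"
    using mult_mono[OF pG] G0 by (simp add: power_mult_distrib)
  have sq: "(u + v + w)\<^sup>2 \<le> 3 * (u\<^sup>2 + v\<^sup>2 + w\<^sup>2)" for u v w :: real
    using sum_squares_ge_zero[of "u - v" "v - w"] zero_le_power2[of "u - w"]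
    by (simp add: power2_eq_square algebra_simps)
  have abb: "(a y)\<^sup>2 * (b y)\<^sup>2 \<le> 3 * (q\<^sup>2 * (g y)\<^sup>2 + p\<^sup>2 * (h y)\<^sup>2 + p\<^sup>2 * q\<^sup>2)" for y
    using sq[of "- q * g y" "- p * h y" "p * q"]
    by (simp add: power_mult_distrib[symmetric] ab)
  have "E r (\<lambda>y. (a y)\<^sup>2 * (b y)\<^sup>2) \<le> E r (\<lambda>y. 3 * (q\<^sup>2 * (g y)\<^sup>2 + p\<^sup>2 * (h y)\<^sup>2 + p\<^sup>2 * q\<^sup>2))"
    using bab g h by (intro integral_mono abb measure_pmf.integrable_bnd bnd_mult bnd_add bnd_power) auto
  also have "\<dots> = 3 * (q\<^sup>2 * G + p\<^sup>2 * H + p\<^sup>2 * q\<^sup>2)"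
    using ig by (simp add: G_def H_def)
  also have "\<dots> \<le> 3 * (H * G + G * H + G * H)"
    using pG G0 by (intro mult_left_mono add_mono mult_mono) auto
  finally have k: "E r (\<lambda>y. (a y)\<^sup>2 * (b y)\<^sup>2) \<le> 9 * (G * H)" by simp
  have al: "E r (\<lambda>y. (a y)\<^sup>2) * E r (\<lambda>y. (b y)\<^sup>2) \<le> G * H"
    unfolding vg using G0 pG by (intro mult_mono) auto
  show "(\<integral>\<omega>. (emp r g n \<omega>)\<^sup>2 * (emp r h n \<omega>)\<^sup>2 \<partial>sample r)
      \<le> 12 * E r (\<lambda>y. (g y)\<^sup>2) * E r (\<lambda>y. (h y)\<^sup>2)"
  proof (cases "n = 0")
    case False
    have GH: "0 \<le> G * H" using G0 by simp
    have "(\<integral>\<omega>. (\<Sum>i<n. a (\<omega> i))\<^sup>2 * (\<Sum>i<n. b (\<omega> i))\<^sup>2 \<partial>sample r)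
      \<le> real n * (real n - 1) * (G * H + 2 * (G * H)) + n * (9 * (G * H))"
      unfolding partial_sum_product_moment[OF bab E0]
      using Eab k al False by (intro add_mono mult_left_mono) auto
    \<comment> \<open>The constant 12 is 3 for the pairs of distinct indices plus 9 for the
      diagonal, where \<open>n \<le> n\<^sup>2\<close> supplies the missing factor.\<close>
    also have "\<dots> = 3 * (real n * (real n - 1) * (G * H)) + 9 * (n * (G * H))" by (simp add: algebra_simps)
    also have "\<dots> \<le> 3 * ((real n)\<^sup>2 * (G * H)) + 9 * ((real n)\<^sup>2 * (G * H))"
      using GH False by (intro add_mono mult_left_mono mult_right_mono)
        (auto simp: power2_eq_square)
    finally show ?thesis
      unfolding emp using False
      by (simp add: field_simps G_def[symmetric] H_def[symmetric])
  qed (auto simp: G_def[symmetric] H_def[symmetric] G0)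
qed

section \<open>Gaussian vectors with multinomial covariance\<close>

definition gauss :: "(nat \<Rightarrow> real) measure" where
  "gauss = PiM UNIV (\<lambda>_. std_normal_distribution)"

lemma prob_space_std_normal: "prob_space std_normal_distribution"
  using real_dist_normal_dist by (simp add: real_distribution_def)

lemma prob_space_gauss: "prob_space gauss"
  unfolding gauss_def by (rule prob_space_PiM) (rule prob_space_std_normal)

lemma space_gauss [simp]: "space gauss = UNIV"
  by (simp add: gauss_def space_PiM)

lemma measurable_gauss_coord [measurable]: "(\<lambda>\<omega>. \<omega> j) \<in> borel_measurable gauss"
proof -
  have "(\<lambda>\<omega>. \<omega> j) \<in> measurable gauss std_normal_distribution"
    unfolding gauss_def by (rule measurable_component_singleton) simp
  then show ?thesis by (simp cong: measurable_cong_sets)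
qed

lemma indep_vars_gauss:
  "prob_space.indep_vars gauss (\<lambda>_. std_normal_distribution) (\<lambda>i \<omega>. \<omega> i) UNIV"
  unfolding gauss_def by (rule indep_vars_PiM_coords[OF prob_space_std_normal])

lemma gauss_coord_integral:
  fixes \<psi> :: "real \<Rightarrow> 'c::{banach, second_countable_topology}"
  assumes "\<psi> \<in> borel_measurable borel"
  shows "(\<integral>\<omega>. \<psi> (\<omega> i) \<partial>gauss) = integral\<^sup>L std_normal_distribution \<psi>"
  unfolding gauss_def using assms
  by (intro PiM_coord_integral(1)[OF prob_space_std_normal]) (simp cong: measurable_cong_sets)

text \<open>Stated with a scaled standard normal variable so that zero variance needs no special case.\<close>

lemma gauss_linear_law:
  "distr gauss borel (\<lambda>\<omega>. \<Sum>j<k. c j * \<omega> j) =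
    distr std_normal_distribution borel (\<lambda>u. sqrt (\<Sum>j<k. (c j)\<^sup>2) * u)"
proof (rule Levy_uniqueness)
  interpret G: prob_space gauss by (rule prob_space_gauss)
  interpret N: prob_space std_normal_distribution by (rule prob_space_std_normal)
  show "real_distribution (distr gauss borel (\<lambda>\<omega>. \<Sum>j<k. c j * \<omega> j))"
    by (intro G.real_distribution_distr borel_measurable_sum borel_measurable_times
        borel_measurable_const measurable_gauss_coord)
  show "real_distribution (distr std_normal_distribution borel (\<lambda>u. sqrt (\<Sum>j<k. (c j)\<^sup>2) * u))"
    by (intro N.real_distribution_distr) simp
  have charN: "(CLINT u|std_normal_distribution. iexp (s * u)) = complex_of_real (exp (- (s^2) / 2))" for s
    using char_std_normal_distribution by (simp add: char_def fun_eq_iff)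
  show "char (distr gauss borel (\<lambda>\<omega>. \<Sum>j<k. c j * \<omega> j)) =
    char (distr std_normal_distribution borel (\<lambda>u. sqrt (\<Sum>j<k. (c j)\<^sup>2) * u))"
  proof
    fix t
    have ind: "G.indep_vars (\<lambda>_. borel) (\<lambda>j \<omega>. c j * \<omega> j) {..<k}"
      by (rule G.indep_vars_subset[OF G.indep_vars_compose2[OF indep_vars_gauss]]) auto
    have one: "char (distr gauss borel (\<lambda>\<omega>. c j * \<omega> j)) t = complex_of_real (exp (- ((t * c j)^2) / 2))" for j
    proof -
      have "char (distr gauss borel (\<lambda>\<omega>. c j * \<omega> j)) t = (CLINT \<omega>|gauss. iexp (t * (c j * \<omega> j)))"
        unfolding char_def by (subst integral_distr) auto
      also have "\<dots> = (CLINT u|std_normal_distribution. iexp (t * (c j * u)))"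
        by (rule gauss_coord_integral) measurable
      also have "\<dots> = complex_of_real (exp (- ((t * c j)^2) / 2))"
        using charN[of "t * c j"] by (simp add: mult.assoc)
      finally show ?thesis .
    qed
    have "char (distr gauss borel (\<lambda>\<omega>. \<Sum>j<k. c j * \<omega> j)) t = (\<Prod>j<k. complex_of_real (exp (- ((t * c j)^2) / 2)))"
      by (simp add: G.char_distr_sum[OF ind] one)
    also have "\<dots> = complex_of_real (exp (\<Sum>j<k. - ((t * c j)^2) / 2))"
      by (simp add: exp_sum)
    also have "(\<Sum>j<k. - ((t * c j)^2) / 2) = - ((t * sqrt (\<Sum>j<k. (c j)\<^sup>2))\<^sup>2) / 2"
      by (simp add: power_mult_distrib sum_nonneg sum_distrib_left[symmetric] sum_negf
          sum_divide_distrib[symmetric])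
    also have "complex_of_real (exp \<dots>) = (CLINT u|std_normal_distribution. iexp (t * (sqrt (\<Sum>j<k. (c j)\<^sup>2) * u)))"
      using charN[of "t * sqrt (\<Sum>j<k. (c j)\<^sup>2)"] by (simp add: mult.assoc)
    also have "\<dots> = char (distr std_normal_distribution borel (\<lambda>u. sqrt (\<Sum>j<k. (c j)\<^sup>2) * u)) t"
      unfolding char_def by (subst integral_distr) auto
    finally show "char (distr gauss borel (\<lambda>\<omega>. \<Sum>j<k. c j * \<omega> j)) t =
      char (distr std_normal_distribution borel (\<lambda>u. sqrt (\<Sum>j<k. (c j)\<^sup>2) * u)) t" .
  qed
qed

definition tail_mass :: "(nat \<Rightarrow> real) \<Rightarrow> nat \<Rightarrow> real" where
  "tail_mass \<rho> k = 1 - (\<Sum>j<k. \<rho> j)"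

text \<open>Partial sums of a Gaussian vector with the multinomial covariance
  \<open>\<rho> i * \<delta> i j - \<rho> i * \<rho> j\<close>: a discretely sampled Brownian bridge, generated from independent
  normals by its Markov property.\<close>

primrec bridge :: "(nat \<Rightarrow> real) \<Rightarrow> (nat \<Rightarrow> real) \<Rightarrow> nat \<Rightarrow> real" where
  "bridge \<rho> \<omega> 0 = 0"
| "bridge \<rho> \<omega> (Suc k) = tail_mass \<rho> (Suc k) / tail_mass \<rho> k * bridge \<rho> \<omega> k
     + sqrt (\<rho> k * tail_mass \<rho> (Suc k) / tail_mass \<rho> k) * \<omega> k"

definition bridge_step :: "(nat \<Rightarrow> real) \<Rightarrow> (nat \<Rightarrow> real) \<Rightarrow> nat \<Rightarrow> real" where
  "bridge_step \<rho> \<omega> j = bridge \<rho> \<omega> (Suc j) - bridge \<rho> \<omega> j"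

lemma sum_bridge_step: "(\<Sum>j<k. bridge_step \<rho> \<omega> j) = bridge \<rho> \<omega> k"
  unfolding bridge_step_def by (subst sum_lessThan_telescope) simp

lemma bridge_measurable: "(\<lambda>\<omega>. bridge \<rho> \<omega> k) \<in> borel_measurable gauss"
  by (induction k) auto

lemma bridge_step_measurable [measurable]: "(\<lambda>\<omega>. bridge_step \<rho> \<omega> j) \<in> borel_measurable gauss"
  using bridge_measurable[of \<rho> "Suc j"] bridge_measurable[of \<rho> j]
  unfolding bridge_step_def by (rule borel_measurable_diff)

lemma bridge_step_vector_measurable [measurable]: "bridge_step \<rho> \<in> borel_measurable gauss"
  by (rule measurable_coordinatewise_then_product) (rule bridge_step_measurable)

text \<open>Peels off the last innovation. Step \<open>k\<close> is \<open>- (\<rho> k / T)\<close>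
  times the sum of the earlier steps plus a multiple of the fresh normal \<open>\<omega> k\<close>,
  so it can be traded for a shift of the earlier coefficients by \<open>a\<close>; hence the
  induction with arbitrary \<open>t\<close>.\<close>

lemma bridge_linear:
  assumes nn: "\<And>j. 0 \<le> \<rho> j" and le1: "\<And>k. (\<Sum>j<k. \<rho> j) \<le> 1"
  shows "\<exists>c. (\<forall>\<omega>. (\<Sum>j<k. t j * bridge_step \<rho> \<omega> j) = (\<Sum>j<k. c j * \<omega> j)) \<and>
    (\<Sum>j<k. (c j)\<^sup>2) = (\<Sum>j<k. (t j)\<^sup>2 * \<rho> j) - (\<Sum>j<k. t j * \<rho> j)\<^sup>2"
proof (induction k arbitrary: t)
  case 0
  show ?case by auto
next
  case (Suc k)
  define T where "T = tail_mass \<rho> k"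
  have T: "tail_mass \<rho> (Suc k) = T - \<rho> k" "T = 1 - (\<Sum>j<k. \<rho> j)"
    by (auto simp: T_def tail_mass_def)
  have pos: "0 \<le> T - \<rho> k" "0 \<le> T"
    using le1[of "Suc k"] le1[of k] by (auto simp: T)
  define a where "a = t k * \<rho> k / T"
  obtain c where c: "\<And>\<omega>. (\<Sum>j<k. (t j - a) * bridge_step \<rho> \<omega> j) = (\<Sum>j<k. c j * \<omega> j)"
    "(\<Sum>j<k. (c j)\<^sup>2) = (\<Sum>j<k. (t j - a)\<^sup>2 * \<rho> j) - (\<Sum>j<k. (t j - a) * \<rho> j)\<^sup>2"
    using Suc[of "\<lambda>j. t j - a"] by auto
  define s where "s = sqrt (\<rho> k * (T - \<rho> k) / T)"
  define c' where "c' = c(k := t k * s)"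
  have c'k: "(\<Sum>j<k. c' j * \<omega> j) = (\<Sum>j<k. c j * \<omega> j)" "(\<Sum>j<k. (c' j)\<^sup>2) = (\<Sum>j<k. (c j)\<^sup>2)" for \<omega>
    by (auto simp: c'_def)
  have step: "bridge_step \<rho> \<omega> k = - (\<rho> k / T) * bridge \<rho> \<omega> k + s * \<omega> k" for \<omega>
  \<comment> \<open>When no mass is left, the quotients in the recursion are divisions by 0 and
    evaluate to 0; the bridge itself has by then returned to 0.\<close>
  proof (cases "T = 0")
    case True
    then have "\<rho> k = 0" using pos nn[of k] by simp
    have "bridge \<rho> \<omega> k = 0"
      using True by (cases k) (auto simp: T_def tail_mass_def)
    then show ?thesis
      using True \<open>\<rho> k = 0\<close> by (simp add: bridge_step_def s_def)
  next
    case False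
    then show ?thesis
      by (simp add: bridge_step_def s_def T(1) T_def[symmetric] field_simps)
  qed
  have lin: "(\<Sum>j<Suc k. t j * bridge_step \<rho> \<omega> j) = (\<Sum>j<Suc k. c' j * \<omega> j)" for \<omega>
  proof -
    have "(\<Sum>j<Suc k. t j * bridge_step \<rho> \<omega> j) =
      (\<Sum>j<k. t j * bridge_step \<rho> \<omega> j) - a * (\<Sum>j<k. bridge_step \<rho> \<omega> j) + t k * s * \<omega> k"
      by (simp add: step sum_bridge_step a_def algebra_simps)
    also have "\<dots> = (\<Sum>j<k. (t j - a) * bridge_step \<rho> \<omega> j) + t k * s * \<omega> k"
      by (simp add: left_diff_distrib sum_subtractf sum_distrib_left)
    finally show ?thesis by (simp add: c c'k) (simp add: c'_def)
  qed
  define P Q where "P = (\<Sum>j<k. (t j)\<^sup>2 * \<rho> j)" and "Q = (\<Sum>j<k. t j * \<rho> j)"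
  have R: "(\<Sum>j<k. \<rho> j) = 1 - T" by (simp add: T)
  have e1: "(\<Sum>j<k. (t j - a)\<^sup>2 * \<rho> j) = P - 2 * a * Q + a\<^sup>2 * (1 - T)"
    unfolding P_def Q_def R[symmetric]
    by (simp add: power2_diff algebra_simps sum.distrib sum_subtractf sum_distrib_left sum_distrib_right)
  have e2: "(\<Sum>j<k. (t j - a) * \<rho> j) = Q - a * (1 - T)"
    unfolding Q_def R[symmetric]
    by (simp add: algebra_simps sum_subtractf sum_distrib_left sum_distrib_right)
  have s2: "s\<^sup>2 = \<rho> k * (T - \<rho> k) / T"
    using pos nn[of k] by (simp add: s_def)
  have "(\<Sum>j<Suc k. (c' j)\<^sup>2) = P - 2 * a * Q + a\<^sup>2 * (1 - T) - (Q - a * (1 - T))\<^sup>2 + (t k)\<^sup>2 * s\<^sup>2"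
    by (simp add: c'k c(2) e1 e2) (simp add: c'_def power_mult_distrib)
  also have "\<dots> = P + (t k)\<^sup>2 * \<rho> k - (Q + t k * \<rho> k)\<^sup>2"
  proof (cases "T = 0")
    case True
    then have "\<rho> k = 0" using pos nn[of k] by simp
    then show ?thesis by (simp add: True a_def s2)
  next
    case False
    have aT: "a * T = t k * \<rho> k" using False by (simp add: a_def)
    have sT: "(t k)\<^sup>2 * s\<^sup>2 = (t k)\<^sup>2 * \<rho> k - a * T * a"
      using False unfolding s2 a_def by (simp add: field_simps power2_eq_square)
    have "P - 2 * a * Q + a\<^sup>2 * (1 - T) - (Q - a * (1 - T))\<^sup>2 + ((t k)\<^sup>2 * \<rho> k - a * T * a)
      = P + (t k)\<^sup>2 * \<rho> k - (Q + a * T)\<^sup>2"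
      by (simp add: power2_eq_square algebra_simps)
    then show ?thesis by (simp add: sT aT)
  qed
  also have "\<dots> = (\<Sum>j<Suc k. (t j)\<^sup>2 * \<rho> j) - (\<Sum>j<Suc k. t j * \<rho> j)\<^sup>2"
    by (simp add: P_def Q_def)
  finally show ?case using lin by blast
qed

lemma bridge_linear_law:
  assumes nn: "\<And>j. 0 \<le> \<rho> j" and le1: "\<And>k. (\<Sum>j<k. \<rho> j) \<le> 1"
  shows "distr gauss borel (\<lambda>\<omega>. \<Sum>j<k. t j * bridge_step \<rho> \<omega> j) =
    distr std_normal_distribution borel (\<lambda>u. sqrt ((\<Sum>j<k. (t j)\<^sup>2 * \<rho> j) - (\<Sum>j<k. t j * \<rho> j)\<^sup>2) * u)"
proof -
  obtain c where "\<And>\<omega>. (\<Sum>j<k. t j * bridge_step \<rho> \<omega> j) = (\<Sum>j<k. c j * \<omega> j)"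
    "(\<Sum>j<k. (c j)\<^sup>2) = (\<Sum>j<k. (t j)\<^sup>2 * \<rho> j) - (\<Sum>j<k. t j * \<rho> j)\<^sup>2"
    using bridge_linear[OF assms] by blast
  then show ?thesis using gauss_linear_law[where c=c and k=k] by simp
qed

lemma bridge_linear_measurable:
  "(\<lambda>\<omega>. \<Sum>j<k. t j * bridge_step \<rho> \<omega> j) \<in> borel_measurable gauss"
  by (intro borel_measurable_sum borel_measurable_times borel_measurable_const bridge_step_measurable)

lemma bridge_linear_integral:
  fixes \<phi> :: "real \<Rightarrow> real" and t :: "nat \<Rightarrow> real" and k :: nat
  assumes "\<And>j. 0 \<le> \<rho> j" and "\<And>k. (\<Sum>j<k. \<rho> j) \<le> 1" and [measurable]: "\<phi> \<in> borel_measurable borel"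
  defines "\<sigma> \<equiv> sqrt ((\<Sum>j<k. (t j)\<^sup>2 * \<rho> j) - (\<Sum>j<k. t j * \<rho> j)\<^sup>2)"
  shows "(\<integral>\<omega>. \<phi> (\<Sum>j<k. t j * bridge_step \<rho> \<omega> j) \<partial>gauss) = (\<integral>u. \<phi> (\<sigma> * u) \<partial>std_normal_distribution)"
    and "integrable gauss (\<lambda>\<omega>. \<phi> (\<Sum>j<k. t j * bridge_step \<rho> \<omega> j)) \<longleftrightarrow>
      integrable std_normal_distribution (\<lambda>u. \<phi> (\<sigma> * u))"
proof -
  note law = bridge_linear_law[OF assms(1,2), where k=k and t=t, folded \<sigma>_def]
  have "(\<integral>\<omega>. \<phi> (\<Sum>j<k. t j * bridge_step \<rho> \<omega> j) \<partial>gauss) =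
    integral\<^sup>L (distr gauss borel (\<lambda>\<omega>. \<Sum>j<k. t j * bridge_step \<rho> \<omega> j)) \<phi>"
    by (rule integral_distr[OF bridge_linear_measurable assms(3), symmetric])
  also have "\<dots> = (\<integral>u. \<phi> (\<sigma> * u) \<partial>std_normal_distribution)"
    unfolding law by (subst integral_distr) simp_all
  finally show "(\<integral>\<omega>. \<phi> (\<Sum>j<k. t j * bridge_step \<rho> \<omega> j) \<partial>gauss) = (\<integral>u. \<phi> (\<sigma> * u) \<partial>std_normal_distribution)" .
  have "integrable gauss (\<lambda>\<omega>. \<phi> (\<Sum>j<k. t j * bridge_step \<rho> \<omega> j)) \<longleftrightarrow>
    integrable (distr gauss borel (\<lambda>\<omega>. \<Sum>j<k. t j * bridge_step \<rho> \<omega> j)) \<phi>"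
    by (rule integrable_distr_eq[OF bridge_linear_measurable assms(3), symmetric])
  also have "\<dots> \<longleftrightarrow> integrable std_normal_distribution (\<lambda>u. \<phi> (\<sigma> * u))"
    unfolding law by (subst integrable_distr_eq) simp_all
  finally show "integrable gauss (\<lambda>\<omega>. \<phi> (\<Sum>j<k. t j * bridge_step \<rho> \<omega> j)) \<longleftrightarrow>
      integrable std_normal_distribution (\<lambda>u. \<phi> (\<sigma> * u))" .
qed

text \<open>One step is the linear form with a unit coefficient vector, hence normal with variance
  \<open>\<rho> j * (1 - \<rho> j)\<close>; \<open>sqrt (2 / pi)\<close> is the first absolute
  moment of a standard normal variable.\<close>

lemma bridge_step_moments:
  assumes "\<And>j. 0 \<le> \<rho> j" and "\<And>k. (\<Sum>j<k. \<rho> j) \<le> 1"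
  shows "integrable gauss (\<lambda>\<omega>. (bridge_step \<rho> \<omega> j)\<^sup>2)"
    and "(\<integral>\<omega>. (bridge_step \<rho> \<omega> j)\<^sup>2 \<partial>gauss) = \<rho> j * (1 - \<rho> j)"
    and "integrable gauss (\<lambda>\<omega>. \<bar>bridge_step \<rho> \<omega> j\<bar>)"
    and "(\<integral>\<omega>. \<bar>bridge_step \<rho> \<omega> j\<bar> \<partial>gauss) = sqrt (2 / pi) * sqrt (\<rho> j * (1 - \<rho> j))"
proof -
  let ?t = "\<lambda>i. if i = j then 1 else (0::real)"
  have one: "(\<Sum>i<Suc j. ?t i * bridge_step \<rho> \<omega> i) = bridge_step \<rho> \<omega> j" for \<omega> by simp
  have var: "(\<Sum>i<Suc j. (?t i)\<^sup>2 * \<rho> i) - (\<Sum>i<Suc j. ?t i * \<rho> i)\<^sup>2 = \<rho> j * (1 - \<rho> j)"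
    by (simp add: power2_eq_square algebra_simps)
  have le: "\<rho> j \<le> 1"
    using assms(2)[of "Suc j"] sum_nonneg[of "{..<j}" \<rho>] assms(1) by simp
  note I = bridge_linear_integral[OF assms, where k="Suc j" and t="?t", unfolded one var]
  have m2: "integrable std_normal_distribution (\<lambda>u. u\<^sup>2)" "(\<integral>u. u\<^sup>2 \<partial>std_normal_distribution) = 1"
    using std_normal_distribution_even_moments[of 1] by auto
  have m1: "integrable std_normal_distribution (\<lambda>u. \<bar>u\<bar>)"
    "(\<integral>u. \<bar>u\<bar> \<partial>std_normal_distribution) = sqrt (2 / pi)"
    using integrable_std_normal_distribution_moment[of 1] std_normal_distribution_odd_moments_abs[of 0] by auto
  show "integrable gauss (\<lambda>\<omega>. (bridge_step \<rho> \<omega> j)\<^sup>2)"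
    using m2 I(2)[of "\<lambda>x. x\<^sup>2"] by (simp add: power_mult_distrib)
  show "(\<integral>\<omega>. (bridge_step \<rho> \<omega> j)\<^sup>2 \<partial>gauss) = \<rho> j * (1 - \<rho> j)"
    using m2 I(1)[of "\<lambda>x. x\<^sup>2"] le assms(1)[of j] by (simp add: power_mult_distrib)
  show "integrable gauss (\<lambda>\<omega>. \<bar>bridge_step \<rho> \<omega> j\<bar>)"
    using m1 I(2)[of "\<lambda>x. \<bar>x\<bar>"] by (simp add: abs_mult)
  show "(\<integral>\<omega>. \<bar>bridge_step \<rho> \<omega> j\<bar> \<partial>gauss) = sqrt (2 / pi) * sqrt (\<rho> j * (1 - \<rho> j))"
    using m1 I(1)[of "\<lambda>x. \<bar>x\<bar>"] le assms(1)[of j] by (simp add: abs_mult)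
qed

text \<open>Cosines with a free phase are a real substitute for the characteristic function.
  Positive variance reduces to the classical theorem for normalised sums; with variance 0 the
  process vanishes almost surely for every \<open>n\<close>.\<close>

lemma emp_CLT_cos:
  fixes a :: "'a \<Rightarrow> real" and r :: "'a pmf"
  assumes a: "bnd a"
  defines "\<sigma> \<equiv> sqrt (E r (\<lambda>y. (a y)\<^sup>2) - (E r a)\<^sup>2)"
  shows "(\<lambda>n. \<integral>\<omega>. cos (emp r a n \<omega> + \<theta>) \<partial>sample r)
    \<longlonglongrightarrow> (\<integral>u. cos (\<sigma> * u + \<theta>) \<partial>std_normal_distribution)"
proof -
  interpret P: prob_space "sample r" by (rule prob_space_sample)
  interpret N: prob_space std_normal_distribution by (rule prob_space_std_normal)
  define b where "b y = a y - E r a" for y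
  have bb: "bnd b" unfolding b_def[abs_def] using a by auto
  have ia: "integrable (measure_pmf r) a" "integrable (measure_pmf r) (\<lambda>y. (a y)\<^sup>2)"
    using a by (auto intro!: measure_pmf.integrable_bnd)
  have ib: "integrable (measure_pmf r) b" "integrable (measure_pmf r) (\<lambda>y. (b y)\<^sup>2)"
    using bb by (auto intro!: measure_pmf.integrable_bnd)
  have Eb: "E r b = 0" unfolding b_def[abs_def] using ia by simp
  have var: "E r (\<lambda>y. (b y)\<^sup>2) = E r (\<lambda>y. (a y)\<^sup>2) - (E r a)\<^sup>2"
    unfolding b_def using measure_pmf.variance_eq[OF ia] .
  have "0 \<le> E r (\<lambda>y. (b y)\<^sup>2)" by simp
  then have v0: "0 \<le> E r (\<lambda>y. (a y)\<^sup>2) - (E r a)\<^sup>2"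
    by (simp only: var)
  then have s2: "\<sigma>\<^sup>2 = E r (\<lambda>y. (b y)\<^sup>2)" by (simp add: \<sigma>_def var)
  have emp: "emp r a n \<omega> = (\<Sum>i<n. b (\<omega> i)) / sqrt n" for n \<omega>
    by (simp add: emp_def b_def)
  show ?thesis
  proof (cases "\<sigma> = 0")
    case True
    have ae0: "AE \<omega> in sample r. emp r a n \<omega> = 0" for n
    proof -
      have eb: "emp r b n \<omega> = emp r a n \<omega>" for \<omega>
        by (simp add: emp) (simp add: emp_def Eb)
      have i: "integrable (sample r) (\<lambda>\<omega>. (emp r a n \<omega>)\<^sup>2)"
        using emp_square(1)[OF ib(2), of n] by (simp add: eb)
      have "(\<integral>\<omega>. (emp r a n \<omega>)\<^sup>2 \<partial>sample r) \<le> 0"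
        using emp_square(2)[OF ib(2), of n] s2 True by (simp add: eb)
      then have "(\<integral>\<omega>. (emp r a n \<omega>)\<^sup>2 \<partial>sample r) = 0"
        by (intro antisym integral_nonneg) auto
      then have "AE \<omega> in sample r. (emp r a n \<omega>)\<^sup>2 = 0"
        using integral_nonneg_eq_0_iff_AE[OF i] by auto
      then show ?thesis by auto
    qed
    have ae: "AE \<omega> in sample r. cos (emp r a n \<omega> + \<theta>) = cos \<theta>" for n
      using ae0[of n] by eventually_elim simp
    have "(\<integral>\<omega>. cos (emp r a n \<omega> + \<theta>) \<partial>sample r) = (\<integral>\<omega>. cos \<theta> \<partial>sample r)" for n
      by (intro integral_cong_AE ae) auto
    then have "(\<integral>\<omega>. cos (emp r a n \<omega> + \<theta>) \<partial>sample r) = (\<integral>u. cos (\<sigma> * u + \<theta>) \<partial>std_normal_distribution)" for n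
      using True by (simp add: P.prob_space[simplified] N.prob_space[simplified])
    then show ?thesis by simp
  next
    case False
    then have spos: "\<sigma> > 0" using v0 by (simp add: \<sigma>_def order.strict_iff_order)
    let ?X = "\<lambda>i (\<omega> :: nat \<Rightarrow> 'a). b (\<omega> i)"
    have wc: "weak_conv_m (\<lambda>n. distr (sample r) borel (\<lambda>\<omega>. (\<Sum>i<n. ?X i \<omega>) / sqrt (n * \<sigma>\<^sup>2))) std_normal_distribution"
    proof (rule P.central_limit_theorem_zero_mean[where \<mu>="distr (measure_pmf r) borel b"])
      show "P.indep_vars (\<lambda>_. borel) ?X UNIV"
        by (rule P.indep_vars_compose2[OF indep_vars_PiM_coords[OF prob_space_measure_pmf]]) auto
      show "P.expectation (?X n) = 0" for n
        using Eb by (simp add: sample_coord_integral)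
      show "integrable (sample r) (\<lambda>\<omega>. (?X n \<omega>)\<^sup>2)" for n
        using ib sample_coord_integral(2)[where \<psi>="\<lambda>y. (b y)\<^sup>2"] by simp
      show "P.variance (?X n) = \<sigma>\<^sup>2" for n
        using Eb sample_coord_integral(1)[where \<psi>="\<lambda>y. (b y)\<^sup>2" and r=r and i=n]
        by (simp add: sample_coord_integral s2)
      show "distr (sample r) borel (?X n) = distr (measure_pmf r) borel b" for n
      proof -
        interpret PP: product_prob_space "\<lambda>_::nat. measure_pmf r" UNIV
          by unfold_locales
        have "distr (sample r) borel (?X n) = distr (distr (sample r) (measure_pmf r) (\<lambda>\<omega>. \<omega> n)) borel b"
          by (subst distr_distr) (auto simp: comp_def)
        then show ?thesis by (simp add: PP.PiM_component)
      qed
    qed (use spos in auto)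
    have meas: "(\<lambda>\<omega>. (\<Sum>i<n. ?X i \<omega>) / sqrt (n * \<sigma>\<^sup>2)) \<in> borel_measurable (sample r)" for n
      by (intro borel_measurable_divide borel_measurable_sum borel_measurable_const measurable_sample_coord)
    have "(\<lambda>n. integral\<^sup>L (distr (sample r) borel (\<lambda>\<omega>. (\<Sum>i<n. ?X i \<omega>) / sqrt (n * \<sigma>\<^sup>2))) (\<lambda>u. cos (\<sigma> * u + \<theta>)))
      \<longlonglongrightarrow> (\<integral>u. cos (\<sigma> * u + \<theta>) \<partial>std_normal_distribution)"
      by (rule weak_conv_imp_integral_bdd_continuous_conv[OF _ real_dist_normal_dist wc, where B=1])
        (auto intro!: P.real_distribution_distr meas)
    moreover have "integral\<^sup>L (distr (sample r) borel (\<lambda>\<omega>. (\<Sum>i<n. ?X i \<omega>) / sqrt (n * \<sigma>\<^sup>2))) (\<lambda>u. cos (\<sigma> * u + \<theta>))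
      = (\<integral>\<omega>. cos (emp r a n \<omega> + \<theta>) \<partial>sample r)" for n
    proof -
      have "\<sigma> * ((\<Sum>i<n. ?X i \<omega>) / sqrt (n * \<sigma>\<^sup>2)) = emp r a n \<omega>" for \<omega>
        using spos by (simp add: emp real_sqrt_mult)
      then show ?thesis by (subst integral_distr[OF meas]) auto
    qed
    ultimately show ?thesis by simp
  qed
qed

section \<open>The multinomial central limit theorem\<close>

text \<open>The labelling \<open>e\<close> may be arbitrary throughout this section, the cells being
  its fibres. Injectivity matters only later, where cells have to be single points.\<close>

definition cell :: "('a \<Rightarrow> nat) \<Rightarrow> 'a pmf \<Rightarrow> nat \<Rightarrow> real" where
  "cell e r j = pmf (map_pmf e r) j"

definition cell_emp :: "('a \<Rightarrow> nat) \<Rightarrow> 'a pmf \<Rightarrow> nat \<Rightarrow> (nat \<Rightarrow> 'a) \<Rightarrow> nat \<Rightarrow> real" where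
  "cell_emp e r n \<omega> j = emp r (\<lambda>y. indicator {j} (e y)) n \<omega>"

lemma cell_nonneg: "0 \<le> cell e r j"
  by (simp add: cell_def)

lemma sum_cell_le: "(\<Sum>j<k. cell e r j) \<le> 1"
  unfolding cell_def by (simp add: measure_measure_pmf_finite[symmetric])

lemma cell_le_1: "cell e r j \<le> 1"
  by (simp add: cell_def pmf_le_1)

lemma expectation_cells:
  fixes u :: "nat \<Rightarrow> real"
  shows "E r (\<lambda>y. if e y < k then u (e y) else 0) = (\<Sum>j<k. u j * cell e r j)"
proof -
  have "E r (\<lambda>y. if e y < k then u (e y) else 0) = E (map_pmf e r) (\<lambda>j. if j < k then u j else 0)"
    by simp
  also have "\<dots> = (\<Sum>j<k. (if j < k then u j else 0) * pmf (map_pmf e r) j)"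
    by (rule integral_measure_pmf_real) (auto split: if_splits)
  finally show ?thesis by (simp add: cell_def)
qed

lemma cell_emp_linear:
  "(\<Sum>j<k. t j * cell_emp e r n \<omega> j) = emp r (\<lambda>y. if e y < k then t (e y) else 0) n \<omega>"
proof -
  have "(\<lambda>y. if e y < k then t (e y) else 0) = (\<lambda>y. \<Sum>j<k. t j * indicator {j} (e y))"
    by (auto simp: fun_eq_iff indicator_def if_distrib cong: if_cong)
  then have "emp r (\<lambda>y. if e y < k then t (e y) else 0) n \<omega> = (\<Sum>j<k. emp r (\<lambda>y. t j * indicator {j} (e y)) n \<omega>)"
    by (simp only:) (intro emp_sum measure_pmf.integrable_bnd, auto intro!: bndI[of _ "\<bar>t _\<bar>"] simp: indicator_def)
  then show ?thesis by (simp add: cell_emp_def emp_cmult)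
qed

lemma cell_emp_measurable [measurable]: "(\<lambda>\<omega>. cell_emp e r n \<omega> j) \<in> borel_measurable (sample r)"
  unfolding cell_emp_def by simp

lemma cell_emp_vector_measurable [measurable]: "cell_emp e r n \<in> borel_measurable (sample r)"
  by (rule measurable_coordinatewise_then_product) simp

lemma cell_emp_square:
  shows "integrable (sample r) (\<lambda>\<omega>. (cell_emp e r n \<omega> j)\<^sup>2)"
    and "(\<integral>\<omega>. (cell_emp e r n \<omega> j)\<^sup>2 \<partial>sample r) \<le> cell e r j"
proof -
  have sq: "(\<lambda>y. (indicator {j} (e y) :: real)\<^sup>2) = (\<lambda>y. indicator {j} (e y))"
    by (auto simp: indicator_def)
  have i: "integrable (measure_pmf r) (\<lambda>y. (indicator {j} (e y) :: real)\<^sup>2)"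
    by (rule measure_pmf.integrable_bnd) (auto intro!: bndI[of _ 1] simp: indicator_def)
  have "E r (\<lambda>y. indicator {j} (e y)) = E r (indicator (e -` {j}))"
    by (rule Bochner_Integration.integral_cong) (auto simp: indicator_def)
  also have "\<dots> = cell e r j"
    by (simp add: cell_def pmf_map)
  finally have "E r (\<lambda>y. (indicator {j} (e y))\<^sup>2) = cell e r j"
    by (simp add: sq)
  then show "integrable (sample r) (\<lambda>\<omega>. (cell_emp e r n \<omega> j)\<^sup>2)"
    "(\<integral>\<omega>. (cell_emp e r n \<omega> j)\<^sup>2 \<partial>sample r) \<le> cell e r j"
    unfolding cell_emp_def using emp_square[OF i, of n] by auto
qed

text \<open>Real trigonometric polynomials in the first \<open>k\<close> coordinates. The phase lets
  a product of two generators be written with sums and differences of their arguments, and each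
  generator involves a single linear form, within reach of the one-dimensional limit
  theorem.\<close>

inductive_set trig :: "nat \<Rightarrow> ((nat \<Rightarrow> real) \<Rightarrow> real) set" for k where
  trig_cos: "(\<lambda>v. c * cos ((\<Sum>j<k. t j * v j) + \<theta>)) \<in> trig k"
| trig_add: "f \<in> trig k \<Longrightarrow> g \<in> trig k \<Longrightarrow> (\<lambda>v. f v + g v) \<in> trig k"

lemma trig_mult:
  assumes f: "f \<in> trig k" and g: "g \<in> trig k"
  shows "(\<lambda>v. f v * g v) \<in> trig k"
  using f
proof induction
  case (trig_cos c t \<theta>)
  show ?case using g
  proof induction
    case (trig_cos c' t' \<theta>')
    have "(\<lambda>v. (c * cos ((\<Sum>j<k. t j * v j) + \<theta>)) * (c' * cos ((\<Sum>j<k. t' j * v j) + \<theta>'))) =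
      (\<lambda>v. (c * c' / 2) * cos ((\<Sum>j<k. (t j - t' j) * v j) + (\<theta> - \<theta>')) +
        (c * c' / 2) * cos ((\<Sum>j<k. (t j + t' j) * v j) + (\<theta> + \<theta>')))"
    proof
      fix v
      have a: "(\<Sum>j<k. (t j - t' j) * v j) + (\<theta> - \<theta>') = ((\<Sum>j<k. t j * v j) + \<theta>) - ((\<Sum>j<k. t' j * v j) + \<theta>')"
        by (simp add: algebra_simps sum_subtractf)
      have b: "(\<Sum>j<k. (t j + t' j) * v j) + (\<theta> + \<theta>') = ((\<Sum>j<k. t j * v j) + \<theta>) + ((\<Sum>j<k. t' j * v j) + \<theta>')"
        by (simp add: algebra_simps sum.distrib)
      show "(c * cos ((\<Sum>j<k. t j * v j) + \<theta>)) * (c' * cos ((\<Sum>j<k. t' j * v j) + \<theta>')) =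
        (c * c' / 2) * cos ((\<Sum>j<k. (t j - t' j) * v j) + (\<theta> - \<theta>')) +
        (c * c' / 2) * cos ((\<Sum>j<k. (t j + t' j) * v j) + (\<theta> + \<theta>'))"
        unfolding a b cos_diff cos_add by (simp add: field_simps)
    qed
    then show ?case
      by (simp only:) (intro trig.intros)
  next
    case (trig_add f g)
    then show ?case
      by (simp only: distrib_left) (rule trig.trig_add)
  qed
next
  case (trig_add f1 f2)
  then show ?case
    by (simp only: distrib_right) (rule trig.trig_add)
qed

lemma trig_continuous: "f \<in> trig k \<Longrightarrow> continuous_on UNIV f"
  by (induction rule: trig.induct) (intro continuous_intros continuous_on_product_coordinates; assumption)+

lemma trig_bnd: "f \<in> trig k \<Longrightarrow> bnd f"
proof (induction rule: trig.induct)
  case (trig_cos c t \<theta>)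
  show ?case
    by (rule bndI[of _ "\<bar>c\<bar>"]) (simp add: abs_mult mult_left_le)
qed auto

lemma continuous_borel_measurable_nat:
  fixes f :: "(nat \<Rightarrow> real) \<Rightarrow> real"
  shows "continuous_on UNIV f \<Longrightarrow> f \<in> borel_measurable borel"
  by (rule borel_measurable_continuous_onI)

text \<open>The Cramer-Wold device: a linear form in the cell counts is the empirical process of one
  function, and the same form in the bridge steps is normal with the matching variance.\<close>

lemma trig_CLT:
  assumes "f \<in> trig k"
  shows "(\<lambda>n. \<integral>\<omega>. f (cell_emp e r n \<omega>) \<partial>sample r) \<longlonglongrightarrow> (\<integral>\<omega>. f (bridge_step (cell e r) \<omega>) \<partial>gauss)"
  using assms
proof induction
  case (trig_cos c t \<theta>)
  let ?a = "\<lambda>y. if e y < k then t (e y) else 0"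
  have b: "bnd ?a"
  proof (rule bndI)
    fix y show "\<bar>?a y\<bar> \<le> (\<Sum>j<k. \<bar>t j\<bar>)"
      by (auto intro: member_le_sum sum_nonneg)
  qed
  have sq: "(\<lambda>y. (?a y)\<^sup>2) = (\<lambda>y. if e y < k then (t (e y))\<^sup>2 else 0)" by auto
  let ?s = "sqrt ((\<Sum>j<k. (t j)\<^sup>2 * cell e r j) - (\<Sum>j<k. t j * cell e r j)\<^sup>2)"
  have "(\<lambda>n. \<integral>\<omega>. cos (emp r ?a n \<omega> + \<theta>) \<partial>sample r) \<longlonglongrightarrow> (\<integral>u. cos (?s * u + \<theta>) \<partial>std_normal_distribution)"
    using emp_CLT_cos[OF b, of r \<theta>] unfolding sq
    by (simp add: expectation_cells[where u=t] expectation_cells[where u="\<lambda>j. (t j)\<^sup>2"])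
  also have "(\<integral>u. cos (?s * u + \<theta>) \<partial>std_normal_distribution) =
    (\<integral>\<omega>. cos ((\<Sum>j<k. t j * bridge_step (cell e r) \<omega> j) + \<theta>) \<partial>gauss)"
    by (rule bridge_linear_integral(1)[OF cell_nonneg sum_cell_le, symmetric]) simp
  finally show ?case
    by (simp add: cell_emp_linear tendsto_mult_left)
next
  case (trig_add f g)
  interpret P: prob_space "sample r" by (rule prob_space_sample)
  interpret G: prob_space gauss by (rule prob_space_gauss)
  have [measurable]: "f \<in> borel_measurable borel" "g \<in> borel_measurable borel"
    using trig_add(1,2) by (auto intro!: continuous_borel_measurable_nat trig_continuous)
  note bf = trig_bnd[OF trig_add(1)] and bg = trig_bnd[OF trig_add(2)]
  have i: "integrable (sample r) (\<lambda>\<omega>. f (cell_emp e r n \<omega>))" "integrable (sample r) (\<lambda>\<omega>. g (cell_emp e r n \<omega>))" for n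
    by (rule P.integrable_bnd[OF bnd_comp[OF bf]] P.integrable_bnd[OF bnd_comp[OF bg]]; measurable)+
  have j: "integrable gauss (\<lambda>\<omega>. f (bridge_step (cell e r) \<omega>))" "integrable gauss (\<lambda>\<omega>. g (bridge_step (cell e r) \<omega>))"
    by (rule G.integrable_bnd[OF bnd_comp[OF bf]] G.integrable_bnd[OF bnd_comp[OF bg]]; measurable)+
  show ?case
    using tendsto_add[OF trig_add(3,4)] by (simp add: i j)
qed

definition cube :: "nat \<Rightarrow> (nat \<Rightarrow> real) set" where
  "cube k = PiE UNIV (\<lambda>j. if j < k then {-1..1} else {0})"

lemma compact_cube: "compact (cube k)"
proof -
  have "compactin (product_topology (\<lambda>_::nat. euclidean :: real topology) UNIV) (cube k)"
    unfolding cube_def compactin_PiE by auto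
  then show ?thesis by (simp add: euclidean_product_topology)
qed

text \<open>The wrapped vector takes values in the compact \<open>cube\<close>, and \<open>\<phi>\<close> is recovered from it
  by \<open>arcsin\<close> as long as no coordinate exceeds \<open>R\<close>.\<close>

definition wrap :: "nat \<Rightarrow> real \<Rightarrow> (nat \<Rightarrow> real) \<Rightarrow> nat \<Rightarrow> real" where
  "wrap k R v j = (if j < k then sin (v j / R) else 0)"

lemma wrap_in_cube: "wrap k R v \<in> cube k"
  by (auto simp: cube_def wrap_def)

text \<open>Stone-Weierstrass on \<open>cube k\<close> for the algebra of continuous functions whose
  pullback along \<open>wrap\<close> is a trigonometric polynomial. Coordinates belong to it because
  a sine is a shifted cosine, and they separate points.\<close>

lemma wrap_approximation:
  fixes \<phi> :: "(nat \<Rightarrow> real) \<Rightarrow> real"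
  assumes cont: "continuous_on UNIV \<phi>" and "\<epsilon> > 0"
  shows "\<exists>p. continuous_on UNIV p \<and> (\<lambda>v. p (wrap k R v)) \<in> trig k \<and>
    (\<forall>s\<in>cube k. \<bar>\<phi> (\<lambda>j. R * arcsin (s j)) - p s\<bar> < \<epsilon>)"
proof -
  let ?R = "{p. continuous_on UNIV p \<and> (\<lambda>v. p (wrap k R v)) \<in> trig k}"
  have const: "(\<lambda>_. c) \<in> trig k" for c
    using trig_cos[of c "\<lambda>_. 0" k 0] by simp
  have coord: "(\<lambda>v. wrap k R v j) \<in> trig k" for j
  proof (cases "j < k")
    case True
    let ?t = "\<lambda>i. if i = j then 1 / R else 0"
    have "(\<lambda>v. 1 * cos ((\<Sum>i<k. ?t i * v i) + (- pi/2))) \<in> trig k"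
      by (rule trig_cos)
    moreover have "(\<Sum>i<k. ?t i * v i) = v j / R" for v
      using True by (simp add: if_distrib[of "\<lambda>x. x * _"] cong: if_cong)
    moreover have "cos (x + (- pi/2)) = sin x" for x :: real
      using cos_diff[of x "pi/2"] by simp
    ultimately show ?thesis using True by (simp add: wrap_def)
  next
    case False
    then show ?thesis using const[of 0] by (simp add: wrap_def)
  qed
  interpret function_ring_on ?R "cube k"
  proof
    show "compact (cube k)" by (rule compact_cube)
    show "continuous_on (cube k) f" if "f \<in> ?R" for f
      using that by (auto intro: continuous_on_subset)
    show "(\<lambda>x. f x + g x) \<in> ?R" if "f \<in> ?R" "g \<in> ?R" for f g
      using that by (auto intro: continuous_on_add trig_add)
    show "(\<lambda>x. f x * g x) \<in> ?R" if "f \<in> ?R" "g \<in> ?R" for f g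
      using that by (auto intro: continuous_on_mult trig_mult)
    show "(\<lambda>_. c) \<in> ?R" for c using const by auto
    show "\<exists>f\<in>?R. f x \<noteq> f y" if "x \<noteq> y" for x y
    proof -
      obtain j where "x j \<noteq> y j" using \<open>x \<noteq> y\<close> by auto
      moreover have "(\<lambda>s. s j) \<in> ?R"
        using coord by (simp add: continuous_on_product_coordinates)
      ultimately show ?thesis by (intro bexI[of _ "\<lambda>s. s j"])
    qed
  qed
  have "continuous_on (cube k) (\<lambda>s. \<phi> (\<lambda>j. R * arcsin (s j)))"
  proof (rule continuous_on_compose2[OF cont])
    show "continuous_on (cube k) (\<lambda>s j. R * arcsin (s j))"
    proof (rule continuous_on_coordinatewise_then_product)
      fix j
      have "continuous_on (cube k) (\<lambda>s. s j)"
        by (rule continuous_on_subset[OF continuous_on_product_coordinates]) simp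
      moreover have "\<forall>s\<in>cube k. -1 \<le> s j \<and> s j \<le> 1"
        by (auto simp: cube_def PiE_def Pi_def split: if_splits)
          (metis atLeastAtMost_iff singletonD zero_le_one neg_le_0_iff_le)+
      ultimately show "continuous_on (cube k) (\<lambda>s. R * arcsin (s j))"
        by (intro continuous_intros) auto
    qed
  qed auto
  from Stone_Weierstrass_basic[OF this \<open>\<epsilon> > 0\<close>] show ?thesis by auto
qed

text \<open>Within radius \<open>R\<close> the argument of the sine has modulus at most 1, which is
  in the range where \<open>arcsin\<close> inverts it. Outside, the trivial error
  \<open>2 * B\<close> is paid for by \<open>1 \<le> (\<Sum>j<k. (v j)\<^sup>2) / R\<^sup>2\<close>,
  a Chebyshev bound in pointwise form.\<close>

lemma wrap_error:
  fixes \<phi> :: "(nat \<Rightarrow> real) \<Rightarrow> real"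
  assumes B: "\<And>v. \<bar>\<phi> v\<bar> \<le> B" and dep: "\<And>v w. (\<And>j. j < k \<Longrightarrow> v j = w j) \<Longrightarrow> \<phi> v = \<phi> w"
    and R: "R > 0"
    and p: "\<forall>s\<in>cube k. \<bar>\<phi> (\<lambda>j. R * arcsin (s j)) - p s\<bar> < \<epsilon>"
  shows "\<bar>\<phi> v - p (wrap k R v)\<bar> \<le> 2 * B / R\<^sup>2 * (\<Sum>j<k. (v j)\<^sup>2) + \<epsilon>"
proof -
  have B0: "0 \<le> B" using B[of v] by linarith
  have "\<bar>\<phi> v - \<phi> (\<lambda>j. R * arcsin (wrap k R v j))\<bar> \<le> 2 * B / R\<^sup>2 * (\<Sum>j<k. (v j)\<^sup>2)"
  proof (cases "\<forall>j<k. \<bar>v j\<bar> \<le> R")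
    case True
    have "\<phi> v = \<phi> (\<lambda>j. R * arcsin (wrap k R v j))"
    proof (rule dep)
      fix j assume "j < k"
      have "\<bar>v j / R\<bar> \<le> 1" using True \<open>j < k\<close> R by simp
      then have "arcsin (sin (v j / R)) = v j / R"
        using pi_gt3 by (intro arcsin_sin; unfold abs_le_iff; linarith)
      then show "v j = R * arcsin (wrap k R v j)"
        using \<open>j < k\<close> R by (simp add: wrap_def)
    qed
    then show ?thesis using B0 by (simp add: sum_nonneg)
  next
    case False
    then obtain j where j: "j < k" "R < \<bar>v j\<bar>" by (auto simp: not_le)
    then have "R\<^sup>2 \<le> (v j)\<^sup>2"
      using R by (metis abs_of_pos less_imp_le power2_le_iff_abs_le abs_le_square_iff)
    also have "\<dots> \<le> (\<Sum>j<k. (v j)\<^sup>2)"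
      using j by (intro member_le_sum) auto
    finally have "1 \<le> (\<Sum>j<k. (v j)\<^sup>2) / R\<^sup>2" using R by simp
    then have "2 * B * 1 \<le> 2 * B * ((\<Sum>j<k. (v j)\<^sup>2) / R\<^sup>2)"
      using B0 by (intro mult_left_mono) auto
    then show ?thesis
      using B[of v] B[of "\<lambda>j. R * arcsin (wrap k R v j)"] by simp
  qed
  moreover have "\<bar>\<phi> (\<lambda>j. R * arcsin (wrap k R v j)) - p (wrap k R v)\<bar> < \<epsilon>"
    using p wrap_in_cube by auto
  ultimately show ?thesis by linarith
qed

lemma (in prob_space) wrap_error_integral:
  fixes \<phi> :: "(nat \<Rightarrow> real) \<Rightarrow> real" and v :: "'a \<Rightarrow> nat \<Rightarrow> real"
  assumes cont: "continuous_on UNIV \<phi>" and B: "\<And>v. \<bar>\<phi> v\<bar> \<le> B"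
    and dep: "\<And>v w. (\<And>j. j < k \<Longrightarrow> v j = w j) \<Longrightarrow> \<phi> v = \<phi> w"
    and R: "R > 0" "2 * B \<le> \<epsilon> * R\<^sup>2"
    and trig: "(\<lambda>v. p (wrap k R v)) \<in> trig k"
    and p: "\<forall>s\<in>cube k. \<bar>\<phi> (\<lambda>j. R * arcsin (s j)) - p s\<bar> < \<epsilon>"
    and v [measurable]: "v \<in> borel_measurable M"
    and v2: "\<And>j. integrable M (\<lambda>\<omega>. (v \<omega> j)\<^sup>2)" "(\<Sum>j<k. expectation (\<lambda>\<omega>. (v \<omega> j)\<^sup>2)) \<le> 1"
  shows "\<bar>expectation (\<lambda>\<omega>. \<phi> (v \<omega>)) - expectation (\<lambda>\<omega>. p (wrap k R (v \<omega>)))\<bar> \<le> 2 * \<epsilon>"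
proof -
  have B0: "0 \<le> B" using B[of "\<lambda>_. 0"] by linarith
  have [measurable]: "\<phi> \<in> borel_measurable borel" "(\<lambda>v. p (wrap k R v)) \<in> borel_measurable borel"
    using cont trig by (auto intro!: continuous_borel_measurable_nat trig_continuous)
  have m2: "(\<lambda>\<omega>. p (wrap k R (v \<omega>))) \<in> borel_measurable M"
    using measurable_compose[OF v, of "\<lambda>v. p (wrap k R v)" borel] by simp
  have i: "integrable M (\<lambda>\<omega>. \<phi> (v \<omega>))" "integrable M (\<lambda>\<omega>. p (wrap k R (v \<omega>)))"
    using bnd_comp[OF bndI[of \<phi>, OF B], of v] bnd_comp[OF trig_bnd[OF trig], of v] m2
    by (auto intro!: integrable_bnd)
  have "\<bar>expectation (\<lambda>\<omega>. \<phi> (v \<omega>)) - expectation (\<lambda>\<omega>. p (wrap k R (v \<omega>)))\<bar>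
    = \<bar>expectation (\<lambda>\<omega>. \<phi> (v \<omega>) - p (wrap k R (v \<omega>)))\<bar>"
    using i by simp
  also have "\<dots> \<le> expectation (\<lambda>\<omega>. \<bar>\<phi> (v \<omega>) - p (wrap k R (v \<omega>))\<bar>)"
    by (rule integral_abs_bound)
  also have "\<dots> \<le> expectation (\<lambda>\<omega>. 2 * B / R\<^sup>2 * (\<Sum>j<k. (v \<omega> j)\<^sup>2) + \<epsilon>)"
    using i v2 by (intro integral_mono wrap_error[OF B dep R(1) p]) auto
  also have "\<dots> = 2 * B / R\<^sup>2 * (\<Sum>j<k. expectation (\<lambda>\<omega>. (v \<omega> j)\<^sup>2)) + \<epsilon>"
    using v2 by (simp add: prob_space)
  also have "\<dots> \<le> 2 * B / R\<^sup>2 * 1 + \<epsilon>"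
    using v2 B0 by (intro add_right_mono mult_left_mono) auto
  also have "\<dots> \<le> 2 * \<epsilon>"
    using R by (simp add: field_simps)
  finally show ?thesis .
qed

text \<open>The second moments of the cell counts, for every \<open>n\<close>, and of the bridge
  steps sum to at most 1. A single \<open>R\<close> therefore makes wrapping harmless along the
  whole sequence and in the limit.\<close>

theorem cell_emp_CLT:
  fixes \<phi> :: "(nat \<Rightarrow> real) \<Rightarrow> real"
  assumes cont: "continuous_on UNIV \<phi>" and B: "\<And>v. \<bar>\<phi> v\<bar> \<le> B"
    and dep: "\<And>v w. (\<And>j. j < k \<Longrightarrow> v j = w j) \<Longrightarrow> \<phi> v = \<phi> w"
  shows "(\<lambda>n. \<integral>\<omega>. \<phi> (cell_emp e r n \<omega>) \<partial>sample r)
    \<longlonglongrightarrow> (\<integral>\<omega>. \<phi> (bridge_step (cell e r) \<omega>) \<partial>gauss)"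
proof (rule LIMSEQ_I)
  interpret P: prob_space "sample r" by (rule prob_space_sample)
  interpret G: prob_space gauss by (rule prob_space_gauss)
  fix \<delta> :: real assume "\<delta> > 0"
  \<comment> \<open>Two wrapping errors of \<open>2 * \<epsilon>\<close> and one
    \<open>\<epsilon>\<close> for the trigonometric polynomial.\<close>
  define \<epsilon> where "\<epsilon> = \<delta> / 5"
  have e: "\<epsilon> > 0" using \<open>\<delta> > 0\<close> by (simp add: \<epsilon>_def)
  have B0: "0 \<le> B" using B[of "\<lambda>_. 0"] by linarith
  \<comment> \<open>The summand 1 keeps \<open>R\<close> positive when \<open>B = 0\<close>.\<close>
  define R where "R = sqrt (2 * B / \<epsilon>) + 1"
  have R: "R > 0" unfolding R_def using B0 e by (auto intro!: add_nonneg_pos)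
  have "2 * B / \<epsilon> = (sqrt (2 * B / \<epsilon>))\<^sup>2" using B0 e by simp
  also have "\<dots> \<le> R\<^sup>2" unfolding R_def using B0 e by (intro power_mono) auto
  finally have R2: "2 * B \<le> \<epsilon> * R\<^sup>2" using e by (simp add: field_simps)
  obtain p where p: "(\<lambda>v. p (wrap k R v)) \<in> trig k"
    "\<forall>s\<in>cube k. \<bar>\<phi> (\<lambda>j. R * arcsin (s j)) - p s\<bar> < \<epsilon>"
    using wrap_approximation[OF cont e, of k R] by auto
  have A: "\<bar>(\<integral>\<omega>. \<phi> (cell_emp e r n \<omega>) \<partial>sample r) - (\<integral>\<omega>. p (wrap k R (cell_emp e r n \<omega>)) \<partial>sample r)\<bar> \<le> 2 * \<epsilon>" for n
    by (rule P.wrap_error_integral[OF cont B dep R R2 p cell_emp_vector_measurable cell_emp_square(1)])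
      (auto intro!: order_trans[OF sum_mono sum_cell_le[where e=e and r=r and k=k]] cell_emp_square(2))
  note bm = bridge_step_moments[where \<rho>="cell e r", OF cell_nonneg sum_cell_le]
  have C: "\<bar>(\<integral>\<omega>. \<phi> (bridge_step (cell e r) \<omega>) \<partial>gauss) - (\<integral>\<omega>. p (wrap k R (bridge_step (cell e r) \<omega>)) \<partial>gauss)\<bar> \<le> 2 * \<epsilon>"
  proof (rule G.wrap_error_integral[OF cont B dep R R2 p bridge_step_vector_measurable bm(1)])
    show "(\<Sum>j<k. \<integral>\<omega>. (bridge_step (cell e r) \<omega> j)\<^sup>2 \<partial>gauss) \<le> 1"
      unfolding bm(2) using cell_nonneg[of e r] cell_le_1[of e r]
      by (intro order_trans[OF sum_mono sum_cell_le[where e=e and r=r and k=k]]) (auto intro!: mult_left_le)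
  qed auto
  have "(\<lambda>n. \<integral>\<omega>. p (wrap k R (cell_emp e r n \<omega>)) \<partial>sample r) \<longlonglongrightarrow> (\<integral>\<omega>. p (wrap k R (bridge_step (cell e r) \<omega>)) \<partial>gauss)"
    using trig_CLT[OF p(1), where e=e and r=r] .
  from LIMSEQ_D[OF this e] obtain N where N:
    "\<And>n. n \<ge> N \<Longrightarrow> \<bar>(\<integral>\<omega>. p (wrap k R (cell_emp e r n \<omega>)) \<partial>sample r) - (\<integral>\<omega>. p (wrap k R (bridge_step (cell e r) \<omega>)) \<partial>gauss)\<bar> < \<epsilon>"
    by auto
  show "\<exists>N. \<forall>n\<ge>N. norm ((\<integral>\<omega>. \<phi> (cell_emp e r n \<omega>) \<partial>sample r) - (\<integral>\<omega>. \<phi> (bridge_step (cell e r) \<omega>) \<partial>gauss)) < \<delta>"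
  proof (intro exI[of _ N] allI impI)
    fix n assume "n \<ge> N"
    show "norm ((\<integral>\<omega>. \<phi> (cell_emp e r n \<omega>) \<partial>sample r) - (\<integral>\<omega>. \<phi> (bridge_step (cell e r) \<omega>) \<partial>gauss)) < \<delta>"
      using A[of n] C N[OF \<open>n \<ge> N\<close>] unfolding real_norm_def \<epsilon>_def by linarith
  qed
qed

section \<open>Weak convergence in a metric space\<close>

lemma space_metric_borel: "space (metric_borel m) = mspace m"
  unfolding metric_borel_def using openin_subset[of "mtopology_of m"]
  by (intro space_measure_of) auto

lemma openin_metric_borel: "openin (mtopology_of m) U \<Longrightarrow> U \<in> sets (metric_borel m)"
  unfolding metric_borel_def using openin_subset[of "mtopology_of m"]
  by (subst sets_measure_of) auto

lemma closedin_metric_borel: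
  assumes "closedin (mtopology_of m) C"
  shows "C \<in> sets (metric_borel m)"
proof -
  have "mspace m - C \<in> sets (metric_borel m)"
    using assms by (intro openin_metric_borel) (simp add: closedin_def)
  moreover have "C = space (metric_borel m) - (mspace m - C)"
    using closedin_subset[OF assms] by (auto simp: space_metric_borel)
  ultimately show ?thesis by (metis sets.compl_sets)
qed

lemma measurable_metric_borelI:
  assumes "\<And>\<omega>. \<omega> \<in> space N \<Longrightarrow> Y \<omega> \<in> mspace m"
    and "\<And>U. openin (mtopology_of m) U \<Longrightarrow> Y -` U \<inter> space N \<in> sets N"
  shows "Y \<in> measurable N (metric_borel m)"
  unfolding metric_borel_def using assms openin_subset[of "mtopology_of m"]
  by (intro measurable_measure_of) auto

lemma continuous_map_metric_borel:
  assumes H: "continuous_map (mtopology_of m) euclideanreal H"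
  shows "H \<in> borel_measurable (metric_borel m)"
proof (rule borel_measurableI)
  fix S :: "real set" assume "open S"
  then have "openin (mtopology_of m) {z \<in> mspace m. H z \<in> S}"
    using openin_continuous_map_preimage[OF H, of S] by simp
  then have "{z \<in> mspace m. H z \<in> S} \<in> sets (metric_borel m)"
    by (rule openin_metric_borel)
  then show "H -` S \<inter> space (metric_borel m) \<in> sets (metric_borel m)"
    by (simp add: space_metric_borel vimage_def Int_def conj_commute)
qed

text \<open>An argument that works without separability: an open \<open>U\<close> is exhausted by
  the sets of points keeping a fixed distance from its complement, and the limit lies in
  \<open>U\<close> exactly when the sequence eventually stays in one of them.\<close>

lemma limit_measurable_metric_borel:
  assumes X: "\<And>k. X k \<in> measurable N (metric_borel m)"
    and lim: "\<And>\<omega>. \<omega> \<in> space N \<Longrightarrow> limitin (mtopology_of m) (\<lambda>k. X k \<omega>) (Y \<omega>) sequentially"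
  shows "Y \<in> measurable N (metric_borel m)"
proof (rule measurable_metric_borelI)
  interpret X: Metric_space "mspace m" "mdist m" by simp
  have top: "X.mtopology = mtopology_of m" by (simp add: mtopology_of_def)
  have YM: "Y \<omega> \<in> mspace m" if "\<omega> \<in> space N" for \<omega>
    using lim[OF that] X.limitin_mspace unfolding top by blast
  then show "\<And>\<omega>. \<omega> \<in> space N \<Longrightarrow> Y \<omega> \<in> mspace m" .
  fix U assume U: "openin (mtopology_of m) U"
  define O' where "O' j = (\<Union>w\<in>mspace m - U. X.mball w (1 / real (Suc j)))" for j
  define A where "A j = mspace m - O' j" for j
  have oO: "openin (mtopology_of m) (O' j)" for j
    unfolding O'_def top[symmetric] by (intro openin_Union) auto
  have A: "A j \<in> sets (metric_borel m)" for j
    using sets.compl_sets[OF openin_metric_borel[OF oO[of j]]] by (simp add: A_def space_metric_borel)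
  have UM: "U \<subseteq> mspace m" using openin_subset[OF U] by simp
  have iff: "Y \<omega> \<in> U \<longleftrightarrow> (\<exists>j. \<exists>n. \<forall>k\<ge>n. X k \<omega> \<in> A j)" if w: "\<omega> \<in> space N" for \<omega>
  proof
    assume YU: "Y \<omega> \<in> U"
    then obtain \<epsilon> where e: "\<epsilon> > 0" "X.mball (Y \<omega>) \<epsilon> \<subseteq> U"
      using U unfolding top[symmetric] X.openin_mtopology by blast
    obtain j where j: "1 / real (Suc j) < \<epsilon> / 2"
      using e(1) nat_approx_posE[of "\<epsilon>/2"] by auto
    have "\<forall>\<^sub>F k in sequentially. X k \<omega> \<in> mspace m \<and> mdist m (X k \<omega>) (Y \<omega>) < \<epsilon> / 2"
      using lim[OF w] half_gt_zero[OF e(1)] unfolding top[symmetric] X.limitin_metric by blast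
    moreover have "x \<in> A j" if x: "x \<in> mspace m" "mdist m x (Y \<omega>) < \<epsilon> / 2" for x
    proof (rule ccontr)
      assume "x \<notin> A j"
      then obtain w' where w': "w' \<in> mspace m" "w' \<notin> U" "mdist m w' x < 1 / real (Suc j)"
        using x by (auto simp: A_def O'_def)
      have "mdist m (Y \<omega>) w' \<le> mdist m (Y \<omega>) x + mdist m x w'"
        using X.triangle YM[OF w] x w' by blast
      also have "\<dots> < \<epsilon>" using x w' j by (simp add: X.commute)
      finally show False using e w' YM[OF w] by auto
    qed
    ultimately have "\<forall>\<^sub>F k in sequentially. X k \<omega> \<in> A j"
      by (auto elim: eventually_mono)
    then show "\<exists>j. \<exists>n. \<forall>k\<ge>n. X k \<omega> \<in> A j"
      by (auto simp: eventually_sequentially)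
  next
    assume "\<exists>j. \<exists>n. \<forall>k\<ge>n. X k \<omega> \<in> A j"
    then obtain j n where jn: "\<And>k. k \<ge> n \<Longrightarrow> X k \<omega> \<in> A j" by auto
    show "Y \<omega> \<in> U"
    proof (rule ccontr)
      assume "Y \<omega> \<notin> U"
      then have "Y \<omega> \<in> O' j"
        using YM[OF w] unfolding O'_def by (intro UN_I[of "Y \<omega>"]) auto
      then have "\<forall>\<^sub>F k in sequentially. X k \<omega> \<in> O' j"
        using lim[OF w] oO[of j] unfolding limitin_def by blast
      then obtain k where "k \<ge> n" "X k \<omega> \<in> O' j"
        unfolding eventually_sequentially by (metis nle_le)
      then show False using jn[of k] by (simp add: A_def)
    qed
  qed
  have "Y -` U \<inter> space N = (\<Union>j. \<Union>n. \<Inter>k\<in>{n..}. X k -` A j \<inter> space N)"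
  proof (rule set_eqI)
    fix \<omega>
    show "\<omega> \<in> Y -` U \<inter> space N \<longleftrightarrow> \<omega> \<in> (\<Union>j. \<Union>n. \<Inter>k\<in>{n..}. X k -` A j \<inter> space N)"
    proof (cases "\<omega> \<in> space N")
      case True
      then show ?thesis using iff[OF True] by simp (simp only: Ball_def atLeast_iff)
    next
      case False
      then show ?thesis by fastforce
    qed
  qed
  also have "\<dots> \<in> sets N"
  proof -
    have "(\<Inter>k\<in>{n..}. X k -` A j \<inter> space N) \<in> sets N" for n j
      using measurable_sets[OF X A] by (intro sets.countable_INT') auto
    then show ?thesis by (intro sets.countable_UN'' countableI_type)
  qed
  finally show "Y -` U \<inter> space N \<in> sets N" .
qed

section \<open>Outer expectation of bounded functions\<close>

context prob_space
begin

text \<open>Boundedness of \<open>T\<close> bounds the integrals of its majorants from below, so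
  that the real infimum is a genuine lower bound of them.\<close>

lemma outer_expectation_le:
  assumes B: "\<And>\<omega>. \<omega> \<in> space M \<Longrightarrow> \<bar>T \<omega>\<bar> \<le> B" and U: "integrable M U" "\<And>\<omega>. \<omega> \<in> space M \<Longrightarrow> T \<omega> \<le> U \<omega>"
  shows "outer_expectation M T \<le> expectation U"
  unfolding outer_expectation_def
proof (rule cInf_lower)
  show "bdd_below {integral\<^sup>L M U |U. integrable M U \<and> (\<forall>\<omega>\<in>space M. T \<omega> \<le> U \<omega>)}"
  proof (rule bdd_belowI[of _ "- B"], clarify)
    fix V assume V: "integrable M V" "\<forall>\<omega>\<in>space M. T \<omega> \<le> V \<omega>"
    have "- B = expectation (\<lambda>_. - B)" by (simp add: prob_space)
    also have "\<dots> \<le> expectation V"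
    proof (rule integral_mono)
      fix \<omega> assume w: "\<omega> \<in> space M"
      then show "- B \<le> V \<omega>" using B[OF w] V(2) by fastforce
    qed (use V in auto)
    finally show "- B \<le> expectation V" .
  qed
qed (use U in blast)

lemma outer_expectation_ge:
  assumes B: "\<And>\<omega>. \<omega> \<in> space M \<Longrightarrow> \<bar>T \<omega>\<bar> \<le> B"
    and "\<And>U. integrable M U \<Longrightarrow> (\<And>\<omega>. \<omega> \<in> space M \<Longrightarrow> T \<omega> \<le> U \<omega>) \<Longrightarrow> c \<le> expectation U"
  shows "c \<le> outer_expectation M T"
  unfolding outer_expectation_def
proof (rule cInf_greatest)
  have "integrable M (\<lambda>_. B) \<and> (\<forall>\<omega>\<in>space M. T \<omega> \<le> B)"
    using B by (auto simp: abs_le_iff)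
  then show "{integral\<^sup>L M U |U. integrable M U \<and> (\<forall>\<omega>\<in>space M. T \<omega> \<le> U \<omega>)} \<noteq> {}" by blast
qed (use assms(2) in blast)

lemma outer_expectation_lessE:
  assumes B: "\<And>\<omega>. \<omega> \<in> space M \<Longrightarrow> \<bar>T \<omega>\<bar> \<le> B" and c: "outer_expectation M T < c"
  obtains U where "integrable M U" "\<And>\<omega>. \<omega> \<in> space M \<Longrightarrow> T \<omega> \<le> U \<omega>" "expectation U < c"
proof -
  have "\<exists>U. integrable M U \<and> (\<forall>\<omega>\<in>space M. T \<omega> \<le> U \<omega>) \<and> expectation U < c"
  proof (rule ccontr)
    assume "\<not> ?thesis"
    then have "c \<le> outer_expectation M T"
      by (intro outer_expectation_ge[OF B]) (auto simp: not_less)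
    then show False using c by simp
  qed
  then show ?thesis using that by auto
qed

lemma outer_expectation_mono:
  assumes "\<And>\<omega>. \<omega> \<in> space M \<Longrightarrow> \<bar>T \<omega>\<bar> \<le> B" "\<And>\<omega>. \<omega> \<in> space M \<Longrightarrow> \<bar>T' \<omega>\<bar> \<le> B'"
    and "\<And>\<omega>. \<omega> \<in> space M \<Longrightarrow> T \<omega> \<le> T' \<omega>"
  shows "outer_expectation M T \<le> outer_expectation M T'"
  by (rule outer_expectation_ge[OF assms(2)])
    (auto intro!: outer_expectation_le[OF assms(1)] order_trans[OF assms(3)])

text \<open>The outer expectation is not additive, but a measurable \<open>S\<close> with an
  integrable error bound sandwiches it between the integrals of \<open>S - U\<close> and
  \<open>S + U\<close>.\<close>

lemma outer_expectation_near_integral: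
  assumes B: "\<And>\<omega>. \<omega> \<in> space M \<Longrightarrow> \<bar>T \<omega>\<bar> \<le> B" and S: "integrable M S" and U: "integrable M U"
    and close: "\<And>\<omega>. \<omega> \<in> space M \<Longrightarrow> \<bar>T \<omega> - S \<omega>\<bar> \<le> U \<omega>"
  shows "\<bar>outer_expectation M T - expectation S\<bar> \<le> expectation U"
proof -
  have "outer_expectation M T \<le> expectation (\<lambda>\<omega>. S \<omega> + U \<omega>)"
    using S U close by (intro outer_expectation_le[OF B]) (auto simp: abs_le_iff algebra_simps)
  moreover have "expectation (\<lambda>\<omega>. S \<omega> - U \<omega>) \<le> outer_expectation M T"
  proof (rule outer_expectation_ge[OF B])
    fix V assume V: "integrable M V" "\<And>\<omega>. \<omega> \<in> space M \<Longrightarrow> T \<omega> \<le> V \<omega>"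
    show "expectation (\<lambda>\<omega>. S \<omega> - U \<omega>) \<le> expectation V"
    proof (rule integral_mono)
      fix \<omega> assume "\<omega> \<in> space M"
      then show "S \<omega> - U \<omega> \<le> V \<omega>" using close[of \<omega>] V(2)[of \<omega>] by linarith
    qed (use S U V in auto)
  qed
  ultimately show ?thesis using S U by (simp add: abs_le_iff)
qed

end

text \<open>The envelopes are sup-convolutions of \<open>H\<close> with the penalty
  \<open>j * mdist m z w\<close>. They inherit their Lipschitz constant from the penalty, and a
  large \<open>j\<close> makes points away from \<open>z\<close> irrelevant. The approximation is
  only one-sided and pointwise, because a bounded continuous function need not be a uniform limit of
  Lipschitz functions.\<close>

lemma lipschitz_majorants:
  assumes H: "continuous_map (mtopology_of m) euclideanreal H"
    and B: "\<And>z. z \<in> mspace m \<Longrightarrow> \<bar>H z\<bar> \<le> B"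
  obtains Hs :: "nat \<Rightarrow> 'd \<Rightarrow> real" where
    "\<And>j z. z \<in> mspace m \<Longrightarrow> H z \<le> Hs j z"
    "\<And>j z. z \<in> mspace m \<Longrightarrow> \<bar>Hs j z\<bar> \<le> B"
    "\<And>j z w. z \<in> mspace m \<Longrightarrow> w \<in> mspace m \<Longrightarrow> \<bar>Hs j z - Hs j w\<bar> \<le> j * mdist m z w"
    "\<And>z. z \<in> mspace m \<Longrightarrow> (\<lambda>j. Hs j z) \<longlonglongrightarrow> H z"
proof
  interpret X: Metric_space "mspace m" "mdist m" by simp
  have top: "X.mtopology = mtopology_of m" by (simp add: mtopology_of_def)
  have nn: "0 \<le> real j * mdist m z w" for j z w
    using X.nonneg by simp
  let ?Hs = "\<lambda>(j::nat) z. SUP w\<in>mspace m. H w - real j * mdist m z w"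
  have bdd: "bdd_above ((\<lambda>w. H w - real j * mdist m z w) ` mspace m)" for j z
  proof (rule bdd_aboveI2[of _ _ B])
    fix w assume "w \<in> mspace m"
    then show "H w - real j * mdist m z w \<le> B"
      using B[of w] nn[of j z w] unfolding abs_le_iff by linarith
  qed
  show ge: "H z \<le> ?Hs j z" if z: "z \<in> mspace m" for j z
    using cSUP_upper[OF z bdd[of j z]] z by simp
  have le: "?Hs j z \<le> c" if "z \<in> mspace m" "\<And>w. w \<in> mspace m \<Longrightarrow> H w - real j * mdist m z w \<le> c" for j z c
    using that by (intro cSUP_least) auto
  show "\<bar>?Hs j z\<bar> \<le> B" if z: "z \<in> mspace m" for j z
  proof -
    have "?Hs j z \<le> B"
    proof (rule le[OF z])
      fix w assume "w \<in> mspace m"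
      then show "H w - real j * mdist m z w \<le> B"
        using B[of w] nn[of j z w] unfolding abs_le_iff by linarith
    qed
    then show ?thesis using ge[OF z, of j] B[OF z] by (simp add: abs_le_iff)
  qed
  have half: "?Hs j z \<le> ?Hs j w + j * mdist m z w" if z: "z \<in> mspace m" "w \<in> mspace m" for j z w
  proof (rule le[OF z(1)])
    fix u assume u: "u \<in> mspace m"
    have "real j * mdist m w u \<le> real j * (mdist m w z + mdist m z u)"
      using X.triangle[of w z u] u z by (intro mult_left_mono) auto
    moreover have "H u - real j * mdist m w u \<le> ?Hs j w"
      by (rule cSUP_upper[OF u bdd])
    ultimately show "H u - real j * mdist m z u \<le> ?Hs j w + j * mdist m z w"
      using X.commute[of z w] by (simp add: algebra_simps)
  qed
  show "\<bar>?Hs j z - ?Hs j w\<bar> \<le> j * mdist m z w" if "z \<in> mspace m" "w \<in> mspace m" for j z w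
    using half[OF that, of j] half[OF that(2,1), of j] unfolding abs_le_iff X.commute[of w z] by linarith
  show "(\<lambda>j. ?Hs j z) \<longlonglongrightarrow> H z" if z: "z \<in> mspace m" for z
  proof (rule LIMSEQ_I)
    fix \<epsilon> :: real assume e: "\<epsilon> > 0"
    have "openin (mtopology_of m) {w \<in> mspace m. H w \<in> {H z - \<epsilon>/2<..<H z + \<epsilon>/2}}"
      using openin_continuous_map_preimage[OF H, of "{H z - \<epsilon>/2<..<H z + \<epsilon>/2}"] by simp
    then obtain \<delta> where d: "\<delta> > 0" "X.mball z \<delta> \<subseteq> {w \<in> mspace m. H w \<in> {H z - \<epsilon>/2<..<H z + \<epsilon>/2}}"
      using z e unfolding top[symmetric] X.openin_mtopology by force
    \<comment> \<open>From this index on, the penalty at distance \<open>\<delta>\<close> is at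
      least \<open>2 * B\<close>, the largest possible variation of \<open>H\<close>.\<close>
    obtain N :: nat where N: "2 * B / \<delta> \<le> N" using real_arch_simple by blast
    show "\<exists>N. \<forall>j\<ge>N. norm (?Hs j z - H z) < \<epsilon>"
    proof (intro exI[of _ N] allI impI)
      fix j assume "N \<le> j"
      then have "2 * B / \<delta> \<le> j" using N by linarith
      then have j: "2 * B \<le> j * \<delta>" using d(1) by (simp add: divide_le_eq)
      have "?Hs j z \<le> H z + \<epsilon> / 2"
      proof (rule le[OF z])
        fix w assume w: "w \<in> mspace m"
        show "H w - real j * mdist m z w \<le> H z + \<epsilon> / 2"
        proof (cases "mdist m z w < \<delta>")
          case True
          then have "H w \<le> H z + \<epsilon>/2" using d(2) z w by auto
          then show ?thesis using nn[of j z w] by linarith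
        next
          case False
          then have "j * \<delta> \<le> j * mdist m z w" by (intro mult_left_mono) auto
          then show ?thesis using j B[OF w] B[OF z] e unfolding abs_le_iff by linarith
        qed
      qed
      then show "norm (?Hs j z - H z) < \<epsilon>" using ge[OF z, of j] e by simp
    qed
  qed
qed

section \<open>Limits through continuous functionals of finitely many coordinates\<close>

lemma min_1_triangle:
  fixes a b c u u' :: real
  assumes "a \<le> b + c" "min 1 b \<le> u" "min 1 c \<le> u'" "0 \<le> b" "0 \<le> c"
  shows "min 1 a \<le> u + u'"
  using assms by (auto simp: min_def split: if_splits)

text \<open>An abstract setting without empirical processes. For large n the possibly non-measurable
  \<open>Z n\<close> is, up to \<open>(1/2) ^ k\<close> in truncated outer mean, a continuous image
  of finitely many coordinates of a measurable vector \<open>V n\<close>, whose finite-dimensional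
  limit is \<open>W\<close>. Completeness and these summable errors replace separability and any
  extraction of convergent subsequences of laws.\<close>

locale metric_limit = M: prob_space M + G: prob_space G
  for M :: "'w measure" and G :: "'v measure" +
  fixes m :: "'d metric" and Z :: "nat \<Rightarrow> 'w \<Rightarrow> 'd"
    and T :: "nat \<Rightarrow> (nat \<Rightarrow> real) \<Rightarrow> 'd" and K :: "nat \<Rightarrow> nat"
    and V :: "nat \<Rightarrow> 'w \<Rightarrow> nat \<Rightarrow> real" and W :: "'v \<Rightarrow> nat \<Rightarrow> real"
  assumes Z: "\<And>n \<omega>. \<omega> \<in> space M \<Longrightarrow> Z n \<omega> \<in> mspace m"
    and T: "\<And>k. continuous_map euclidean (mtopology_of m) (T k)"
    and T_dep: "\<And>k v w. (\<And>j. j < K k \<Longrightarrow> v j = w j) \<Longrightarrow> T k v = T k w"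
    and V [measurable]: "\<And>n. V n \<in> borel_measurable M"
    and W [measurable]: "W \<in> borel_measurable G"
    and conv: "\<And>\<phi> B i. continuous_on UNIV \<phi> \<Longrightarrow> (\<And>v. \<bar>\<phi> v\<bar> \<le> B) \<Longrightarrow>
      (\<And>v w. (\<And>j. j < i \<Longrightarrow> v j = w j) \<Longrightarrow> \<phi> v = \<phi> w) \<Longrightarrow>
      (\<lambda>n. \<integral>\<omega>. \<phi> (V n \<omega>) \<partial>M) \<longlonglongrightarrow> (\<integral>\<omega>. (\<phi> (W \<omega>) :: real) \<partial>G)"
    and approx: "\<And>k. \<exists>N. \<forall>n\<ge>N. \<exists>U. integrable M U \<and> integral\<^sup>L M U \<le> (1/2) ^ k \<and>
      (\<forall>\<omega>\<in>space M. min 1 (mdist m (Z n \<omega>) (T k (V n \<omega>))) \<le> U \<omega>)"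
    and complete: "mcomplete_of m"
begin

sublocale X: Metric_space "mspace m" "mdist m" by simp

lemma top: "X.mtopology = mtopology_of m"
  by (simp add: mtopology_of_def)

lemma T_in [simp]: "T k v \<in> mspace m"
  using T[of k] by (metis (no_types, lifting) UNIV_I continuous_map_def Pi_iff topspace_euclidean topspace_mtopology_of)

lemma continuous_on_comp_T:
  assumes "continuous_map (mtopology_of m) euclideanreal H"
  shows "continuous_on UNIV (\<lambda>v. H (T k v))"
  using continuous_map_compose[OF T assms, of k] by (simp add: comp_def)

definition gap :: "nat \<Rightarrow> (nat \<Rightarrow> real) \<Rightarrow> real" where
  "gap k v = min 1 (mdist m (T k v) (T (Suc k) v))"

lemma gap_bounds: "0 \<le> gap k v" "gap k v \<le> 1"
  by (auto simp: gap_def)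

lemma gap_continuous: "continuous_on UNIV (gap k)"
proof -
  have "continuous_map euclidean euclideanreal (\<lambda>v. min 1 (mdist m (T k v) (T (Suc k) v)))"
    by (intro continuous_intros T)
  then show ?thesis by (simp add: gap_def[abs_def])
qed

lemma gap_measurable [measurable]: "gap k \<in> borel_measurable borel"
  by (rule continuous_borel_measurable_nat[OF gap_continuous])

lemma gap_integrable: "integrable G (\<lambda>\<omega>. gap k (W \<omega>))" "integrable M (\<lambda>\<omega>. gap k (V n \<omega>))"
  using gap_bounds by (auto intro!: G.integrable_const_bound[of _ 1] M.integrable_const_bound[of _ 1])

text \<open>The bound cannot be read off at the limit, where there is no process to compare with. It
  holds for \<open>V n\<close> by the triangle inequality through \<open>Z n\<close>, and passes to
  \<open>W\<close> because \<open>gap k\<close> is bounded, continuous and depends on finitely many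
  coordinates.\<close>

lemma expectation_gap_le: "(\<integral>\<omega>. gap k (W \<omega>) \<partial>G) \<le> 2 * (1/2) ^ k"
proof (rule LIMSEQ_le_const2)
  show "(\<lambda>n. \<integral>\<omega>. gap k (V n \<omega>) \<partial>M) \<longlonglongrightarrow> (\<integral>\<omega>. gap k (W \<omega>) \<partial>G)"
  proof (rule conv[where B=1 and i="max (K k) (K (Suc k))"])
    show "continuous_on UNIV (gap k)" by (rule gap_continuous)
    show "\<bar>gap k v\<bar> \<le> 1" for v using gap_bounds[of k v] by simp
    show "gap k v = gap k w" if "\<And>j. j < max (K k) (K (Suc k)) \<Longrightarrow> v j = w j" for v w
      using T_dep[of k v w] T_dep[of "Suc k" v w] that by (simp add: gap_def)
  qed
  obtain N where N: "\<And>n. n \<ge> N \<Longrightarrow> \<exists>U. integrable M U \<and> integral\<^sup>L M U \<le> (1/2) ^ k \<and>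
      (\<forall>\<omega>\<in>space M. min 1 (mdist m (Z n \<omega>) (T k (V n \<omega>))) \<le> U \<omega>)"
    using approx[of k] by auto
  obtain N' where N': "\<And>n. n \<ge> N' \<Longrightarrow> \<exists>U. integrable M U \<and> integral\<^sup>L M U \<le> (1/2) ^ Suc k \<and>
      (\<forall>\<omega>\<in>space M. min 1 (mdist m (Z n \<omega>) (T (Suc k) (V n \<omega>))) \<le> U \<omega>)"
    using approx[of "Suc k"] by auto
  show "\<exists>N. \<forall>n\<ge>N. (\<integral>\<omega>. gap k (V n \<omega>) \<partial>M) \<le> 2 * (1/2) ^ k"
  proof (intro exI[of _ "max N N'"] allI impI)
    fix n assume n: "max N N' \<le> n"
    obtain U where U: "integrable M U" "integral\<^sup>L M U \<le> (1/2) ^ k"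
      "\<And>\<omega>. \<omega> \<in> space M \<Longrightarrow> min 1 (mdist m (Z n \<omega>) (T k (V n \<omega>))) \<le> U \<omega>"
      using N[of n] n by auto
    obtain U' where U': "integrable M U'" "integral\<^sup>L M U' \<le> (1/2) ^ Suc k"
      "\<And>\<omega>. \<omega> \<in> space M \<Longrightarrow> min 1 (mdist m (Z n \<omega>) (T (Suc k) (V n \<omega>))) \<le> U' \<omega>"
      using N'[of n] n by auto
    have "(\<integral>\<omega>. gap k (V n \<omega>) \<partial>M) \<le> (\<integral>\<omega>. U \<omega> + U' \<omega> \<partial>M)"
    proof (rule integral_mono)
      fix \<omega> assume w: "\<omega> \<in> space M"
      have "mdist m (T k (V n \<omega>)) (T (Suc k) (V n \<omega>)) \<le>
        mdist m (Z n \<omega>) (T k (V n \<omega>)) + mdist m (Z n \<omega>) (T (Suc k) (V n \<omega>))"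
        using X.triangle'[of "T k (V n \<omega>)" "Z n \<omega>" "T (Suc k) (V n \<omega>)"] Z[OF w, of n] X.commute by simp
      then show "gap k (V n \<omega>) \<le> U \<omega> + U' \<omega>"
        unfolding gap_def by (rule min_1_triangle) (use U(3)[OF w] U'(3)[OF w] in auto)
    qed (use U U' gap_integrable in auto)
    also have "\<dots> = integral\<^sup>L M U + integral\<^sup>L M U'"
      using U U' by simp
    also have "\<dots> \<le> (1/2) ^ k + (1/2) ^ k"
    proof (rule add_mono[OF U(2)])
      have "(1/2::real) ^ Suc k \<le> (1/2) ^ k" by simp
      then show "integral\<^sup>L M U' \<le> (1/2) ^ k" using U'(2) by linarith
    qed
    also have "\<dots> = 2 * (1/2) ^ k" by simp
    finally show "(\<integral>\<omega>. gap k (V n \<omega>) \<partial>M) \<le> 2 * (1/2) ^ k" .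
  qed
qed

text \<open>The weights \<open>(3/2)^i\<close> grow, yet still leave a finite expectation; one bound on the weighted
  sum thus gives convergence of \<open>T k v\<close> at the uniform rate \<open>q * (2/3)^k\<close>.\<close>

definition wgap :: "(nat \<Rightarrow> real) \<Rightarrow> ennreal" where
  "wgap v = (\<Sum>i. ennreal ((3/2) ^ i * gap i v))"

lemma wgap_measurable [measurable]: "wgap \<in> borel_measurable borel"
  unfolding wgap_def[abs_def] by measurable

text \<open>Weight and gap bound combine to \<open>2 * (3/4) ^ i\<close>, a geometric series with
  sum 8.\<close>

lemma nn_integral_wgap: "(\<integral>\<^sup>+\<omega>. wgap (W \<omega>) \<partial>G) \<le> 8"
proof -
  have "(\<integral>\<^sup>+\<omega>. wgap (W \<omega>) \<partial>G) = (\<Sum>i. \<integral>\<^sup>+\<omega>. ennreal ((3/2) ^ i * gap i (W \<omega>)) \<partial>G)"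
    unfolding wgap_def by (rule nn_integral_suminf) measurable
  also have "\<dots> \<le> (\<Sum>i. ennreal (2 * (3/4) ^ i))"
  proof (rule suminf_le)
    fix i
    have "(\<integral>\<^sup>+\<omega>. ennreal ((3/2) ^ i * gap i (W \<omega>)) \<partial>G) = ennreal (\<integral>\<omega>. (3/2) ^ i * gap i (W \<omega>) \<partial>G)"
      using gap_integrable gap_bounds by (intro nn_integral_eq_integral) auto
    also have "\<dots> \<le> ennreal (2 * (3/4) ^ i)"
    proof (rule ennreal_leI)
      have "(\<integral>\<omega>. (3/2) ^ i * gap i (W \<omega>) \<partial>G) \<le> (3/2) ^ i * (2 * (1/2) ^ i)"
        using expectation_gap_le[of i] by simp
      also have "\<dots> = 2 * (3/4) ^ i" by (simp add: power_mult_distrib[symmetric])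
      finally show "(\<integral>\<omega>. (3/2) ^ i * gap i (W \<omega>) \<partial>G) \<le> 2 * (3/4) ^ i" .
    qed
    finally show "(\<integral>\<^sup>+\<omega>. ennreal ((3/2) ^ i * gap i (W \<omega>)) \<partial>G) \<le> ennreal (2 * (3/4) ^ i)" .
  qed auto
  also have "\<dots> = ennreal (\<Sum>i. 2 * (3/4) ^ i)"
    by (rule suminf_ennreal2) (auto intro!: summable_mult)
  also have "(\<Sum>i. 2 * (3/4) ^ i) = (8::real)"
    by (subst suminf_mult) (auto simp: suminf_geometric)
  finally show ?thesis by simp
qed

lemma wgap_partial_sum:
  assumes "wgap v \<le> ennreal q" "0 \<le> q"
  shows "(\<Sum>i<n. (3/2) ^ i * gap i v) \<le> q"
proof -
  have "ennreal (\<Sum>i<n. (3/2) ^ i * gap i v) = (\<Sum>i<n. ennreal ((3/2) ^ i * gap i v))"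
    using gap_bounds by (intro sum_ennreal[symmetric]) auto
  also have "\<dots> \<le> wgap v" unfolding wgap_def by (rule sum_le_suminf) auto
  also have "\<dots> \<le> ennreal q" by fact
  finally show ?thesis using assms(2) by (simp add: ennreal_le_iff)
qed

text \<open>Below 1 the truncation in \<open>gap\<close> is inactive, so gaps are true distances and
  can be chained by the triangle inequality; the growing weights bound their sum from
  \<open>k\<close> on by \<open>q * (2/3) ^ k\<close>.\<close>

lemma wgap_mdist:
  assumes q: "wgap v \<le> ennreal q" "0 \<le> q" and k: "q * (2/3) ^ k < 1" "k \<le> n"
  shows "mdist m (T k v) (T n v) \<le> q * (2/3) ^ k"
proof -
  have s: "(\<Sum>i=k..<n. gap i v) \<le> q * (2/3) ^ k" for n
  proof -
    have "(\<Sum>i=k..<n. gap i v) \<le> (\<Sum>i=k..<n. (2/3) ^ k * ((3/2) ^ i * gap i v))"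
    proof (rule sum_mono)
      fix i assume "i \<in> {k..<n}"
      then have "(2/3::real) ^ i \<le> (2/3) ^ k" by (intro power_decreasing) auto
      then have "(2/3) ^ i * ((3/2) ^ i * gap i v) \<le> (2/3) ^ k * ((3/2) ^ i * gap i v)"
        using gap_bounds by (intro mult_right_mono) auto
      moreover have "(2/3) ^ i * ((3/2) ^ i * gap i v) = gap i v"
        by (simp add: mult.assoc[symmetric] power_mult_distrib[symmetric])
      ultimately show "gap i v \<le> (2/3) ^ k * ((3/2) ^ i * gap i v)" by simp
    qed
    also have "\<dots> \<le> (2/3) ^ k * (\<Sum>i<n. (3/2) ^ i * gap i v)"
      unfolding sum_distrib_left[symmetric] using gap_bounds by (intro mult_left_mono sum_mono2) auto
    also have "\<dots> \<le> (2/3) ^ k * q"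
      by (intro mult_left_mono wgap_partial_sum q) auto
    finally show ?thesis by (simp add: mult.commute)
  qed
  have "mdist m (T k v) (T n v) \<le> (\<Sum>i=k..<n. gap i v)"
    using \<open>k \<le> n\<close>
  proof (induction n rule: dec_induct)
    case base
    show ?case using X.mdist_zero[of "T k v"] by simp
  next
    case (step n)
    have "gap n v \<le> (\<Sum>i=k..<Suc n. gap i v)"
      using step(1) gap_bounds by (intro member_le_sum) auto
    then have "gap n v < 1" using s[of "Suc n"] k(1) by linarith
    then have g: "gap n v = mdist m (T n v) (T (Suc n) v)"
      unfolding gap_def by (auto simp: min_def split: if_splits)
    have "mdist m (T k v) (T (Suc n) v) \<le> mdist m (T k v) (T n v) + mdist m (T n v) (T (Suc n) v)"
      by (intro X.triangle) auto
    then show ?case using step g by simp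
  qed
  also have "\<dots> \<le> q * (2/3) ^ k" by (rule s)
  finally show ?thesis .
qed

lemma geometric_small: "(\<epsilon>::real) > 0 \<Longrightarrow> \<exists>k. q * (2/3) ^ k < \<epsilon>"
proof -
  assume e: "\<epsilon> > 0"
  have "(\<lambda>k. q * (2/3) ^ k) \<longlonglongrightarrow> q * 0"
    by (intro tendsto_intros LIMSEQ_power_zero) auto
  then have "\<forall>\<^sub>F k in sequentially. q * (2/3) ^ k < \<epsilon>"
    using e by (intro order_tendstoD(2)) auto
  then show ?thesis by (auto simp: eventually_sequentially)
qed

lemma wgap_limit:
  assumes "wgap v < top"
  shows "\<exists>z. limitin (mtopology_of m) (\<lambda>k. T k v) z sequentially"
proof -
  obtain q where q: "wgap v = ennreal q" "0 \<le> q"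
    using assms by (cases "wgap v") auto
  have "X.MCauchy (\<lambda>k. T k v)"
    unfolding X.MCauchy_def
  proof (intro conjI allI impI)
    fix \<epsilon> :: real assume e: "\<epsilon> > 0"
    then obtain k where k: "q * (2/3) ^ k < min 1 (\<epsilon> / 2)"
      using geometric_small[of "min 1 (\<epsilon> / 2)" q] by auto
    show "\<exists>N. \<forall>n n'. N \<le> n \<longrightarrow> N \<le> n' \<longrightarrow> mdist m (T n v) (T n' v) < \<epsilon>"
    proof (intro exI[of _ k] allI impI)
      fix n n' assume n: "k \<le> n" "k \<le> n'"
      have "mdist m (T n v) (T n' v) \<le> mdist m (T k v) (T n v) + mdist m (T k v) (T n' v)"
        using X.triangle[of "T n v" "T k v" "T n' v"] X.commute[of "T n v" "T k v"] by simp
      also have "\<dots> \<le> q * (2/3) ^ k + q * (2/3) ^ k"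
        using k n q by (intro add_mono wgap_mdist) auto
      also have "\<dots> < \<epsilon>" using k by simp
      finally show "mdist m (T n v) (T n' v) < \<epsilon>" .
    qed
  qed auto
  then show ?thesis
    using complete unfolding mcomplete_of_def X.mcomplete_def top by blast
qed

lemma wgap_limit_mdist:
  assumes q: "wgap v \<le> ennreal q" "0 \<le> q" and k: "q * (2/3) ^ k < 1"
    and z: "limitin (mtopology_of m) (\<lambda>k. T k v) z sequentially"
  shows "mdist m z (T k v) \<le> q * (2/3) ^ k"
proof (rule field_le_epsilon)
  fix \<epsilon> :: real assume e: "\<epsilon> > 0"
  have zM: "z \<in> mspace m" using z unfolding top[symmetric] by (rule X.limitin_mspace)
  obtain N where N: "\<And>n. n \<ge> N \<Longrightarrow> mdist m (T n v) z < \<epsilon>"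
    using z e unfolding top[symmetric] X.limit_metric_sequentially by blast
  let ?n = "max N k"
  have "mdist m z (T k v) \<le> mdist m (T k v) (T ?n v) + mdist m (T ?n v) z"
    using X.triangle[of "T k v" "T ?n v" z] zM X.commute[of z "T k v"] by simp
  also have "\<dots> \<le> q * (2/3) ^ k + \<epsilon>"
    using N[of ?n] by (intro add_mono wgap_mdist q k) auto
  finally show "mdist m z (T k v) \<le> q * (2/3) ^ k + \<epsilon>" .
qed

lemma T_W_measurable: "(\<lambda>\<omega>. T k (W \<omega>)) \<in> measurable G (metric_borel m)"
proof (rule measurable_metric_borelI)
  fix U assume "openin (mtopology_of m) U"
  then have "openin euclidean {v. T k v \<in> U}"
    using openin_continuous_map_preimage[OF T, of U k] by simp
  then have "{v. T k v \<in> U} \<in> sets borel" by simp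
  from measurable_sets[OF W this] show "(\<lambda>\<omega>. T k (W \<omega>)) -` U \<inter> space G \<in> sets G"
    by (simp add: vimage_def)
qed simp

lemma limit_exists:
  "\<exists>Y. Y \<in> measurable G (metric_borel m) \<and>
    (\<forall>\<omega>\<in>space G. wgap (W \<omega>) < top \<longrightarrow> limitin (mtopology_of m) (\<lambda>k. T k (W \<omega>)) (Y \<omega>) sequentially)"
proof -
  \<comment> \<open>Where the weighted sum is infinite, a null set, the sequence is reset to a
    constant, so that a limit exists at every point as \<open>limit_measurable_metric_borel\<close>
    requires.\<close>
  define X where "X k \<omega> = (if wgap (W \<omega>) < top then T k (W \<omega>) else T 0 (\<lambda>_. 0))" for k \<omega>
  have "\<exists>z. limitin (mtopology_of m) (\<lambda>k. X k \<omega>) z sequentially" for \<omega>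
  proof (cases "wgap (W \<omega>) < top")
    case True
    then show ?thesis using wgap_limit by (simp add: X_def)
  next
    case False
    then show ?thesis
      by (intro exI[of _ "T 0 (\<lambda>_. 0)"]) (simp add: X_def)
  qed
  then obtain Y where Y: "\<And>\<omega>. limitin (mtopology_of m) (\<lambda>k. X k \<omega>) (Y \<omega>) sequentially" by metis
  have "X k \<in> measurable G (metric_borel m)" for k
    unfolding X_def[abs_def]
    by (intro measurable_If T_W_measurable measurable_const) (auto simp: space_metric_borel)
  then have "Y \<in> measurable G (metric_borel m)"
    using Y by (rule limit_measurable_metric_borel)
  moreover have "limitin (mtopology_of m) (\<lambda>k. T k (W \<omega>)) (Y \<omega>) sequentially" if "wgap (W \<omega>) < top" for \<omega>
    using Y[of \<omega>] that by (simp add: X_def)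
  ultimately show ?thesis by blast
qed

lemma AE_wgap: "AE \<omega> in G. wgap (W \<omega>) < top"
proof -
  have "(\<integral>\<^sup>+\<omega>. wgap (W \<omega>) \<partial>G) \<noteq> \<infinity>"
    using nn_integral_wgap by (auto simp: top_unique)
  then have "AE \<omega> in G. wgap (W \<omega>) \<noteq> \<infinity>"
    by (intro nn_integral_PInf_AE) measurable
  then show ?thesis by eventually_elim (simp add: less_top)
qed

end

context metric_limit
begin

context
  fixes Y :: "'v \<Rightarrow> 'd"
  assumes Ym [measurable]: "Y \<in> measurable G (metric_borel m)"
    and Ylim: "\<And>\<omega>. \<omega> \<in> space G \<Longrightarrow> wgap (W \<omega>) < top \<Longrightarrow>
      limitin (mtopology_of m) (\<lambda>k. T k (W \<omega>)) (Y \<omega>) sequentially"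
begin

lemma Y_in: "\<omega> \<in> space G \<Longrightarrow> Y \<omega> \<in> mspace m"
  using measurable_space[OF Ym] by (simp add: space_metric_borel)

lemma integral_limit:
  assumes H: "continuous_map (mtopology_of m) euclideanreal H" and B: "\<And>z. z \<in> mspace m \<Longrightarrow> \<bar>H z\<bar> \<le> B"
  shows "(\<lambda>k. \<integral>\<omega>. H (T k (W \<omega>)) \<partial>G) \<longlonglongrightarrow> (\<integral>\<omega>. H (Y \<omega>) \<partial>G)"
proof (rule integral_dominated_convergence[where w="\<lambda>_. B"])
  show "(\<lambda>\<omega>. H (Y \<omega>)) \<in> borel_measurable G"
    by (rule measurable_compose[OF Ym continuous_map_metric_borel[OF H]])
  show "(\<lambda>\<omega>. H (T k (W \<omega>))) \<in> borel_measurable G" for k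
    by (rule measurable_compose[OF T_W_measurable continuous_map_metric_borel[OF H]])
  show "AE \<omega> in G. (\<lambda>k. H (T k (W \<omega>))) \<longlonglongrightarrow> H (Y \<omega>)"
    using AE_wgap
  proof (rule AE_mp, intro AE_I2 impI)
    fix \<omega> assume w: "\<omega> \<in> space G" "wgap (W \<omega>) < top"
    show "(\<lambda>k. H (T k (W \<omega>))) \<longlonglongrightarrow> H (Y \<omega>)"
      using continuous_map_limit[OF H Ylim[OF w]] by (simp add: comp_def)
  qed
  show "AE \<omega> in G. norm (H (T k (W \<omega>))) \<le> B" for k
    using B by auto
qed simp

text \<open>Three comparisons: \<open>Z n\<close> with \<open>T k (V n \<omega>)\<close> by the
  Lipschitz bound, \<open>V n\<close> with \<open>W\<close> by \<open>conv\<close>, and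
  \<open>T k (W \<omega>)\<close> with \<open>Y\<close> by dominated convergence. The index
  \<open>k\<close> is fixed before \<open>n\<close>.\<close>

lemma outer_limit_lipschitz:
  assumes B: "\<And>z. z \<in> mspace m \<Longrightarrow> \<bar>H z\<bar> \<le> B" and C: "0 \<le> C"
    and lip: "\<And>z w. z \<in> mspace m \<Longrightarrow> w \<in> mspace m \<Longrightarrow> \<bar>H z - H w\<bar> \<le> C * mdist m z w"
  shows "(\<lambda>n. outer_expectation M (\<lambda>\<omega>. H (Z n \<omega>))) \<longlonglongrightarrow> (\<integral>\<omega>. H (Y \<omega>) \<partial>G)"
proof (rule LIMSEQ_I)
  have H: "continuous_map (mtopology_of m) euclideanreal H"
  proof -
    have "Lipschitz_continuous_map m euclidean_metric H"
      using lip unfolding Lipschitz_continuous_map_def by (auto simp: dist_real_def)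
    then show ?thesis using Lipschitz_continuous_imp_continuous_map by force
  qed
  have B0: "0 \<le> B" using B[OF T_in[of 0 "\<lambda>_. 0"]] by linarith
  \<comment> \<open>With this constant the increments of \<open>H\<close> are bounded by the
    truncated distance: beyond distance 1 the trivial bound \<open>2 * B\<close> takes over.\<close>
  define D where "D = max C (2 * B)"
  have D0: "0 \<le> D" using C by (simp add: D_def)
  have lipD: "\<bar>H z - H w\<bar> \<le> D * min 1 (mdist m z w)" if "z \<in> mspace m" "w \<in> mspace m" for z w
  proof (cases "mdist m z w \<le> 1")
    case True
    have "C * mdist m z w \<le> D * mdist m z w" by (intro mult_right_mono) (auto simp: D_def)
    then show ?thesis using lip[OF that] True by (simp add: min_def)
  next
    case False
    have "\<bar>H z - H w\<bar> \<le> 2 * B" using B[OF that(1)] B[OF that(2)] by linarith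
    then show ?thesis using False by (simp add: D_def min_def)
  qed
  fix \<epsilon> :: real assume e: "\<epsilon> > 0"
  have "(\<lambda>k. D * (1/2) ^ k) \<longlonglongrightarrow> D * 0"
    by (intro tendsto_intros LIMSEQ_power_zero) auto
  then have "\<forall>\<^sub>F k in sequentially. D * (1/2) ^ k < \<epsilon> / 3"
    using e by (intro order_tendstoD(2)) auto
  moreover have "\<forall>\<^sub>F k in sequentially. \<bar>(\<integral>\<omega>. H (T k (W \<omega>)) \<partial>G) - (\<integral>\<omega>. H (Y \<omega>) \<partial>G)\<bar> < \<epsilon> / 3"
    using tendstoD[OF integral_limit[OF H B], of "\<epsilon>/3"] e by (simp add: dist_real_def)
  ultimately have "\<forall>\<^sub>F k in sequentially. D * (1/2) ^ k < \<epsilon> / 3 \<and>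
      \<bar>(\<integral>\<omega>. H (T k (W \<omega>)) \<partial>G) - (\<integral>\<omega>. H (Y \<omega>) \<partial>G)\<bar> < \<epsilon> / 3"
    by (rule eventually_conj)
  then obtain k where k: "D * (1/2) ^ k < \<epsilon> / 3"
    "\<bar>(\<integral>\<omega>. H (T k (W \<omega>)) \<partial>G) - (\<integral>\<omega>. H (Y \<omega>) \<partial>G)\<bar> < \<epsilon> / 3"
    by (auto simp: eventually_sequentially)
  have "(\<lambda>n. \<integral>\<omega>. H (T k (V n \<omega>)) \<partial>M) \<longlonglongrightarrow> (\<integral>\<omega>. H (T k (W \<omega>)) \<partial>G)"
  proof (rule conv[where B=B and i="K k"])
    show "continuous_on UNIV (\<lambda>v. H (T k v))" by (rule continuous_on_comp_T[OF H])
    show "\<bar>H (T k v)\<bar> \<le> B" for v by (rule B) simp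
    show "H (T k v) = H (T k w)" if "\<And>j. j < K k \<Longrightarrow> v j = w j" for v w
      using T_dep[OF that] by simp
  qed
  from LIMSEQ_D[OF this, of "\<epsilon>/3"] e obtain N1 where
    N1: "\<And>n. n \<ge> N1 \<Longrightarrow> \<bar>(\<integral>\<omega>. H (T k (V n \<omega>)) \<partial>M) - (\<integral>\<omega>. H (T k (W \<omega>)) \<partial>G)\<bar> < \<epsilon> / 3"
    by auto
  obtain N2 where N2: "\<And>n. n \<ge> N2 \<Longrightarrow> \<exists>U. integrable M U \<and> integral\<^sup>L M U \<le> (1/2) ^ k \<and>
      (\<forall>\<omega>\<in>space M. min 1 (mdist m (Z n \<omega>) (T k (V n \<omega>))) \<le> U \<omega>)"
    using approx[of k] by auto
  have Hm: "(\<lambda>v. H (T k v)) \<in> borel_measurable borel"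
    by (rule continuous_borel_measurable_nat[OF continuous_on_comp_T[OF H]])
  show "\<exists>N. \<forall>n\<ge>N. norm (outer_expectation M (\<lambda>\<omega>. H (Z n \<omega>)) - (\<integral>\<omega>. H (Y \<omega>) \<partial>G)) < \<epsilon>"
  proof (intro exI[of _ "max N1 N2"] allI impI)
    fix n assume n: "max N1 N2 \<le> n"
    obtain U where U: "integrable M U" "integral\<^sup>L M U \<le> (1/2) ^ k"
      "\<And>\<omega>. \<omega> \<in> space M \<Longrightarrow> min 1 (mdist m (Z n \<omega>) (T k (V n \<omega>))) \<le> U \<omega>"
      using N2[of n] n by auto
    have "\<bar>outer_expectation M (\<lambda>\<omega>. H (Z n \<omega>)) - (\<integral>\<omega>. H (T k (V n \<omega>)) \<partial>M)\<bar> \<le> (\<integral>\<omega>. D * U \<omega> \<partial>M)"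
    proof (rule M.outer_expectation_near_integral)
      show "\<bar>H (Z n \<omega>)\<bar> \<le> B" if "\<omega> \<in> space M" for \<omega> using B Z that by blast
      show "integrable M (\<lambda>\<omega>. H (T k (V n \<omega>)))"
        using measurable_compose[OF V Hm] B by (intro M.integrable_const_bound[of _ B]) auto
      show "\<bar>H (Z n \<omega>) - H (T k (V n \<omega>))\<bar> \<le> D * U \<omega>" if w: "\<omega> \<in> space M" for \<omega>
        using lipD[OF Z[OF w] T_in] mult_left_mono[OF U(3)[OF w] D0] by (rule order_trans)
    qed (use U in auto)
    also have "\<dots> \<le> D * (1/2) ^ k" using U(2) D0 by (simp add: mult_left_mono)
    finally show "norm (outer_expectation M (\<lambda>\<omega>. H (Z n \<omega>)) - (\<integral>\<omega>. H (Y \<omega>) \<partial>G)) < \<epsilon>"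
      using k N1[of n] n unfolding real_norm_def by linarith
  qed
qed

lemma lipschitz_majorant_close:
  assumes H: "continuous_map (mtopology_of m) euclideanreal H" and B: "\<And>z. z \<in> mspace m \<Longrightarrow> \<bar>H z\<bar> \<le> B"
    and e: "\<epsilon> > 0"
  obtains H' j where "\<And>z. z \<in> mspace m \<Longrightarrow> H z \<le> H' z"
    "\<And>z. z \<in> mspace m \<Longrightarrow> \<bar>H' z\<bar> \<le> B"
    "\<And>z w. z \<in> mspace m \<Longrightarrow> w \<in> mspace m \<Longrightarrow> \<bar>H' z - H' w\<bar> \<le> real j * mdist m z w"
    "(\<integral>\<omega>. H' (Y \<omega>) \<partial>G) < (\<integral>\<omega>. H (Y \<omega>) \<partial>G) + \<epsilon>"
proof -
  obtain Hs :: "nat \<Rightarrow> 'd \<Rightarrow> real" where Hs: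
    "\<And>j z. z \<in> mspace m \<Longrightarrow> H z \<le> Hs j z"
    "\<And>j z. z \<in> mspace m \<Longrightarrow> \<bar>Hs j z\<bar> \<le> B"
    "\<And>j z w. z \<in> mspace m \<Longrightarrow> w \<in> mspace m \<Longrightarrow> \<bar>Hs j z - Hs j w\<bar> \<le> j * mdist m z w"
    "\<And>z. z \<in> mspace m \<Longrightarrow> (\<lambda>j. Hs j z) \<longlonglongrightarrow> H z"
    using lipschitz_majorants[OF H B] by metis
  have cont: "continuous_map (mtopology_of m) euclideanreal (Hs j)" for j
  proof -
    have "Lipschitz_continuous_map m euclidean_metric (Hs j)"
      using Hs(3)[of _ _ j] unfolding Lipschitz_continuous_map_def by (auto simp: dist_real_def)
    then show ?thesis using Lipschitz_continuous_imp_continuous_map by force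
  qed
  have "(\<lambda>j. \<integral>\<omega>. Hs j (Y \<omega>) \<partial>G) \<longlonglongrightarrow> (\<integral>\<omega>. H (Y \<omega>) \<partial>G)"
  proof (rule integral_dominated_convergence[where w="\<lambda>_. B"])
    show "(\<lambda>\<omega>. H (Y \<omega>)) \<in> borel_measurable G"
      by (rule measurable_compose[OF Ym continuous_map_metric_borel[OF H]])
    show "(\<lambda>\<omega>. Hs j (Y \<omega>)) \<in> borel_measurable G" for j
      by (rule measurable_compose[OF Ym continuous_map_metric_borel[OF cont]])
    show "AE \<omega> in G. (\<lambda>j. Hs j (Y \<omega>)) \<longlonglongrightarrow> H (Y \<omega>)"
      using Hs(4) Y_in by (intro AE_I2) auto
    show "AE \<omega> in G. norm (Hs j (Y \<omega>)) \<le> B" for j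
      using Hs(2) Y_in by (intro AE_I2) auto
  qed simp
  then have "\<forall>\<^sub>F j in sequentially. (\<integral>\<omega>. Hs j (Y \<omega>) \<partial>G) < (\<integral>\<omega>. H (Y \<omega>) \<partial>G) + \<epsilon>"
    using e by (intro order_tendstoD(2)) auto
  then obtain j where "(\<integral>\<omega>. Hs j (Y \<omega>) \<partial>G) < (\<integral>\<omega>. H (Y \<omega>) \<partial>G) + \<epsilon>"
    by (auto simp: eventually_sequentially)
  with Hs(1-3) show ?thesis by (rule that)
qed

text \<open>The envelope of \<open>H\<close> bounds the outer expectations from above; the envelope
  of \<open>- H\<close> gives a Lipschitz minorant and the bound from below. Monotonicity does the
  work that linearity would do for integrals.\<close>

lemma outer_limit:
  assumes H: "continuous_map (mtopology_of m) euclideanreal H" and B: "\<And>z. z \<in> mspace m \<Longrightarrow> \<bar>H z\<bar> \<le> B"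
  shows "(\<lambda>n. outer_expectation M (\<lambda>\<omega>. H (Z n \<omega>))) \<longlonglongrightarrow> (\<integral>\<omega>. H (Y \<omega>) \<partial>G)"
proof (rule order_tendstoI)
  fix c assume "(\<integral>\<omega>. H (Y \<omega>) \<partial>G) < c"
  then obtain H' j where H': "\<And>z. z \<in> mspace m \<Longrightarrow> H z \<le> H' z"
    "\<And>z. z \<in> mspace m \<Longrightarrow> \<bar>H' z\<bar> \<le> B"
    "\<And>z w. z \<in> mspace m \<Longrightarrow> w \<in> mspace m \<Longrightarrow> \<bar>H' z - H' w\<bar> \<le> real j * mdist m z w"
    "(\<integral>\<omega>. H' (Y \<omega>) \<partial>G) < c"
    using lipschitz_majorant_close[OF H B, of "c - (\<integral>\<omega>. H (Y \<omega>) \<partial>G)"] by auto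
  have "(\<lambda>n. outer_expectation M (\<lambda>\<omega>. H' (Z n \<omega>))) \<longlonglongrightarrow> (\<integral>\<omega>. H' (Y \<omega>) \<partial>G)"
    by (rule outer_limit_lipschitz[OF H'(2) _ H'(3)]) auto
  then have "\<forall>\<^sub>F n in sequentially. outer_expectation M (\<lambda>\<omega>. H' (Z n \<omega>)) < c"
    by (rule order_tendstoD(2)) fact
  then show "\<forall>\<^sub>F n in sequentially. outer_expectation M (\<lambda>\<omega>. H (Z n \<omega>)) < c"
  proof eventually_elim
    case (elim n)
    have "outer_expectation M (\<lambda>\<omega>. H (Z n \<omega>)) \<le> outer_expectation M (\<lambda>\<omega>. H' (Z n \<omega>))"
      by (rule M.outer_expectation_mono[of _ B _ B]) (auto intro: B H' Z)
    with elim show ?case by simp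
  qed
next
  fix c assume c: "c < (\<integral>\<omega>. H (Y \<omega>) \<partial>G)"
  have H2: "continuous_map (mtopology_of m) euclideanreal (\<lambda>z. - H z)"
    using H by (intro continuous_intros)
  obtain H' j where H': "\<And>z. z \<in> mspace m \<Longrightarrow> - H z \<le> H' z"
    "\<And>z. z \<in> mspace m \<Longrightarrow> \<bar>H' z\<bar> \<le> B"
    "\<And>z w. z \<in> mspace m \<Longrightarrow> w \<in> mspace m \<Longrightarrow> \<bar>H' z - H' w\<bar> \<le> real j * mdist m z w"
    "(\<integral>\<omega>. H' (Y \<omega>) \<partial>G) < - c"
    using lipschitz_majorant_close[OF H2, of B "(\<integral>\<omega>. H (Y \<omega>) \<partial>G) - c"] B c by auto
  have "(\<lambda>n. outer_expectation M (\<lambda>\<omega>. - H' (Z n \<omega>))) \<longlonglongrightarrow> (\<integral>\<omega>. - H' (Y \<omega>) \<partial>G)"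
    by (rule outer_limit_lipschitz[of "\<lambda>z. - H' z" B "real j"])
      (use H'(2,3) in \<open>auto simp: abs_minus_commute\<close>)
  then have "\<forall>\<^sub>F n in sequentially. c < outer_expectation M (\<lambda>\<omega>. - H' (Z n \<omega>))"
    by (rule order_tendstoD(1)) (use H'(4) in simp)
  then show "\<forall>\<^sub>F n in sequentially. c < outer_expectation M (\<lambda>\<omega>. H (Z n \<omega>))"
  proof eventually_elim
    case (elim n)
    have "outer_expectation M (\<lambda>\<omega>. - H' (Z n \<omega>)) \<le> outer_expectation M (\<lambda>\<omega>. H (Z n \<omega>))"
    proof (rule M.outer_expectation_mono[of _ B _ B])
      fix \<omega> assume w: "\<omega> \<in> space M"
      show "- H' (Z n \<omega>) \<le> H (Z n \<omega>)" using H'(1)[OF Z[OF w, of n]] by simp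
    qed (auto intro: B H' Z)
    with elim show ?case by simp
  qed
qed

text \<open>Up to small probability, \<open>W\<close> lies in a compact set \<open>C\<close> and the
  weighted gaps are at most \<open>q\<close>. Then \<open>Y\<close> is, for every large
  \<open>k\<close>, within \<open>q * (2/3) ^ k\<close> of the compact image of \<open>C\<close>
  under \<open>T k\<close>. Such points form a totally bounded set, and completeness makes its
  closure compact.\<close>

lemma limit_law_tight: "tight_law m (distr G (metric_borel m) Y)"
  unfolding tight_law_def
proof (intro allI impI)
  fix \<epsilon> :: real assume e: "\<epsilon> > 0"
  interpret W: prob_space "distr G borel W" by (rule G.prob_space_distr) simp
  \<comment> \<open>The space of real sequences is Polish, so the law of \<open>W\<close> is inner
    regular.\<close>
  have "ennreal (1 - \<epsilon> / 2) < emeasure (distr G borel W) UNIV"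
    using W.emeasure_space_1 e by (auto simp: ennreal_less_one_iff)
  also have "\<dots> = (SUP C \<in> {C. C \<subseteq> UNIV \<and> compact C}. emeasure (distr G borel W) C)"
    by (rule inner_regular) (use W.emeasure_space_1 in auto)
  finally obtain C where C: "compact C" "ennreal (1 - \<epsilon> / 2) < emeasure (distr G borel W) C"
    by (auto simp: less_SUP_iff)
  have Cb: "C \<in> sets borel" using C(1) by (simp add: compact_imp_closed borel_closed)
  have WC: "1 - \<epsilon> / 2 \<le> G.prob (W -` C \<inter> space G)"
    using C(2) Cb by (simp add: W.emeasure_eq_measure measure_distr ennreal_less_iff)
      (metis (no_types, lifting) W.emeasure_eq_measure ennreal_less_iff less_imp_le linorder_not_le
        measure_distr W measure_nonneg order_trans)
  \<comment> \<open>By Markov's inequality and \<open>nn_integral_wgap\<close>, the weighted sum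
    reaches \<open>16 / \<epsilon>\<close> with probability at most
    \<open>8 * \<epsilon> / 16\<close>.\<close>
  define q where "q = 16 / \<epsilon>"
  have q: "0 \<le> q" "0 < \<epsilon> / 16" using e by (auto simp: q_def)
  let ?bad = "{\<omega> \<in> space G. 1 \<le> ennreal (\<epsilon> / 16) * wgap (W \<omega>)}"
  have "emeasure G ?bad \<le> ennreal (\<epsilon> / 16) * (\<integral>\<^sup>+\<omega>. wgap (W \<omega>) * indicator (space G) \<omega> \<partial>G)"
    by (rule order_trans[OF _ nn_integral_Markov_inequality]) auto
  also have "\<dots> = ennreal (\<epsilon> / 16) * (\<integral>\<^sup>+\<omega>. wgap (W \<omega>) \<partial>G)"
    by (intro arg_cong2[where f="(*)"] nn_integral_cong) auto
  also have "\<dots> \<le> ennreal (\<epsilon> / 16) * 8"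
    by (intro mult_left_mono nn_integral_wgap) auto
  also have "\<dots> = ennreal (\<epsilon> / 2)"
    using e by (simp flip: ennreal_numeral add: ennreal_mult'[symmetric])
  finally have bad: "G.prob ?bad \<le> \<epsilon> / 2"
    using e by (simp add: G.emeasure_eq_measure)
  have good: "wgap (W \<omega>) \<le> ennreal q" if "\<omega> \<in> space G" "\<omega> \<notin> ?bad" for \<omega>
  proof (rule ccontr)
    assume "\<not> wgap (W \<omega>) \<le> ennreal q"
    then have "ennreal (\<epsilon> / 16) * ennreal q \<le> ennreal (\<epsilon> / 16) * wgap (W \<omega>)"
      by (intro mult_left_mono) auto
    moreover have "ennreal (\<epsilon> / 16) * ennreal q = 1"
      using e by (simp add: q_def ennreal_mult'[symmetric])
    ultimately show False using that by auto
  qed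
  define S where "S = {z \<in> mspace m. \<forall>k. q * (2/3) ^ k < 1 \<longrightarrow> (\<exists>v\<in>C. mdist m z (T k v) \<le> q * (2/3) ^ k)}"
  have "X.mtotally_bounded S"
    unfolding X.mtotally_bounded_def
  proof (intro allI impI)
    fix \<delta> :: real assume d: "\<delta> > 0"
    obtain k where k: "q * (2/3) ^ k < min 1 (\<delta> / 4)"
      using geometric_small[of "min 1 (\<delta> / 4)" q] d by auto
    have "compactin (mtopology_of m) (T k ` C)"
      using C(1) by (intro image_compactin[OF _ T]) simp
    then have "X.mtotally_bounded (T k ` C)"
      unfolding top[symmetric] by (rule X.compactin_imp_mtotally_bounded)
    then obtain F where F: "finite F" "T k ` C \<subseteq> (\<Union>c\<in>F. X.mball c (\<delta> / 4))"
      unfolding X.mtotally_bounded_def using d by (metis zero_less_divide_iff zero_less_numeral)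
    \<comment> \<open>The centres of this net need not lie in \<open>S\<close>, while total
      boundedness asks for centres in \<open>S\<close>. Each centre that is close to
      \<open>S\<close> is replaced by a nearby point of \<open>S\<close>, at the cost of doubling
      the radius.\<close>
    define s where "s c = (SOME z. z \<in> S \<and> mdist m c z < \<delta> / 2)" for c
    define F' where "F' = {c \<in> F. \<exists>z. z \<in> S \<and> mdist m c z < \<delta> / 2}"
    have s: "s c \<in> S \<and> mdist m c (s c) < \<delta> / 2" if "c \<in> F'" for c
      unfolding s_def by (rule someI_ex) (use that in \<open>simp add: F'_def\<close>)
    show "\<exists>K. finite K \<and> K \<subseteq> S \<and> S \<subseteq> (\<Union>x\<in>K. X.mball x \<delta>)"
    proof (intro exI[of _ "s ` F'"] conjI subsetI)
      show "finite (s ` F')" using F by (simp add: F'_def)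
      show "z \<in> S" if "z \<in> s ` F'" for z using that s by auto
      fix z assume z: "z \<in> S"
      then obtain v where v: "v \<in> C" "mdist m z (T k v) \<le> q * (2/3) ^ k"
        using k by (auto simp: S_def)
      then obtain c where c: "c \<in> F" "c \<in> mspace m" "mdist m c (T k v) < \<delta> / 4"
        using F(2) by fastforce
      have zM: "z \<in> mspace m" using z by (simp add: S_def)
      have "mdist m c z \<le> mdist m c (T k v) + mdist m z (T k v)"
        using X.triangle[of c "T k v" z] c zM X.commute[of z] by simp
      also have "\<dots> < \<delta> / 2" using c v k by simp
      finally have cz: "mdist m c z < \<delta> / 2" .
      then have cF: "c \<in> F'" using c z by (auto simp: F'_def)
      have sM: "s c \<in> mspace m" using s[OF cF] by (simp add: S_def)
      have "mdist m (s c) z \<le> mdist m c (s c) + mdist m c z"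
        using X.triangle[of "s c" c z] c zM sM X.commute[of "s c" c] by simp
      also have "\<dots> < \<delta>" using cz s[OF cF] by simp
      finally show "z \<in> (\<Union>x\<in>s ` F'. X.mball x \<delta>)"
        using cF zM sM by auto
    qed
  qed
  then have comp: "compactin (mtopology_of m) (mtopology_of m closure_of S)"
    using X.mtotally_bounded_eq_compact_closure_of complete unfolding mcomplete_of_def top by blast
  have cl: "mtopology_of m closure_of S \<in> sets (metric_borel m)"
    by (rule closedin_metric_borel) simp
  have YS: "Y \<omega> \<in> mtopology_of m closure_of S" if w: "\<omega> \<in> W -` C \<inter> space G - ?bad" for \<omega>
  proof -
    have wq: "wgap (W \<omega>) \<le> ennreal q" using good w by auto
    then have "wgap (W \<omega>) < top" by (rule order_le_less_trans) simp
    then have lim: "limitin (mtopology_of m) (\<lambda>k. T k (W \<omega>)) (Y \<omega>) sequentially"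
      using Ylim w by auto
    have "Y \<omega> \<in> S"
      unfolding S_def using Y_in w wgap_limit_mdist[OF wq q(1) _ lim] by auto
    moreover have "S \<subseteq> mtopology_of m closure_of S"
      by (rule closure_of_subset) (auto simp: S_def)
    ultimately show ?thesis by auto
  qed
  have "1 - \<epsilon> \<le> G.prob (W -` C \<inter> space G) - G.prob ?bad"
    using WC bad by simp
  also have "\<dots> \<le> G.prob (W -` C \<inter> space G - ?bad)"
  proof -
    have "G.prob (W -` C \<inter> space G) \<le> G.prob ((W -` C \<inter> space G - ?bad) \<union> ?bad)"
      using Cb measurable_sets[OF W, of C] by (intro G.finite_measure_mono) auto
    also have "\<dots> \<le> G.prob (W -` C \<inter> space G - ?bad) + G.prob ?bad"
      using Cb measurable_sets[OF W, of C] by (intro measure_Un_le) auto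
    finally show ?thesis by simp
  qed
  also have "\<dots> \<le> G.prob (Y -` (mtopology_of m closure_of S) \<inter> space G)"
    using YS measurable_sets[OF Ym cl] by (intro G.finite_measure_mono) auto
  also have "\<dots> = measure (distr G (metric_borel m) Y) (mtopology_of m closure_of S)"
    using cl by (simp add: measure_distr)
  finally show "\<exists>K. compactin (mtopology_of m) K \<and> 1 - \<epsilon> \<le> measure (distr G (metric_borel m) Y) K"
    using comp by blast
qed

end

theorem weak_limit:
  "\<exists>L. HJ_weakly_converges M m Z L \<and> tight_law m L"
proof -
  obtain Y where Y: "Y \<in> measurable G (metric_borel m)"
    "\<And>\<omega>. \<omega> \<in> space G \<Longrightarrow> wgap (W \<omega>) < top \<Longrightarrow>
      limitin (mtopology_of m) (\<lambda>k. T k (W \<omega>)) (Y \<omega>) sequentially"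
    using limit_exists by blast
  let ?L = "distr G (metric_borel m) Y"
  have "HJ_weakly_converges M m Z ?L"
    unfolding HJ_weakly_converges_def
  proof (intro conjI allI impI)
    show "Z n \<in> space M \<rightarrow> mspace m" for n using Z by auto
    show "prob_space ?L" by (rule G.prob_space_distr[OF Y(1)])
    show "space ?L = mspace m" by (simp add: space_metric_borel)
    fix H assume H: "continuous_map (mtopology_of m) euclideanreal H \<and> bounded (H ` mspace m)"
    then obtain B where B: "\<And>z. z \<in> mspace m \<Longrightarrow> \<bar>H z\<bar> \<le> B"
      unfolding bounded_iff by auto
    have "integral\<^sup>L ?L H = (\<integral>\<omega>. H (Y \<omega>) \<partial>G)"
      using H by (intro integral_distr[OF Y(1)] continuous_map_metric_borel) simp
    then show "(\<lambda>n. outer_expectation M (\<lambda>\<omega>. H (Z n \<omega>))) \<longlonglongrightarrow> integral\<^sup>L ?L H"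
      using outer_limit[OF Y, of H B] H B by simp
  qed simp
  then show ?thesis using limit_law_tight[OF Y] by blast
qed

end

section \<open>Sufficiency of finite approximation\<close>

abbreviation ell :: "'b set \<Rightarrow> ('b \<Rightarrow> real) metric" where
  "ell F \<equiv> funspace F euclidean_metric"

lemma mspace_ell: "z \<in> mspace (ell F) \<longleftrightarrow> z \<in> extensional F \<and> (\<exists>B. \<forall>g\<in>F. \<bar>z g\<bar> \<le> B)"
proof -
  have "Metric_space.mbounded UNIV dist (z ` F) \<longleftrightarrow> bounded (z ` F)"
    by simp
  then show ?thesis
    by (auto simp: Metric_space.fspace_def[OF Met_TC.Metric_space_axioms] bounded_iff)
qed

lemma mdist_ell_ge:
  assumes "z \<in> mspace (ell F)" "w \<in> mspace (ell F)" "g \<in> F"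
  shows "\<bar>z g - w g\<bar> \<le> mdist (ell F) z w"
  using funspace_mdist_le[OF assms(1,2), of "mdist (ell F) z w"] assms(3)
  by (auto simp: dist_real_def simp del: mdist_funspace mspace_funspace)

lemma mdist_ell_le:
  assumes "z \<in> mspace (ell F)" "w \<in> mspace (ell F)" "0 \<le> c" "\<And>g. g \<in> F \<Longrightarrow> \<bar>z g - w g\<bar> \<le> c"
  shows "mdist (ell F) z w \<le> c"
proof (cases "F = {}")
  case True
  then show ?thesis using assms(3) by (simp add: Metric_space.fdist_empty[OF Met_TC.Metric_space_axioms])
next
  case False
  then show ?thesis
    using funspace_mdist_le[OF assms(1,2) False] assms(4)
    by (auto simp: dist_real_def simp del: mdist_funspace mspace_funspace)
qed

lemma min_1_mdist_ell_le:
  assumes "z \<in> mspace (ell F)" "w \<in> mspace (ell F)" "0 \<le> u" "\<And>g. g \<in> F \<Longrightarrow> min 1 \<bar>z g - w g\<bar> \<le> u"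
  shows "min 1 (mdist (ell F) z w) \<le> u"
proof (cases "1 \<le> u")
  case False
  have "mdist (ell F) z w \<le> u"
  proof (rule mdist_ell_le[OF assms(1-3)])
    fix g assume "g \<in> F"
    from assms(4)[OF this] False show "\<bar>z g - w g\<bar> \<le> u" by (auto simp: min_def split: if_splits)
  qed
  then show ?thesis by (rule min.coboundedI2)
qed (simp add: min.coboundedI1)

lemma mcomplete_ell: "mcomplete_of (ell F)"
proof -
  have "Met_TC.Self = (euclidean_metric :: real metric)"
    by (simp add: Met_TC.Self_def euclidean_metric_def)
  moreover have "mcomplete_of (funspace F (Met_TC.Self :: real metric))"
    by (rule Met_TC.mcomplete_funspace) (simp add: complete_UNIV)
  ultimately show ?thesis by simp
qed

text \<open>The supremum over \<open>F\<close> need not be measurable, so smallness in outer probability is expressed by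
  an integrable majorant \<open>U\<close>; truncation at 1 turns it into smallness in expectation.\<close>

abbreviation outer_close ::
    "'a pmf \<Rightarrow> ('a \<Rightarrow> real) set \<Rightarrow> (('a \<Rightarrow> real) \<Rightarrow> 'a \<Rightarrow> real) \<Rightarrow> real \<Rightarrow> nat \<Rightarrow> bool" where
  "outer_close r F \<pi> \<epsilon> n \<equiv> \<exists>U. integrable (sample r) U \<and> integral\<^sup>L (sample r) U \<le> \<epsilon> \<and>
    (\<forall>\<omega>. 0 \<le> U \<omega> \<and> (\<forall>g\<in>F. min 1 \<bar>emp r g n \<omega> - emp r (\<pi> g) n \<omega>\<bar> \<le> U \<omega>))"

text \<open>Because the approximants \<open>\<pi> g\<close> are bounded by \<open>C\<close> and supported in \<open>A\<close>, their empirical process is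
  a Lipschitz image of finitely many cell counts.\<close>

definition approximable :: "'a pmf \<Rightarrow> ('a \<Rightarrow> real) set \<Rightarrow> bool" where
  "approximable r F \<longleftrightarrow> (\<forall>\<epsilon>>0. \<exists>A \<pi> C N. finite A \<and>
    (\<forall>g\<in>F. \<forall>y. \<bar>\<pi> g y\<bar> \<le> C \<and> (y \<notin> A \<longrightarrow> \<pi> g y = 0)) \<and>
    (\<forall>n\<ge>N. outer_close r F \<pi> \<epsilon> n))"

lemma empirical_process_in_ell:
  assumes "\<And>g. g \<in> F \<Longrightarrow> integrable (measure_pmf r) g"
  shows "empirical_process r F n \<omega> \<in> mspace (ell F) \<longleftrightarrow> (\<exists>B. \<forall>g\<in>F. \<bar>emp r g n \<omega>\<bar> \<le> B)"
  unfolding mspace_ell using assms by (simp add: empirical_process_extensional empirical_process_eq)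

definition simple_functional :: "('a \<Rightarrow> nat) \<Rightarrow> ('a \<Rightarrow> real) set \<Rightarrow> 'a set \<Rightarrow> (('a \<Rightarrow> real) \<Rightarrow> 'a \<Rightarrow> real)
    \<Rightarrow> (nat \<Rightarrow> real) \<Rightarrow> ('a \<Rightarrow> real) \<Rightarrow> real" where
  "simple_functional e F A \<pi> v = (\<lambda>g\<in>F. \<Sum>y\<in>A. \<pi> g y * v (e y))"

lemma simple_functional_in_ell:
  assumes C: "\<And>g y. g \<in> F \<Longrightarrow> \<bar>\<pi> g y\<bar> \<le> C"
  shows "simple_functional e F A \<pi> v \<in> mspace (ell F)"
  unfolding mspace_ell
proof (intro conjI exI ballI)
  fix g assume g: "g \<in> F"
  have "\<bar>\<Sum>y\<in>A. \<pi> g y * v (e y)\<bar> \<le> (\<Sum>y\<in>A. \<bar>\<pi> g y * v (e y)\<bar>)" by (rule sum_abs)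
  also have "\<dots> \<le> (\<Sum>y\<in>A. C * \<bar>v (e y)\<bar>)"
    using C[OF g] by (intro sum_mono) (simp add: abs_mult mult_right_mono)
  finally show "\<bar>simple_functional e F A \<pi> v g\<bar> \<le> (\<Sum>y\<in>A. C * \<bar>v (e y)\<bar>)"
    using g by (simp add: simple_functional_def)
qed (simp add: simple_functional_def)

text \<open>The uniform bound \<open>C\<close> turns the supremum over \<open>F\<close> into a
  weighted sum over the coordinates labelled by \<open>A\<close>, and such a sum is continuous for
  the product topology.\<close>

lemma simple_functional_continuous:
  assumes C: "\<And>g y. g \<in> F \<Longrightarrow> \<bar>\<pi> g y\<bar> \<le> C"
  shows "continuous_map euclidean (mtopology_of (ell F)) (simple_functional e F A \<pi>)"
proof -
  interpret X: Metric_space "mspace (ell F)" "mdist (ell F)" by (rule Metric_space_mspace_mdist)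
  have top: "X.mtopology = mtopology_of (ell F)" by (simp only: mtopology_of_def)
  note in_ell = simple_functional_in_ell[of F \<pi> C, OF C]
  \<comment> \<open>The modulus of \<open>C\<close> is taken because an empty \<open>F\<close> does
    not force \<open>C\<close> to be nonnegative.\<close>
  have dist: "mdist (ell F) (simple_functional e F A \<pi> v) (simple_functional e F A \<pi> w) \<le>
      (\<Sum>y\<in>A. \<bar>C\<bar> * \<bar>v (e y) - w (e y)\<bar>)" for v w
  proof (rule mdist_ell_le[OF in_ell in_ell])
    fix g assume g: "g \<in> F"
    have "\<bar>(\<Sum>y\<in>A. \<pi> g y * v (e y)) - (\<Sum>y\<in>A. \<pi> g y * w (e y))\<bar> = \<bar>\<Sum>y\<in>A. \<pi> g y * (v (e y) - w (e y))\<bar>"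
      by (simp add: sum_subtractf right_diff_distrib)
    also have "\<dots> \<le> (\<Sum>y\<in>A. \<bar>\<pi> g y * (v (e y) - w (e y))\<bar>)" by (rule sum_abs)
    also have "\<dots> \<le> (\<Sum>y\<in>A. \<bar>C\<bar> * \<bar>v (e y) - w (e y)\<bar>)"
      using C[OF g] by (intro sum_mono) (auto simp: abs_mult intro!: mult_right_mono order_trans[OF _ abs_ge_self[of C]])
    finally show "\<bar>simple_functional e F A \<pi> v g - simple_functional e F A \<pi> w g\<bar> \<le>
        (\<Sum>y\<in>A. \<bar>C\<bar> * \<bar>v (e y) - w (e y)\<bar>)"
      using g by (simp add: simple_functional_def)
  qed (auto intro: sum_nonneg)
  show ?thesis
    unfolding top[symmetric] X.continuous_map_to_metric
  proof (intro ballI allI impI)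
    fix v :: "nat \<Rightarrow> real" and \<epsilon> :: real assume e: "\<epsilon> > 0"
    let ?U = "{w. (\<Sum>y\<in>A. \<bar>C\<bar> * \<bar>v (e y) - w (e y)\<bar>) < \<epsilon>}"
    have "open ?U"
      by (intro open_Collect_less continuous_intros continuous_on_product_coordinates)
    moreover have "v \<in> ?U" using e by simp
    moreover have "simple_functional e F A \<pi> w \<in> X.mball (simple_functional e F A \<pi> v) \<epsilon>" if "w \<in> ?U" for w
      using dist[of v w] that in_ell by (simp only: X.in_mball) simp
    ultimately show "\<exists>U. openin euclidean U \<and> v \<in> U \<and>
        (\<forall>w\<in>U. simple_functional e F A \<pi> w \<in> X.mball (simple_functional e F A \<pi> v) \<epsilon>)"
      by (intro exI[of _ ?U]) auto
  qed
qed

lemma simple_functional_cell_emp: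
  assumes e: "inj e" and A: "finite A" "\<And>g y. g \<in> F \<Longrightarrow> y \<notin> A \<Longrightarrow> \<pi> g y = 0" and g: "g \<in> F"
  shows "simple_functional e F A \<pi> (cell_emp e r n \<omega>) g = emp r (\<pi> g) n \<omega>"
proof -
  have "cell_emp e r n \<omega> (e y) = emp r (indicator {y}) n \<omega>" for y
  proof -
    have "(\<lambda>z. indicator {e y} (e z)) = (indicator {y} :: 'a \<Rightarrow> real)"
      using e by (auto simp: fun_eq_iff indicator_def inj_eq)
    then show ?thesis by (simp add: cell_emp_def)
  qed
  then show ?thesis
    using g emp_finite_support[OF A(1), of "\<pi> g" r n \<omega>] A(2)[OF g] by (simp add: simple_functional_def)
qed

text \<open>An injective \<open>e\<close> puts distinct points into distinct cells, so the simple
  functional of the cell counts is exactly the empirical process of the approximants. Path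
  boundedness places the empirical process itself in \<open>ell F\<close>.\<close>

theorem Donsker_if_approximable:
  fixes e :: "'a \<Rightarrow> nat" and r :: "'a pmf"
  assumes e: "inj e" and int: "\<And>g. g \<in> F \<Longrightarrow> integrable (measure_pmf r) g"
    and bdd: "\<And>n \<omega>. \<exists>B. \<forall>g\<in>F. \<bar>emp r g n \<omega>\<bar> \<le> B" and approx: "approximable r F"
  shows "Donsker r F"
proof -
  interpret P: prob_space "sample r" by (rule prob_space_sample)
  interpret N: prob_space gauss by (rule prob_space_gauss)
  have "\<forall>k. \<exists>A \<pi> C N. finite A \<and> (\<forall>g\<in>F. \<forall>y. \<bar>\<pi> g y\<bar> \<le> C \<and> (y \<notin> A \<longrightarrow> \<pi> g y = 0)) \<and>
    (\<forall>n\<ge>N. outer_close r F \<pi> ((1/2) ^ k) n)"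
    using approx unfolding approximable_def by (simp only: zero_less_power half_gt_zero_iff zero_less_one simp_thms)
  then obtain A \<pi> C N where ap: "\<And>k. finite (A k)"
    "\<And>k g y. g \<in> F \<Longrightarrow> \<bar>\<pi> k g y\<bar> \<le> C k" "\<And>k g y. g \<in> F \<Longrightarrow> y \<notin> A k \<Longrightarrow> \<pi> k g y = 0"
    "\<And>k n. n \<ge> N k \<Longrightarrow> outer_close r F (\<pi> k) ((1/2) ^ k) n"
    by metis
  define T where "T k = simple_functional e F (A k) (\<pi> k)" for k
  \<comment> \<open>A crude strict upper bound for all labels of \<open>A k\<close>, valid for empty
    \<open>A k\<close> too.\<close>
  define K where "K k = Suc (\<Sum>y\<in>A k. e y)" for k
  have eK: "e y < K k" if "y \<in> A k" for y k
    using member_le_sum[OF that, of e] ap(1) by (simp add: K_def)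
  have Z: "empirical_process r F n \<omega> \<in> mspace (ell F)" for n \<omega>
    using bdd int by (simp only: empirical_process_in_ell)
  have Tin: "T k v \<in> mspace (ell F)" for k v
    unfolding T_def by (rule simple_functional_in_ell[OF ap(2)])
  interpret metric_limit "sample r" gauss "ell F" "empirical_process r F" T K "cell_emp e r"
    "bridge_step (cell e r)"
  proof
    show "empirical_process r F n \<omega> \<in> mspace (ell F)" for n \<omega> by (rule Z)
    show "continuous_map euclidean (mtopology_of (ell F)) (T k)" for k
      unfolding T_def by (rule simple_functional_continuous[OF ap(2)])
    show "T k v = T k w" if "\<And>j. j < K k \<Longrightarrow> v j = w j" for k v w
      unfolding T_def simple_functional_def using that eK by (intro restrict_ext sum.cong) auto
    show "(\<lambda>n. \<integral>\<omega>. \<phi> (cell_emp e r n \<omega>) \<partial>sample r) \<longlonglongrightarrow> (\<integral>\<omega>. \<phi> (bridge_step (cell e r) \<omega>) \<partial>gauss)"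
      if "continuous_on UNIV \<phi>" "\<And>v. \<bar>\<phi> v\<bar> \<le> B" "\<And>v w. (\<And>j. j < i \<Longrightarrow> v j = w j) \<Longrightarrow> \<phi> v = \<phi> w"
      for \<phi> :: "(nat \<Rightarrow> real) \<Rightarrow> real" and B i
      using that by (rule cell_emp_CLT)
    show "\<exists>N. \<forall>n\<ge>N. \<exists>U. integrable (sample r) U \<and> integral\<^sup>L (sample r) U \<le> (1/2) ^ k \<and>
      (\<forall>\<omega>\<in>space (sample r). min 1 (mdist (ell F) (empirical_process r F n \<omega>) (T k (cell_emp e r n \<omega>))) \<le> U \<omega>)" for k
    proof (intro exI[of _ "N k"] allI impI)
      fix n assume "N k \<le> n"
      from ap(4)[OF this] obtain U where U: "integrable (sample r) U" "integral\<^sup>L (sample r) U \<le> (1/2) ^ k"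
        "\<And>\<omega>. 0 \<le> U \<omega>" "\<And>\<omega> g. g \<in> F \<Longrightarrow> min 1 \<bar>emp r g n \<omega> - emp r (\<pi> k g) n \<omega>\<bar> \<le> U \<omega>"
        by auto
      have "min 1 (mdist (ell F) (empirical_process r F n \<omega>) (T k (cell_emp e r n \<omega>))) \<le> U \<omega>" for \<omega>
      proof (rule min_1_mdist_ell_le[OF Z Tin U(3)])
        fix g assume g: "g \<in> F"
        show "min 1 \<bar>empirical_process r F n \<omega> g - T k (cell_emp e r n \<omega>) g\<bar> \<le> U \<omega>"
          using U(4)[OF g, of \<omega>] int[OF g] g
          by (simp add: empirical_process_eq T_def simple_functional_cell_emp[OF e ap(1) ap(3) g])
      qed
      then show "\<exists>U. integrable (sample r) U \<and> integral\<^sup>L (sample r) U \<le> (1/2) ^ k \<and>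
        (\<forall>\<omega>\<in>space (sample r). min 1 (mdist (ell F) (empirical_process r F n \<omega>) (T k (cell_emp e r n \<omega>))) \<le> U \<omega>)"
        using U by blast
    qed
    show "mcomplete_of (ell F)" by (rule mcomplete_ell)
  qed measurable
  show ?thesis
    unfolding Donsker_def using weak_limit int integrable_pmf_iff_summable by blast
qed

section \<open>The converse of the central limit theorem\<close>

lemma expectation_sum_le:
  fixes \<phi> :: "'a \<Rightarrow> real"
  assumes "integrable (measure_pmf r) \<phi>" "\<And>y. 0 \<le> \<phi> y" "finite B"
  shows "(\<Sum>y\<in>B. \<phi> y * pmf r y) \<le> E r \<phi>"
proof -
  have "(\<Sum>y\<in>B. \<phi> y * pmf r y) = (\<Sum>y\<in>B. (\<phi> y * indicator B y) * pmf r y)"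
    by (intro sum.cong) auto
  also have "\<dots> = E r (\<lambda>y. \<phi> y * indicator B y)"
    by (rule integral_measure_pmf_real[symmetric]) (use assms(3) in \<open>auto simp: indicator_def split: if_splits\<close>)
  also have "\<dots> \<le> E r \<phi>"
    using assms(2) by (intro integral_mono integrable_real_mult_indicator assms(1)) (auto simp: indicator_def)
  finally show ?thesis .
qed

lemma integrable_of_bounded_sums:
  fixes \<phi> :: "'a \<Rightarrow> real"
  assumes "\<And>y. 0 \<le> \<phi> y" and "\<And>B. finite B \<Longrightarrow> (\<Sum>y\<in>B. \<phi> y * pmf r y) \<le> c"
  shows "integrable (measure_pmf r) \<phi>"
  unfolding integrable_pmf_iff_summable
  by (rule nonneg_bdd_above_summable_on) (use assms in \<open>auto intro!: bdd_aboveI[of _ c]\<close>)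

text \<open>The squared modulus of \<open>E exp (i s g)\<close> in real terms. Passing to the
  modulus removes the dependence on the centring of \<open>g\<close>.\<close>

definition charmod :: "'a pmf \<Rightarrow> ('a \<Rightarrow> real) \<Rightarrow> real \<Rightarrow> real" where
  "charmod r g s = (E r (\<lambda>y. cos (s * g y)))\<^sup>2 + (E r (\<lambda>y. sin (s * g y)))\<^sup>2"

lemma integrable_cos_sin:
  fixes g :: "'a \<Rightarrow> real"
  shows "integrable (measure_pmf r) (\<lambda>y. cos (g y))" "integrable (measure_pmf r) (\<lambda>y. sin (g y))"
  by (auto intro!: measure_pmf.integrable_bnd bndI[of _ 1])

text \<open>The squared modulus of a characteristic function is the characteristic function of the
  symmetrised variable \<open>g y - g y'\<close>.\<close>

lemma charmod_symmetrised:
  "charmod r g s = E r (\<lambda>y. E r (\<lambda>y'. cos (s * (g y - g y'))))"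
  by (simp add: right_diff_distrib cos_diff integrable_cos_sin charmod_def power2_eq_square)

text \<open>The integrand \<open>1 - cos\<close> of the symmetrised variable is nonnegative, so one
  may keep only the atom \<open>y0\<close> of one copy and the points of \<open>B\<close> of the
  other. Discreteness of \<open>r\<close> thus undoes the symmetrisation.\<close>

lemma one_minus_charmod_ge:
  assumes B: "finite B"
  shows "pmf r y0 * (\<Sum>y\<in>B. (1 - cos (s * (g y0 - g y))) * pmf r y) \<le> 1 - charmod r g s"
proof -
  have i: "integrable (measure_pmf r) (\<lambda>y'. cos (s * (g y - g y')))" for y
    by (rule integrable_cos_sin)
  have le: "E r (\<lambda>y'. cos (s * (g y - g y'))) \<le> 1" for y
    using integral_mono[of "measure_pmf r" "\<lambda>y'. cos (s * (g y - g y'))" "\<lambda>_. 1"] i by simp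
  have ge: "- 1 \<le> E r (\<lambda>y'. cos (s * (g y - g y')))" for y
    using integral_mono[of "measure_pmf r" "\<lambda>_. - 1" "\<lambda>y'. cos (s * (g y - g y'))"] i by simp
  have j: "integrable (measure_pmf r) (\<lambda>y. E r (\<lambda>y'. cos (s * (g y - g y'))))"
    using le ge by (intro measure_pmf.integrable_bnd bndI[of _ 1]) (auto simp: abs_le_iff minus_le_iff)
  have "(\<Sum>y\<in>B. (1 - cos (s * (g y0 - g y))) * pmf r y) \<le> E r (\<lambda>y. 1 - cos (s * (g y0 - g y)))"
    using i by (intro expectation_sum_le B) auto
  also have "\<dots> = 1 - E r (\<lambda>y'. cos (s * (g y0 - g y')))"
    using i by simp
  finally have "pmf r y0 * (\<Sum>y\<in>B. (1 - cos (s * (g y0 - g y))) * pmf r y) \<le>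
      (\<Sum>y\<in>{y0}. (1 - E r (\<lambda>y'. cos (s * (g y - g y')))) * pmf r y)"
    by (simp add: mult.commute mult_left_mono)
  also have "\<dots> \<le> E r (\<lambda>y. 1 - E r (\<lambda>y'. cos (s * (g y - g y'))))"
    using j le by (intro expectation_sum_le) auto
  also have "\<dots> = 1 - charmod r g s"
    using j by (simp add: charmod_symmetrised)
  finally show ?thesis .
qed

text \<open>By independence the characteristic function of the normalised sum is an
  \<open>n\<close>-th power. Centring only rotates it, so the modulus is that of \<open>g\<close>
  itself.\<close>

lemma charmod_emp:
  "(\<integral>\<omega>. cos (t * emp r g n \<omega>) \<partial>sample r)\<^sup>2 + (\<integral>\<omega>. sin (t * emp r g n \<omega>) \<partial>sample r)\<^sup>2 =
    charmod r g (t / sqrt n) ^ n"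
proof -
  interpret P: prob_space "sample r" by (rule prob_space_sample)
  define Y where "Y y = g y - E r g" for y
  define s where "s = t / sqrt n"
  have norm2: "(cmod (CLINT x|M. iexp (f x)))\<^sup>2 = (\<integral>x. cos (f x) \<partial>M)\<^sup>2 + (\<integral>x. sin (f x) \<partial>M)\<^sup>2"
    if "prob_space M" "f \<in> borel_measurable M" for M and f :: "'b \<Rightarrow> real"
  proof -
    interpret M: prob_space M by fact
    have "integrable M (\<lambda>x. iexp (f x))"
      using that(2) by (intro M.integrable_const_bound[of _ 1]) auto
    then have "Re (CLINT x|M. iexp (f x)) = (\<integral>x. cos (f x) \<partial>M)" "Im (CLINT x|M. iexp (f x)) = (\<integral>x. sin (f x) \<partial>M)"
      by (simp_all add: integral_Re[symmetric] integral_Im[symmetric] Re_exp Im_exp)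
    then show ?thesis by (simp add: cmod_power2)
  qed
  have ind: "P.indep_vars (\<lambda>_. borel) (\<lambda>i \<omega>. iexp (s * Y (\<omega> i))) {..<n}"
    by (rule P.indep_vars_subset[OF P.indep_vars_compose2[OF indep_vars_PiM_coords[OF prob_space_measure_pmf]]]) auto
  have "(CLINT \<omega>|sample r. iexp (t * emp r g n \<omega>)) = (CLINT \<omega>|sample r. (\<Prod>i<n. iexp (s * Y (\<omega> i))))"
  proof (rule Bochner_Integration.integral_cong[OF refl])
    fix \<omega> :: "nat \<Rightarrow> 'a"
    have "t * emp r g n \<omega> = (\<Sum>i<n. s * Y (\<omega> i))"
      by (simp add: emp_def s_def Y_def sum_distrib_left sum_divide_distrib)
    then show "iexp (t * emp r g n \<omega>) = (\<Prod>i<n. iexp (s * Y (\<omega> i)))"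
      by (simp add: exp_sum sum_distrib_left)
  qed
  also have "\<dots> = (\<Prod>i<n. CLINT \<omega>|sample r. iexp (s * Y (\<omega> i)))"
  proof (rule P.indep_vars_lebesgue_integral[OF _ ind])
    show "integrable (sample r) (\<lambda>\<omega>. iexp (s * Y (\<omega> i)))" for i
      by (intro P.integrable_const_bound[of _ 1] measurable_sample_coord) auto
  qed simp
  also have "\<dots> = (\<Prod>i<n. CLINT y|measure_pmf r. iexp (s * Y y))"
    by (intro prod.cong refl PiM_coord_integral(1) prob_space_measure_pmf) simp
  finally have "(CLINT \<omega>|sample r. iexp (t * emp r g n \<omega>)) = (CLINT y|measure_pmf r. iexp (s * Y y)) ^ n"
    by simp
  then have "(cmod (CLINT \<omega>|sample r. iexp (t * emp r g n \<omega>)))\<^sup>2 = ((cmod (CLINT y|measure_pmf r. iexp (s * Y y)))\<^sup>2) ^ n"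
    by (simp add: norm_power power_mult[symmetric] mult.commute)
  then have "(\<integral>\<omega>. cos (t * emp r g n \<omega>) \<partial>sample r)\<^sup>2 + (\<integral>\<omega>. sin (t * emp r g n \<omega>) \<partial>sample r)\<^sup>2 = charmod r Y s ^ n"
    using norm2[OF prob_space_sample, of "\<lambda>\<omega>. t * emp r g n \<omega>" r]
      norm2[OF prob_space_measure_pmf, of "\<lambda>y. s * Y y" r] by (simp add: charmod_def)
  also have "charmod r Y s = charmod r g s"
    by (simp add: charmod_symmetrised Y_def)
  finally show ?thesis by (simp add: s_def)
qed

text \<open>By the half-angle formula the expression is \<open>c\<^sup>2 / 2\<close> times the
  square of \<open>sin h / h\<close> at \<open>h = c / (2 * sqrt n)\<close>.\<close>

lemma one_minus_cos_limit:
  "(\<lambda>n. real n * (1 - cos (c / sqrt n))) \<longlonglongrightarrow> c\<^sup>2 / 2"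
proof (cases "c = 0")
  case False
  have lim: "(\<lambda>h. sin h / h :: real) \<midarrow>0\<rightarrow> 1"
    using DERIV_sin[of 0] by (simp add: DERIV_def)
  have "(\<lambda>n. c / (2 * sqrt (real n))) \<longlonglongrightarrow> 0"
    by (intro tendsto_divide_0[OF tendsto_const] filterlim_at_top_imp_at_infinity
        filterlim_tendsto_pos_mult_at_top[OF tendsto_const] filterlim_compose[OF sqrt_at_top]
        filterlim_real_sequentially) auto
  then have "filterlim (\<lambda>n. c / (2 * sqrt (real n))) (at 0) sequentially"
    unfolding filterlim_at using False by (auto intro: eventually_sequentiallyI[of 1])
  from filterlim_compose[OF lim this]
  have "(\<lambda>n. c\<^sup>2 / 2 * (sin (c / (2 * sqrt n)) / (c / (2 * sqrt n)))\<^sup>2) \<longlonglongrightarrow> c\<^sup>2 / 2 * 1\<^sup>2"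
    by (intro tendsto_intros)
  moreover have "\<forall>\<^sub>F n in sequentially. c\<^sup>2 / 2 * (sin (c / (2 * sqrt n)) / (c / (2 * sqrt n)))\<^sup>2
    = real n * (1 - cos (c / sqrt n))"
  proof (rule eventually_sequentiallyI[of 1])
    fix n :: nat assume "1 \<le> n"
    have "cos (c / sqrt n) = cos (2 * (c / (2 * sqrt n)))" by simp
    also have "\<dots> = 1 - 2 * (sin (c / (2 * sqrt n)))\<^sup>2" by (rule cos_double_sin)
    finally show "c\<^sup>2 / 2 * (sin (c / (2 * sqrt n)) / (c / (2 * sqrt n)))\<^sup>2 = real n * (1 - cos (c / sqrt n))"
      using False \<open>1 \<le> n\<close> by (simp add: power_divide power_mult_distrib)
  qed
  ultimately show ?thesis by (simp add: tendsto_cong)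
qed simp

text \<open>The converse of the central limit theorem, needing only a non-degenerate lower bound on the
  modulus of the characteristic functions.\<close>

lemma square_integrable_if_charmod_bounded:
  fixes g :: "'a \<Rightarrow> real"
  assumes t: "t \<noteq> 0" and ev: "\<forall>\<^sub>F n in sequentially. 1/2 \<le> charmod r g (t / sqrt n) ^ n"
  shows "integrable (measure_pmf r) (\<lambda>y. (g y)\<^sup>2)"
proof -
  obtain y0 where y0: "pmf r y0 > 0"
    using set_pmf_not_empty[of r] by (auto simp: set_pmf_eq pmf_positive_iff)
  define c where "c = 2 / (t\<^sup>2 * pmf r y0)"
  \<comment> \<open>Taking logarithms, \<open>ln u \<le> u - 1\<close> turns the lower bound on the
    \<open>n\<close>-th power into \<open>n * (1 - u) \<le> ln 2\<close>.\<close>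
  have bound: "n * (1 - charmod r g (t / sqrt n)) \<le> 1" if "1/2 \<le> charmod r g (t / sqrt n) ^ n" "n \<ge> 1" for n :: nat
  proof -
    let ?u = "charmod r g (t / sqrt n)"
    have "0 \<le> ?u" by (simp add: charmod_def)
    moreover have "?u \<noteq> 0" using that by (auto simp: power_0_left)
    ultimately have u: "?u > 0" by simp
    have "ln (1/2) \<le> ln (?u ^ n)" using that u by simp
    also have "\<dots> = n * ln ?u" using u by (simp add: ln_realpow)
    also have "\<dots> \<le> n * (?u - 1)" using u by (intro mult_left_mono ln_le_minus_one) auto
    finally have "n * (1 - ?u) \<le> ln 2" by (simp add: ln_div algebra_simps)
    also have "\<dots> \<le> 1" using ln_le_minus_one[of 2] by simp
    finally show ?thesis .
  qed
  \<comment> \<open>A Fatou argument on finite partial sums: the limit in n is taken termwise, and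
    the resulting bound does not depend on \<open>B\<close>.\<close>
  have sums: "(\<Sum>y\<in>B. (g y0 - g y)\<^sup>2 * pmf r y) \<le> c" if B: "finite B" for B
  proof -
    let ?f = "\<lambda>n. pmf r y0 * (\<Sum>y\<in>B. (real n * (1 - cos (t * (g y0 - g y) / sqrt n))) * pmf r y)"
    have "?f \<longlonglongrightarrow> pmf r y0 * (\<Sum>y\<in>B. ((t * (g y0 - g y))\<^sup>2 / 2) * pmf r y)"
      by (intro tendsto_intros one_minus_cos_limit)
    moreover have "\<forall>\<^sub>F n in sequentially. ?f n \<le> 1"
      using ev eventually_ge_at_top[of 1]
    proof eventually_elim
      case (elim n)
      have "?f n = n * (pmf r y0 * (\<Sum>y\<in>B. (1 - cos (t / sqrt n * (g y0 - g y))) * pmf r y))"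
        by (simp add: sum_distrib_left mult_ac)
      also have "\<dots> \<le> n * (1 - charmod r g (t / sqrt n))"
        by (intro mult_left_mono one_minus_charmod_ge B) auto
      also have "\<dots> \<le> 1" using bound elim by simp
      finally show ?case .
    qed
    ultimately have "pmf r y0 * (\<Sum>y\<in>B. ((t * (g y0 - g y))\<^sup>2 / 2) * pmf r y) \<le> 1"
      by (intro tendsto_upperbound[of ?f]) auto
    moreover have "(\<Sum>y\<in>B. ((t * (g y0 - g y))\<^sup>2 / 2) * pmf r y) = t\<^sup>2 / 2 * (\<Sum>y\<in>B. (g y0 - g y)\<^sup>2 * pmf r y)"
      by (simp add: power_mult_distrib sum_distrib_left mult_ac)
    ultimately have h: "pmf r y0 * (t\<^sup>2 / 2 * (\<Sum>y\<in>B. (g y0 - g y)\<^sup>2 * pmf r y)) \<le> 1"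
      by (simp only:)
    have pos: "0 < t\<^sup>2 * pmf r y0" using t y0 by simp
    show ?thesis
      unfolding c_def pos_le_divide_eq[OF pos] using h by (simp add: mult_ac)
  qed
  have "integrable (measure_pmf r) (\<lambda>y. (g y0 - g y)\<^sup>2)"
    by (rule integrable_of_bounded_sums[OF _ sums]) auto
  then have i2: "integrable (measure_pmf r) (\<lambda>y. 2 * (g y0 - g y)\<^sup>2 + 2 * (g y0)\<^sup>2)"
    by simp
  show ?thesis
  proof (rule Bochner_Integration.integrable_bound[OF i2])
    show "AE y in measure_pmf r. norm ((g y)\<^sup>2) \<le> norm (2 * (g y0 - g y)\<^sup>2 + 2 * (g y0)\<^sup>2)"
    proof (intro AE_I2)
      fix y
      \<comment> \<open>This square is exactly the difference of the two sides of the next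
        inequality.\<close>
      have "0 \<le> (g y - 2 * g y0)\<^sup>2" by simp
      then have "(g y)\<^sup>2 \<le> 2 * (g y0 - g y)\<^sup>2 + 2 * (g y0)\<^sup>2"
        by (simp add: power2_eq_square algebra_simps)
      then show "norm ((g y)\<^sup>2) \<le> norm (2 * (g y0 - g y)\<^sup>2 + 2 * (g y0)\<^sup>2)" by simp
    qed
  qed simp
qed

lemma tail_expectation_small:
  fixes \<phi> :: "'a \<Rightarrow> real"
  assumes \<phi>: "integrable (measure_pmf r) \<phi>" and "0 < \<eta>"
  shows "\<exists>A. finite A \<and> (\<forall>A'. finite A' \<longrightarrow> A \<subseteq> A' \<longrightarrow> E r (\<lambda>y. \<phi> y * indicator (- A') y) < \<eta>)"
proof -
  have "((\<lambda>y. \<phi> y * pmf r y) has_sum E r \<phi>) UNIV"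
    using \<phi> pmf_expectation_infsum[OF \<phi>] by (simp add: integrable_pmf_iff_summable has_sum_infsum)
  then have "\<forall>\<^sub>F A in finite_subsets_at_top UNIV. dist (\<Sum>y\<in>A. \<phi> y * pmf r y) (E r \<phi>) < \<eta>"
    unfolding has_sum_def using assms(2) by (rule tendstoD)
  then obtain A where A: "finite A" "\<And>A'. finite A' \<Longrightarrow> A \<subseteq> A' \<Longrightarrow> dist (\<Sum>y\<in>A'. \<phi> y * pmf r y) (E r \<phi>) < \<eta>"
    unfolding eventually_finite_subsets_at_top by auto
  have "E r (\<lambda>y. \<phi> y * indicator (- A') y) < \<eta>" if A': "finite A'" "A \<subseteq> A'" for A'
  proof -
    have i: "integrable (measure_pmf r) (\<lambda>y. \<phi> y * indicator A' y)"
      using \<phi> by (intro integrable_real_mult_indicator) auto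
    have "E r (\<lambda>y. \<phi> y * indicator A' y) = (\<Sum>y\<in>A'. (\<phi> y * indicator A' y) * pmf r y)"
      by (rule integral_measure_pmf_real) (use A' in \<open>auto simp: indicator_def split: if_splits\<close>)
    also have "\<dots> = (\<Sum>y\<in>A'. \<phi> y * pmf r y)" by (intro sum.cong) auto
    finally have e: "E r (\<lambda>y. \<phi> y * indicator A' y) = (\<Sum>y\<in>A'. \<phi> y * pmf r y)" .
    have "E r (\<lambda>y. \<phi> y * indicator (- A') y) = E r (\<lambda>y. \<phi> y - \<phi> y * indicator A' y)"
      by (intro Bochner_Integration.integral_cong) (auto simp: indicator_def)
    also have "\<dots> = E r \<phi> - (\<Sum>y\<in>A'. \<phi> y * pmf r y)"
      using \<phi> i e by simp
    also have "\<dots> < \<eta>" using A(2)[OF A'] by (simp add: dist_real_def abs_less_iff)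
    finally show ?thesis .
  qed
  then show ?thesis using A(1) by blast
qed

section \<open>Necessity of finite approximation\<close>

lemma ell_eval_continuous:
  assumes "g \<in> F"
  shows "continuous_map (mtopology_of (ell F)) euclideanreal (\<lambda>z. z g)"
proof -
  have "Lipschitz_continuous_map (ell F) euclidean_metric (\<lambda>z. z g)"
    unfolding Lipschitz_continuous_map_def
  proof (intro conjI exI[of _ 1] ballI)
    fix z w assume "z \<in> mspace (ell F)" "w \<in> mspace (ell F)"
    from mdist_ell_ge[OF this assms] show "mdist euclidean_metric (z g) (w g) \<le> 1 * mdist (ell F) z w"
      by (simp add: dist_real_def del: mdist_funspace)
  qed simp
  then show ?thesis using Lipschitz_continuous_imp_continuous_map by force
qed

text \<open>Evaluation at \<open>g\<close> is a Lipschitz functional, and at a single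
  \<open>g\<close> the process is measurable, so the outer expectation is an ordinary
  integral.\<close>

lemma Donsker_marginal_limit:
  fixes \<psi> :: "real \<Rightarrow> real"
  assumes conv: "HJ_weakly_converges (sample r) (ell F) (empirical_process r F) L"
    and g: "g \<in> F" "integrable (measure_pmf r) g"
    and \<psi>: "continuous_on UNIV \<psi>" "\<And>x. \<bar>\<psi> x\<bar> \<le> B"
  shows "(\<lambda>n. \<integral>\<omega>. \<psi> (emp r g n \<omega>) \<partial>sample r) \<longlonglongrightarrow> (\<integral>z. \<psi> (z g) \<partial>L)"
proof -
  interpret P: prob_space "sample r" by (rule prob_space_sample)
  have "continuous_map (mtopology_of (ell F)) euclideanreal (\<lambda>z. \<psi> (z g))"
    using continuous_map_compose[OF ell_eval_continuous[OF g(1)], of euclideanreal \<psi>] \<psi>(1)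
    by (simp add: comp_def)
  moreover have "bounded ((\<lambda>z. \<psi> (z g)) ` mspace (ell F))"
    unfolding bounded_iff using \<psi>(2) by (intro exI[of _ B]) auto
  ultimately have "(\<lambda>n. outer_expectation (sample r) (\<lambda>\<omega>. \<psi> (empirical_process r F n \<omega> g))) \<longlonglongrightarrow> (\<integral>z. \<psi> (z g) \<partial>L)"
    using conv unfolding HJ_weakly_converges_def by blast
  moreover have "outer_expectation (sample r) (\<lambda>\<omega>. \<psi> (empirical_process r F n \<omega> g)) = (\<integral>\<omega>. \<psi> (emp r g n \<omega>) \<partial>sample r)" for n
  proof -
    have m: "(\<lambda>\<omega>. \<psi> (emp r g n \<omega>)) \<in> borel_measurable (sample r)"
      by (rule measurable_compose[OF emp_measurable borel_measurable_continuous_onI[OF \<psi>(1)]])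
    have "\<bar>outer_expectation (sample r) (\<lambda>\<omega>. \<psi> (empirical_process r F n \<omega> g)) - (\<integral>\<omega>. \<psi> (emp r g n \<omega>) \<partial>sample r)\<bar>
      \<le> (\<integral>\<omega>. 0 \<partial>sample r)"
      using \<psi>(2) m by (intro P.outer_expectation_near_integral[where B=B] P.integrable_const_bound[of _ B])
        (auto simp: empirical_process_eq g intro: order_trans[OF abs_ge_zero \<psi>(2)])
    then show ?thesis by simp
  qed
  ultimately show ?thesis by simp
qed

text \<open>Under the limit law the coordinate at \<open>g\<close> is a real random variable, so its
  cosine transform is close to 1 near 0. Weak convergence carries this over to finite samples and
  keeps their characteristic functions away from 0.\<close>

lemma Donsker_square_integrable:
  assumes D: "Donsker r F" and g: "g \<in> F"
  shows "integrable (measure_pmf r) (\<lambda>y. (g y)\<^sup>2)"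
proof -
  have int: "integrable (measure_pmf r) g"
    using D g unfolding Donsker_def integrable_pmf_iff_summable by blast
  obtain L where L: "HJ_weakly_converges (sample r) (ell F) (empirical_process r F) L"
    using D unfolding Donsker_def by blast
  then interpret L: prob_space L unfolding HJ_weakly_converges_def by blast
  have Ls: "sets L = sets (metric_borel (ell F))"
    using L unfolding HJ_weakly_converges_def by blast
  have eval: "(\<lambda>z. z g) \<in> borel_measurable L"
    using continuous_map_metric_borel[OF ell_eval_continuous[OF g]] measurable_cong_sets[OF Ls refl] by blast
  have "(\<lambda>k. \<integral>z. cos (z g / real (Suc k)) \<partial>L) \<longlonglongrightarrow> (\<integral>z. 1 \<partial>L)"
  proof (rule integral_dominated_convergence[where w="\<lambda>_. 1"])
    show "AE z in L. (\<lambda>k. cos (z g / real (Suc k))) \<longlonglongrightarrow> 1"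
    proof (intro AE_I2)
      fix z
      have "(\<lambda>k. z g / real (Suc k)) \<longlonglongrightarrow> 0"
        using LIMSEQ_Suc[OF lim_const_over_n[of "z g"]] by simp
      from tendsto_cos[OF this] show "(\<lambda>k. cos (z g / real (Suc k))) \<longlonglongrightarrow> 1" by simp
    qed
    show "(\<lambda>z. cos (z g / real (Suc k))) \<in> borel_measurable L" for k
      using eval by measurable
  qed auto
  then have "\<forall>\<^sub>F k in sequentially. 3/4 < (\<integral>z. cos (z g / real (Suc k)) \<partial>L)"
    by (rule order_tendstoD(1)) (simp add: L.prob_space)
  \<comment> \<open>3/4 is chosen because its square exceeds the 1/2 required by
    \<open>square_integrable_if_charmod_bounded\<close>.\<close>
  then obtain k where k: "3/4 < (\<integral>z. cos (z g / real (Suc k)) \<partial>L)"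
    by (auto simp: eventually_sequentially)
  define t where "t = 1 / real (Suc k)"
  have c: "(\<lambda>n. \<integral>\<omega>. cos (t * emp r g n \<omega>) \<partial>sample r) \<longlonglongrightarrow> (\<integral>z. cos (t * z g) \<partial>L)"
    by (rule Donsker_marginal_limit[OF L g int, where \<psi>="\<lambda>x. cos (t * x)" and B=1]) (auto intro!: continuous_intros)
  have "(3/4)\<^sup>2 < (\<integral>z. cos (t * z g) \<partial>L)\<^sup>2"
    using k by (intro power_strict_mono) (auto simp: t_def)
  then have "1/2 < (\<integral>z. cos (t * z g) \<partial>L)\<^sup>2" by (simp add: power2_eq_square)
  with tendsto_power[OF c, of 2] have "\<forall>\<^sub>F n in sequentially. 1/2 < (\<integral>\<omega>. cos (t * emp r g n \<omega>) \<partial>sample r)\<^sup>2"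
    by (rule order_tendstoD(1))
  then have "\<forall>\<^sub>F n in sequentially. 1/2 \<le> charmod r g (t / sqrt n) ^ n"
  proof eventually_elim
    case (elim n)
    then show ?case
      unfolding charmod_emp[symmetric] using zero_le_power2[of "\<integral>\<omega>. sin (t * emp r g n \<omega>) \<partial>sample r"] by linarith
  qed
  then show ?thesis
    by (rule square_integrable_if_charmod_bounded[rotated]) (simp add: t_def)
qed

text \<open>The tail of \<open>h\<close> has small second moment, and \<open>emp_square\<close>
  transfers this to all \<open>n\<close> simultaneously.\<close>

lemma emp_tail_small:
  fixes h :: "'a \<Rightarrow> real"
  assumes h: "integrable (measure_pmf r) (\<lambda>y. (h y)\<^sup>2)" and "\<delta> > 0"
  shows "\<exists>A. finite A \<and> (\<forall>A'. finite A' \<longrightarrow> A \<subseteq> A' \<longrightarrow> (\<forall>n.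
    integrable (sample r) (\<lambda>\<omega>. \<bar>emp r (\<lambda>y. h y * indicator (- A') y) n \<omega>\<bar>) \<and>
    (\<integral>\<omega>. \<bar>emp r (\<lambda>y. h y * indicator (- A') y) n \<omega>\<bar> \<partial>sample r) \<le> \<delta>))"
proof -
  interpret P: prob_space "sample r" by (rule prob_space_sample)
  obtain A where A: "finite A" "\<And>A'. finite A' \<Longrightarrow> A \<subseteq> A' \<Longrightarrow> E r (\<lambda>y. (h y)\<^sup>2 * indicator (- A') y) < \<delta>\<^sup>2"
    using tail_expectation_small[OF h, of "\<delta>\<^sup>2"] assms(2) by auto
  have "integrable (sample r) (\<lambda>\<omega>. \<bar>emp r (\<lambda>y. h y * indicator (- A') y) n \<omega>\<bar>) \<and>
    (\<integral>\<omega>. \<bar>emp r (\<lambda>y. h y * indicator (- A') y) n \<omega>\<bar> \<partial>sample r) \<le> \<delta>" if A': "finite A'" "A \<subseteq> A'" for A' n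
  proof -
    have sq: "(\<lambda>y. (h y * indicator (- A') y)\<^sup>2) = (\<lambda>y. (h y)\<^sup>2 * indicator (- A') y)"
      by (auto simp: fun_eq_iff indicator_def)
    have i: "integrable (measure_pmf r) (\<lambda>y. (h y * indicator (- A') y)\<^sup>2)"
      unfolding sq by (intro integrable_real_mult_indicator h) simp
    note e = emp_square[OF i, of n]
    note a = P.integral_abs_le_sqrt[OF emp_measurable e(1)]
    have "sqrt (\<integral>\<omega>. (emp r (\<lambda>y. h y * indicator (- A') y) n \<omega>)\<^sup>2 \<partial>sample r) \<le> sqrt (\<delta>\<^sup>2)"
      using e(2) A(2)[OF A'] unfolding sq by (intro real_sqrt_le_mono) linarith
    then show ?thesis using a assms(2) by simp
  qed
  then show ?thesis using A(1) by blast
qed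

text \<open>Truncation to a finite set costs nothing when the approximating map has finite range in
  \<open>L\<^sup>2\<close>.\<close>

lemma approximableI:
  assumes int: "\<And>g. g \<in> F \<Longrightarrow> integrable (measure_pmf r) g"
    and ap: "\<And>\<epsilon>. \<epsilon> > 0 \<Longrightarrow> \<exists>\<pi> N. finite (\<pi> ` F) \<and> (\<forall>h\<in>\<pi> ` F. integrable (measure_pmf r) (\<lambda>y. (h y)\<^sup>2)) \<and>
      (\<forall>n\<ge>N. outer_close r F \<pi> \<epsilon> n)"
  shows "approximable r F"
  unfolding approximable_def
proof (intro allI impI)
  fix \<epsilon> :: real assume e: "\<epsilon> > 0"
  obtain \<pi> N where pi: "finite (\<pi> ` F)" "\<And>h. h \<in> \<pi> ` F \<Longrightarrow> integrable (measure_pmf r) (\<lambda>y. (h y)\<^sup>2)"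
    and N: "\<And>n. n \<ge> N \<Longrightarrow> outer_close r F \<pi> (\<epsilon> / 2) n"
    using ap[of "\<epsilon> / 2"] e by auto
  let ?H = "\<pi> ` F"
  \<comment> \<open>One share of \<open>\<epsilon> / 2\<close> for each of the finitely many
    approximants; the added 1 avoids division by 0 when there are none.\<close>
  define \<delta> where "\<delta> = \<epsilon> / (2 * (card ?H + 1))"
  have d: "\<delta> > 0" using e by (simp add: \<delta>_def)
  let ?P = "\<lambda>h A. finite A \<and> (\<forall>A'. finite A' \<longrightarrow> A \<subseteq> A' \<longrightarrow> (\<forall>n.
    integrable (sample r) (\<lambda>\<omega>. \<bar>emp r (\<lambda>y. h y * indicator (- A') y) n \<omega>\<bar>) \<and>
    (\<integral>\<omega>. \<bar>emp r (\<lambda>y. h y * indicator (- A') y) n \<omega>\<bar> \<partial>sample r) \<le> \<delta>))"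
  have "\<forall>h\<in>?H. \<exists>A. ?P h A"
    using emp_tail_small[OF pi(2) d] by blast
  then have "\<exists>Ah. \<forall>h\<in>?H. ?P h (Ah h)"
    by (rule bchoice)
  then obtain Ah where "\<forall>h\<in>?H. ?P h (Ah h)" ..
  then have Ah: "\<And>h. h \<in> ?H \<Longrightarrow> finite (Ah h)"
    "\<And>h A' n. h \<in> ?H \<Longrightarrow> finite A' \<Longrightarrow> Ah h \<subseteq> A' \<Longrightarrow>
      integrable (sample r) (\<lambda>\<omega>. \<bar>emp r (\<lambda>y. h y * indicator (- A') y) n \<omega>\<bar>)"
    "\<And>h A' n. h \<in> ?H \<Longrightarrow> finite A' \<Longrightarrow> Ah h \<subseteq> A' \<Longrightarrow>
      (\<integral>\<omega>. \<bar>emp r (\<lambda>y. h y * indicator (- A') y) n \<omega>\<bar> \<partial>sample r) \<le> \<delta>"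
    by blast+
  define A where "A = (\<Union>h\<in>?H. Ah h)"
  have A: "finite A" "\<And>h. h \<in> ?H \<Longrightarrow> Ah h \<subseteq> A"
    unfolding A_def by (rule finite_UN_I[OF pi(1) Ah(1)], assumption) blast
  let ?\<pi>' = "\<lambda>g y. \<pi> g y * indicator A y"
  define C where "C = (\<Sum>h\<in>?H. \<Sum>y\<in>A. \<bar>h y\<bar>)"
  have C: "\<bar>?\<pi>' g y\<bar> \<le> C" if "g \<in> F" for g y
  proof (cases "y \<in> A")
    case True
    have "\<bar>\<pi> g y\<bar> \<le> (\<Sum>y\<in>A. \<bar>\<pi> g y\<bar>)" using True A(1) by (intro member_le_sum) auto
    also have "\<dots> \<le> C"
      unfolding C_def using that pi(1) by (intro member_le_sum[where f="\<lambda>h. \<Sum>y\<in>A. \<bar>h y\<bar>"] sum_nonneg) auto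
    finally show ?thesis using True by simp
  next
    case False
    then show ?thesis unfolding C_def by (auto intro!: sum_nonneg)
  qed
  have "outer_close r F ?\<pi>' \<epsilon> n" if n: "n \<ge> N" for n
  proof -
    obtain U where U: "integrable (sample r) U" "integral\<^sup>L (sample r) U \<le> \<epsilon> / 2" "\<And>\<omega>. 0 \<le> U \<omega>"
      "\<And>\<omega> g. g \<in> F \<Longrightarrow> min 1 \<bar>emp r g n \<omega> - emp r (\<pi> g) n \<omega>\<bar> \<le> U \<omega>"
      using N[OF n] by auto
    let ?T = "\<lambda>h \<omega>. \<bar>emp r (\<lambda>y. h y * indicator (- A) y) n \<omega>\<bar>"
    \<comment> \<open>The sum over all approximants dominates the truncation error of whichever one
      belongs to \<open>g\<close>, so a finite sum stands in for the supremum over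
      \<open>F\<close>.\<close>
    let ?U = "\<lambda>\<omega>. U \<omega> + (\<Sum>h\<in>?H. ?T h \<omega>)"
    have iU: "integrable (sample r) ?U"
      using U(1) Ah(2)[OF _ A(1) A(2)] by (intro Bochner_Integration.integrable_add Bochner_Integration.integrable_sum) auto
    have "integral\<^sup>L (sample r) ?U = integral\<^sup>L (sample r) U + (\<Sum>h\<in>?H. integral\<^sup>L (sample r) (?T h))"
      using U(1) Ah(2)[OF _ A(1) A(2)] by (subst Bochner_Integration.integral_add) auto
    also have "\<dots> \<le> \<epsilon> / 2 + (\<Sum>h\<in>?H. \<delta>)"
      using U(2) Ah(3)[OF _ A(1) A(2)] by (intro add_mono sum_mono) auto
    also have "\<dots> \<le> \<epsilon> / 2 + \<epsilon> / 2"
      using e by (simp add: \<delta>_def field_simps)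
    finally have EU: "integral\<^sup>L (sample r) ?U \<le> \<epsilon>" by simp
    have "min 1 \<bar>emp r g n \<omega> - emp r (?\<pi>' g) n \<omega>\<bar> \<le> ?U \<omega>" if g: "g \<in> F" for g \<omega>
    proof -
      have i: "integrable (measure_pmf r) (\<pi> g)" by (rule integrable_of_square[OF pi(2)]) (rule imageI[OF g])
      have "emp r (\<lambda>y. \<pi> g y * indicator (- A) y) n \<omega> = emp r (\<lambda>y. \<pi> g y - ?\<pi>' g y) n \<omega>"
        by (rule arg_cong[where f="\<lambda>h. emp r h n \<omega>"]) (auto simp: fun_eq_iff indicator_def)
      also have "\<dots> = emp r (\<pi> g) n \<omega> - emp r (?\<pi>' g) n \<omega>"
        by (intro emp_diff i integrable_real_mult_indicator) simp
      finally have eq: "emp r (\<lambda>y. \<pi> g y * indicator (- A) y) n \<omega> = emp r (\<pi> g) n \<omega> - emp r (?\<pi>' g) n \<omega>" .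
      have sum: "?T (\<pi> g) \<omega> \<le> (\<Sum>h\<in>?H. ?T h \<omega>)"
        by (rule member_le_sum[OF imageI[OF g] _ pi(1)]) simp
      show ?thesis
      proof (rule min_1_triangle[where c="?T (\<pi> g) \<omega>", OF _ U(4)[OF g]])
        show "\<bar>emp r g n \<omega> - emp r (?\<pi>' g) n \<omega>\<bar> \<le> \<bar>emp r g n \<omega> - emp r (\<pi> g) n \<omega>\<bar> + ?T (\<pi> g) \<omega>"
          unfolding eq by linarith
        show "min 1 (?T (\<pi> g) \<omega>) \<le> (\<Sum>h\<in>?H. ?T h \<omega>)"
          using sum by (rule min.coboundedI2)
      qed simp_all
    qed
    then show ?thesis using iU EU U(3) by (intro exI[of _ ?U]) (auto intro!: add_nonneg_nonneg sum_nonneg)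
  qed
  then show "\<exists>A \<pi> C N. finite A \<and> (\<forall>g\<in>F. \<forall>y. \<bar>\<pi> g y\<bar> \<le> C \<and> (y \<notin> A \<longrightarrow> \<pi> g y = 0)) \<and>
    (\<forall>n\<ge>N. outer_close r F \<pi> \<epsilon> n)"
    using A(1) C by (intro exI[of _ A] exI[of _ ?\<pi>'] exI[of _ C] exI[of _ N]) simp
qed

text \<open>A finite net of a compact set consists of finitely many bounded functions on
  \<open>F\<close>, which split \<open>F\<close> into finitely many cells on which all of them are
  nearly constant. Replacing each \<open>g\<close> by a representative of its cell moves every point
  of the compact set only slightly in \<open>ell F\<close>, and weak convergence carries this to the
  empirical process.\<close>

lemma Donsker_approximable:
  assumes D: "Donsker r F"
  shows "approximable r F"
proof (rule approximableI)
  interpret P: prob_space "sample r" by (rule prob_space_sample)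
  interpret X: Metric_space "mspace (ell F)" "mdist (ell F)" by (rule Metric_space_mspace_mdist)
  have top: "X.mtopology = mtopology_of (ell F)" by (simp only: mtopology_of_def)
  show int: "integrable (measure_pmf r) g" if "g \<in> F" for g
    using D that unfolding Donsker_def integrable_pmf_iff_summable by blast
  obtain L where L: "HJ_weakly_converges (sample r) (ell F) (empirical_process r F) L"
    and tight: "tight_law (ell F) L"
    using D unfolding Donsker_def by blast
  interpret L: prob_space L using L unfolding HJ_weakly_converges_def by blast
  have Ls: "sets L = sets (metric_borel (ell F))" "space L = mspace (ell F)"
    using L unfolding HJ_weakly_converges_def by blast+
  have Z: "empirical_process r F n \<omega> \<in> mspace (ell F)" for n \<omega>
    using L unfolding HJ_weakly_converges_def by auto
  fix \<epsilon> :: real assume e: "\<epsilon> > 0"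
  \<comment> \<open>On \<open>K\<close> the functional \<open>H\<close> below is at most
    \<open>3 * \<delta>\<close>, and the complement of \<open>K\<close> adds
    \<open>\<delta>\<close>; the fifth share makes the inequality strict.\<close>
  define \<delta> where "\<delta> = \<epsilon> / 5"
  have d: "\<delta> > 0" using e by (simp add: \<delta>_def)
  obtain K where K: "compactin (mtopology_of (ell F)) K" "1 - \<delta> \<le> measure L K"
    using tight d unfolding tight_law_def by blast
  have "X.mtotally_bounded K"
    by (rule X.compactin_imp_mtotally_bounded) (simp only: top K)
  then obtain P where P: "finite P" "P \<subseteq> K" "K \<subseteq> (\<Union>c\<in>P. X.mball c \<delta>)"
    unfolding X.mtotally_bounded_def using d by meson
  have KM: "K \<subseteq> mspace (ell F)"
    using compactin_subset_topspace[OF K(1)] by (simp only: topspace_mtopology_of)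
  \<comment> \<open>Members of \<open>F\<close> with equal \<open>\<kappa>\<close> agree up to
    \<open>\<delta>\<close> under every point of the net. As the net points are bounded,
    \<open>\<kappa>\<close> takes finitely many values.\<close>
  define \<kappa> where "\<kappa> g = restrict (\<lambda>c. \<lfloor>c g / \<delta>\<rfloor>) P" for g
  \<comment> \<open>The representative is taken from \<open>F\<close> itself, so that
    \<open>Donsker_square_integrable\<close> applies to it.\<close>
  define \<pi> where "\<pi> g = (SOME h. h \<in> F \<and> \<kappa> h = \<kappa> g)" for g
  have pi: "\<pi> g \<in> F" "\<kappa> (\<pi> g) = \<kappa> g" if "g \<in> F" for g
  proof -
    have "\<pi> g \<in> F \<and> \<kappa> (\<pi> g) = \<kappa> g"
      unfolding \<pi>_def by (rule someI[of _ g]) (simp add: that)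
    then show "\<pi> g \<in> F" "\<kappa> (\<pi> g) = \<kappa> g" by auto
  qed
  have fin\<kappa>: "finite (\<kappa> ` F)"
  proof -
    have "\<forall>c\<in>P. \<exists>B. \<forall>g\<in>F. \<bar>c g\<bar> \<le> B"
      using P(2) KM mspace_ell by blast
    then obtain B where B: "\<And>c g. c \<in> P \<Longrightarrow> g \<in> F \<Longrightarrow> \<bar>c g\<bar> \<le> B c" by metis
    have "\<kappa> ` F \<subseteq> PiE P (\<lambda>c. {\<lfloor>- B c / \<delta>\<rfloor>..\<lfloor>B c / \<delta>\<rfloor>})"
    proof
      fix k assume "k \<in> \<kappa> ` F"
      then obtain g where g: "g \<in> F" "k = \<kappa> g" by auto
      have "\<lfloor>- B c / \<delta>\<rfloor> \<le> \<lfloor>c g / \<delta>\<rfloor> \<and> \<lfloor>c g / \<delta>\<rfloor> \<le> \<lfloor>B c / \<delta>\<rfloor>" if "c \<in> P" for c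
        using B[OF that g(1)] d by (intro conjI floor_mono divide_right_mono) (auto simp: abs_le_iff)
      then show "k \<in> PiE P (\<lambda>c. {\<lfloor>- B c / \<delta>\<rfloor>..\<lfloor>B c / \<delta>\<rfloor>})"
        unfolding g(2) \<kappa>_def by (intro PiE_I) auto
    qed
    moreover have "finite (PiE P (\<lambda>c. {\<lfloor>- B c / \<delta>\<rfloor>..\<lfloor>B c / \<delta>\<rfloor>}))"
      by (rule finite_PiE[OF P(1)]) simp
    ultimately show ?thesis by (rule finite_subset)
  qed
  have fin\<pi>: "finite (\<pi> ` F)"
  proof -
    have "\<pi> ` F = (\<lambda>k. SOME h. h \<in> F \<and> \<kappa> h = k) ` \<kappa> ` F"
      by (simp add: image_image \<pi>_def[abs_def])
    then show ?thesis using fin\<kappa> by simp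
  qed
  have cell: "\<bar>c g - c (\<pi> g)\<bar> \<le> \<delta>" if c: "c \<in> P" and g: "g \<in> F" for c g
  proof -
    have "\<lfloor>c (\<pi> g) / \<delta>\<rfloor> = \<lfloor>c g / \<delta>\<rfloor>"
      using fun_cong[OF pi(2)[OF g], of c] c by (simp add: \<kappa>_def)
    then have "\<bar>c g / \<delta> - c (\<pi> g) / \<delta>\<bar> < 1" by linarith
    then show ?thesis using d by (simp add: diff_divide_distrib[symmetric] abs_divide)
  qed
  define J where "J z = restrict (\<lambda>g. z (\<pi> g)) F" for z :: "('a \<Rightarrow> real) \<Rightarrow> real"
  have JM: "J z \<in> mspace (ell F)" if "z \<in> mspace (ell F)" for z
    using that pi(1) unfolding mspace_ell J_def by fastforce
  have Jlip: "mdist (ell F) (J z) (J w) \<le> 1 * mdist (ell F) z w" if "z \<in> mspace (ell F)" "w \<in> mspace (ell F)" for z w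
  proof -
    have "mdist (ell F) (J z) (J w) \<le> mdist (ell F) z w"
      by (rule mdist_ell_le[OF JM[OF that(1)] JM[OF that(2)] X.nonneg])
        (simp add: J_def mdist_ell_ge[OF that pi(1)] del: mdist_funspace)
    then show ?thesis by simp
  qed
  have Jc: "continuous_map (mtopology_of (ell F)) (mtopology_of (ell F)) J"
    by (rule Lipschitz_continuous_imp_continuous_map)
      (use JM Jlip in \<open>unfold Lipschitz_continuous_map_def, blast\<close>)
  \<comment> \<open>A bounded continuous test functional on \<open>ell F\<close>; weak convergence
    applies to it even where its value along the sample is not measurable.\<close>
  define H where "H z = min 1 (mdist (ell F) z (J z))" for z
  have Hc: "continuous_map (mtopology_of (ell F)) euclideanreal H"
    unfolding H_def[abs_def]
    by (intro continuous_map_real_min continuous_map_mdist Jc continuous_map_const[THEN iffD2]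
        continuous_map_id[unfolded id_def]) simp
  have H01: "0 \<le> H z" "H z \<le> 1" for z
    unfolding H_def using X.nonneg by auto
  have Hm: "H \<in> borel_measurable L"
    using continuous_map_metric_borel[OF Hc] measurable_cong_sets[OF Ls(1) refl] by blast
  have HK: "H z \<le> 3 * \<delta>" if z: "z \<in> K" for z
  proof -
    obtain c where c: "c \<in> P" "mdist (ell F) c z < \<delta>" using P(3) z by (auto simp del: mdist_funspace mspace_funspace)
    have zM: "z \<in> mspace (ell F)" "c \<in> mspace (ell F)" using z c P KM by blast+
    have "mdist (ell F) z (J z) \<le> 3 * \<delta>"
    proof (rule mdist_ell_le[OF zM(1) JM[OF zM(1)]])
      fix g assume g: "g \<in> F"
      have "\<bar>c g - z g\<bar> \<le> \<delta>" "\<bar>c (\<pi> g) - z (\<pi> g)\<bar> \<le> \<delta>"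
        using mdist_ell_ge[OF zM(2,1) g] mdist_ell_ge[OF zM(2,1) pi(1)[OF g]] c(2) by linarith+
      then show "\<bar>z g - J z g\<bar> \<le> 3 * \<delta>"
        using cell[OF c(1) g] g by (simp add: J_def)
    qed (use d in simp)
    then show ?thesis unfolding H_def by simp
  qed
  have Kset: "K \<in> sets L"
    unfolding Ls(1)
    by (rule closedin_metric_borel, rule compactin_imp_closedin[OF _ K(1)])
      (simp only: top[symmetric] X.Hausdorff_space_mtopology)
  have iH: "integrable L H"
    using Hm H01 by (intro L.integrable_const_bound[of _ 1]) auto
  have ii: "integrable L (indicator (space L - K) :: _ \<Rightarrow> real)"
    using Kset by (intro integrable_real_indicator) (auto simp: less_top[symmetric] L.emeasure_finite)
  have "integral\<^sup>L L H \<le> (\<integral>z. 3 * \<delta> + indicator (space L - K) z \<partial>L)"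
  proof (rule integral_mono[OF iH])
    show "integrable L (\<lambda>z. 3 * \<delta> + indicator (space L - K) z)"
      using ii by simp
    show "H z \<le> 3 * \<delta> + indicator (space L - K) z" if "z \<in> space L" for z
      using HK[of z] H01[of z] d that by (cases "z \<in> K") auto
  qed
  also have "\<dots> = 3 * \<delta> + measure L (space L - K)"
    using Kset ii by (simp add: L.prob_space)
  also have "\<dots> \<le> 4 * \<delta>"
    using K(2) L.prob_compl[OF Kset] by simp
  also have "\<dots> < \<epsilon>" using e by (simp add: \<delta>_def)
  finally have HL: "integral\<^sup>L L H < \<epsilon>" .
  have "bounded (H ` mspace (ell F))"
    unfolding bounded_iff using H01 by (intro exI[of _ 1]) auto
  then have "(\<lambda>n. outer_expectation (sample r) (\<lambda>\<omega>. H (empirical_process r F n \<omega>))) \<longlonglongrightarrow> integral\<^sup>L L H"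
    using L Hc unfolding HJ_weakly_converges_def by blast
  then have "\<forall>\<^sub>F n in sequentially. outer_expectation (sample r) (\<lambda>\<omega>. H (empirical_process r F n \<omega>)) < \<epsilon>"
    using HL by (rule order_tendstoD(2))
  then obtain N where N: "\<And>n. n \<ge> N \<Longrightarrow> outer_expectation (sample r) (\<lambda>\<omega>. H (empirical_process r F n \<omega>)) < \<epsilon>"
    by (auto simp: eventually_sequentially)
  have "outer_close r F \<pi> \<epsilon> n" if n: "n \<ge> N" for n
  proof -
    obtain U where U: "integrable (sample r) U" "\<And>\<omega>. H (empirical_process r F n \<omega>) \<le> U \<omega>" "integral\<^sup>L (sample r) U < \<epsilon>"
      using P.outer_expectation_lessE[of "\<lambda>\<omega>. H (empirical_process r F n \<omega>)" 1 \<epsilon>] N[OF n] H01 by auto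
    have "min 1 \<bar>emp r g n \<omega> - emp r (\<pi> g) n \<omega>\<bar> \<le> U \<omega>" if g: "g \<in> F" for g \<omega>
    proof -
      let ?z = "empirical_process r F n \<omega>"
      have "\<bar>?z g - J ?z g\<bar> \<le> mdist (ell F) ?z (J ?z)"
        by (rule mdist_ell_ge[OF Z JM[OF Z] g])
      then have "min 1 \<bar>?z g - J ?z g\<bar> \<le> H ?z" unfolding H_def by (rule min.mono[OF order_refl])
      also have "\<dots> \<le> U \<omega>" by (rule U(2))
      finally show ?thesis
        using g pi(1)[OF g] int by (simp add: J_def empirical_process_eq)
    qed
    moreover have "0 \<le> U \<omega>" for \<omega> using H01(1) U(2) by (rule order_trans)
    ultimately show ?thesis using U(1,3) by (intro exI[of _ U]) auto
  qed
  then show "\<exists>\<pi> N. finite (\<pi> ` F) \<and> (\<forall>h\<in>\<pi> ` F. integrable (measure_pmf r) (\<lambda>y. (h y)\<^sup>2)) \<and>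
      (\<forall>n\<ge>N. outer_close r F \<pi> \<epsilon> n)"
    using fin\<pi> pi(1) Donsker_square_integrable[OF D] by (intro exI[of _ \<pi>] exI[of _ N]) auto
qed

text \<open>Path boundedness is a separate clause, since approximation speaks of large
  \<open>n\<close> and truncated errors, while weak convergence requires values in
  \<open>ell F\<close> at every sample point and every \<open>n\<close>. The injection
  \<open>e\<close> expresses countability of the space.\<close>

theorem Donsker_iff:
  fixes e :: "'a \<Rightarrow> nat" and r :: "'a pmf"
  assumes "inj e"
  shows "Donsker r F \<longleftrightarrow> (\<forall>g\<in>F. integrable (measure_pmf r) g) \<and>
    (\<forall>n \<omega>. \<exists>B. \<forall>g\<in>F. \<bar>emp r g n \<omega>\<bar> \<le> B) \<and> approximable r F"
proof
  assume D: "Donsker r F"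
  then have int: "\<forall>g\<in>F. integrable (measure_pmf r) g"
    unfolding Donsker_def integrable_pmf_iff_summable by blast
  have "empirical_process r F n \<omega> \<in> mspace (ell F)" for n \<omega>
    using D unfolding Donsker_def HJ_weakly_converges_def by auto
  then have "\<forall>n \<omega>. \<exists>B. \<forall>g\<in>F. \<bar>emp r g n \<omega>\<bar> \<le> B"
    using int empirical_process_in_ell by blast
  then show "(\<forall>g\<in>F. integrable (measure_pmf r) g) \<and>
    (\<forall>n \<omega>. \<exists>B. \<forall>g\<in>F. \<bar>emp r g n \<omega>\<bar> \<le> B) \<and> approximable r F"
    using int Donsker_approximable[OF D] by blast
next
  assume "(\<forall>g\<in>F. integrable (measure_pmf r) g) \<and>
    (\<forall>n \<omega>. \<exists>B. \<forall>g\<in>F. \<bar>emp r g n \<omega>\<bar> \<le> B) \<and> approximable r F"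
  then show "Donsker r F" using Donsker_if_approximable[OF assms] by blast
qed

lemma approximable_subset: "approximable r F \<Longrightarrow> F' \<subseteq> F \<Longrightarrow> approximable r F'"
  unfolding approximable_def subset_iff by (elim all_forward imp_forward ex_forward conj_forward) blast+

section \<open>The fluctuation inequality\<close>

text \<open>The fourth power of 13/12 is below 3/2, and \<open>13 ^ 4 = 28561\<close>. In the
  halving argument the first factor has to be below 2, as each of the two halves contributes a
  quarter of the squared mass.\<close>

lemma fourth_power_add_le:
  fixes a b :: real
  assumes "0 \<le> a" "0 \<le> b"
  shows "(a + b) ^ 4 \<le> 3/2 * a ^ 4 + 28561 * b ^ 4"
proof (cases "12 * b \<le> a")
  case True
  have "(a + b) ^ 4 \<le> (13/12 * a) ^ 4" using assms True by (intro power_mono) auto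
  also have "\<dots> = 28561 / 20736 * a ^ 4" by (simp add: power_mult_distrib power_divide)
  also have "\<dots> \<le> 3/2 * a ^ 4" by (intro mult_right_mono) auto
  finally show ?thesis using assms by (simp add: add_increasing2)
next
  case False
  have "(a + b) ^ 4 \<le> (13 * b) ^ 4" using assms False by (intro power_mono) auto
  also have "\<dots> = 28561 * b ^ 4" by (simp add: power_mult_distrib)
  finally show ?thesis using assms by (simp add: add_increasing)
qed

lemma min_fourth_power_le:
  fixes a b :: real
  shows "(min \<bar>a\<bar> \<bar>b\<bar>) ^ 4 \<le> a\<^sup>2 * b\<^sup>2"
proof -
  have "(min \<bar>a\<bar> \<bar>b\<bar>) ^ 4 = (min \<bar>a\<bar> \<bar>b\<bar>)\<^sup>2 * (min \<bar>a\<bar> \<bar>b\<bar>)\<^sup>2"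
    by (simp add: power_add[symmetric])
  also have "\<dots> \<le> \<bar>a\<bar>\<^sup>2 * \<bar>b\<bar>\<^sup>2"
    by (intro mult_mono power_mono) auto
  finally show ?thesis by simp
qed

text \<open>For consecutive blocks \<open>a\<close>, \<open>q\<close>, \<open>y\<close>: the
  fluctuation at the cut after \<open>a\<close> is controlled by the fluctuation inside
  \<open>a + q\<close> and by that at the cut before \<open>y\<close>.\<close>

lemma min_abs_split:
  fixes a q y :: real
  shows "min \<bar>a\<bar> \<bar>q + y\<bar> \<le> min \<bar>a\<bar> \<bar>q\<bar> + min \<bar>a + q\<bar> \<bar>y\<bar>"
proof (cases "\<bar>a\<bar> \<le> \<bar>q\<bar>")
  case True
  then have "min \<bar>a\<bar> \<bar>q\<bar> = \<bar>a\<bar>" by simp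
  moreover have "0 \<le> min \<bar>a + q\<bar> \<bar>y\<bar>" by simp
  moreover have "min \<bar>a\<bar> \<bar>q + y\<bar> \<le> \<bar>a\<bar>" by simp
  ultimately show ?thesis by linarith
next
  case False
  then have q: "min \<bar>a\<bar> \<bar>q\<bar> = \<bar>q\<bar>" by simp
  show ?thesis
  proof (cases "\<bar>a + q\<bar> \<le> \<bar>y\<bar>")
    case True
    have "min \<bar>a\<bar> \<bar>q + y\<bar> \<le> \<bar>a\<bar>" by simp
    then show ?thesis unfolding q using True by simp
  next
    case False
    have "min \<bar>a\<bar> \<bar>q + y\<bar> \<le> \<bar>q + y\<bar>" by simp
    then show ?thesis unfolding q using False by simp
  qed
qed

lemma min_power4_step:
  fixes a b x y :: real
  assumes min: "min \<bar>a\<bar> \<bar>b\<bar> \<le> min \<bar>p\<bar> \<bar>q\<bar> + min \<bar>x\<bar> \<bar>y\<bar>" and u: "(min \<bar>p\<bar> \<bar>q\<bar>) ^ 4 \<le> u"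
  shows "(min \<bar>a\<bar> \<bar>b\<bar>) ^ 4 \<le> 3/2 * u + 28561 * (x\<^sup>2 * y\<^sup>2)"
proof -
  have "(min \<bar>a\<bar> \<bar>b\<bar>) ^ 4 \<le> (min \<bar>p\<bar> \<bar>q\<bar> + min \<bar>x\<bar> \<bar>y\<bar>) ^ 4"
    by (rule power_mono[OF min]) simp
  also have "\<dots> \<le> 3/2 * (min \<bar>p\<bar> \<bar>q\<bar>) ^ 4 + 28561 * (min \<bar>x\<bar> \<bar>y\<bar>) ^ 4"
    by (rule fourth_power_add_le) simp_all
  also have "\<dots> \<le> 3/2 * u + 28561 * (x\<^sup>2 * y\<^sup>2)"
    by (intro add_mono mult_left_mono u min_fourth_power_le) simp_all
  finally show ?thesis .
qed

text \<open>Billingsley's fluctuation inequality, by halving the total mass of the weights \<open>u\<close>.  The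
  induction closes for every constant \<open>C\<close> with \<open>3/4 * C + 13^4/2 \<le> C\<close>; here \<open>C = 8 * 13^4\<close>.\<close>

lemma fluctuation_inequality:
  fixes D :: "nat \<Rightarrow> 'w \<Rightarrow> real" and u :: "nat \<Rightarrow> real"
  defines "S i j \<equiv> \<lambda>\<omega>. \<Sum>l=i..<j. D l \<omega>"
  assumes u0: "\<And>l. 0 \<le> u l" and c0: "0 \<le> c"
    and int: "\<And>i j k. i \<le> j \<Longrightarrow> j \<le> k \<Longrightarrow> integrable M (\<lambda>\<omega>. (S i j \<omega>)\<^sup>2 * (S j k \<omega>)\<^sup>2)"
    and mom: "\<And>i j k. i \<le> j \<Longrightarrow> j \<le> k \<Longrightarrow>
      (\<integral>\<omega>. (S i j \<omega>)\<^sup>2 * (S j k \<omega>)\<^sup>2 \<partial>M) \<le> c * ((\<Sum>l=i..<j. u l) * (\<Sum>l=j..<k. u l))"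
  shows "i \<le> k \<Longrightarrow> \<exists>U. integrable M U \<and> integral\<^sup>L M U \<le> 228488 * c * (\<Sum>l=i..<k. u l)\<^sup>2 \<and>
    (\<forall>\<omega>. \<forall>j\<in>{i..k}. (min \<bar>S i j \<omega>\<bar> \<bar>S j k \<omega>\<bar>) ^ 4 \<le> U \<omega>)"
proof (induction "k - i" arbitrary: i k rule: less_induct)
  case less
  have S0: "S i i \<omega> = 0" for i \<omega> by (simp add: S_def)
  have Sadd: "S i j \<omega> + S j k \<omega> = S i k \<omega>" if "i \<le> j" "j \<le> k" for i j k \<omega>
    unfolding S_def using that by (rule sum.atLeastLessThan_concat)
  have uadd: "sum u {i..<j} + sum u {j..<k} = sum u {i..<k}" if "i \<le> j" "j \<le> k" for i j k
    using that by (rule sum.atLeastLessThan_concat)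
  have unn: "0 \<le> sum u {i..<j}" for i j using u0 by (intro sum_nonneg) auto
  show ?case
  proof (cases "i = k")
    case True
    then show ?thesis by (intro exI[of _ "\<lambda>_. 0"]) (auto simp: S0)
  next
    case False
    then have ik: "i < k" using less.prems by simp
    let ?m = "sum u {i..<k}"
    let ?Q = "\<lambda>h. i \<le> h \<and> h < k \<and> sum u {i..<h} \<le> ?m / 2"
    have "?Q i" using ik unn[of i k] by simp
    \<comment> \<open>Cutting out step \<open>h\<close> leaves at most half of the mass on either
      side. The weight of \<open>h\<close> itself may be large; it enters only through the product
      moments \<open>?V1\<close> and \<open>?V2\<close> of the two cuts next to it.\<close>
    define h where "h = (GREATEST h. ?Q h)"
    have "?Q h" unfolding h_def
      by (rule GreatestI_nat[where P="?Q" and k=i and b=k]) (use \<open>?Q i\<close> in auto)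
    then have h: "i \<le> h" "h < k" "sum u {i..<h} \<le> ?m / 2" by auto
    have hmax: "h' \<le> h" if "?Q h'" for h'
      unfolding h_def by (rule Greatest_le_nat[where P="?Q" and b=k]) (use that in auto)
    have h2: "sum u {Suc h..<k} \<le> ?m / 2"
    proof (cases "Suc h < k")
      case True
      then have "\<not> sum u {i..<Suc h} \<le> ?m / 2" using hmax[of "Suc h"] h by auto
      then show ?thesis using uadd[of i "Suc h" k] True h by simp
    next
      case False
      then show ?thesis using unn by simp
    qed
    obtain U1 where U1: "integrable M U1" "integral\<^sup>L M U1 \<le> 228488 * c * (sum u {i..<h})\<^sup>2"
      "\<And>\<omega> j. j \<in> {i..h} \<Longrightarrow> (min \<bar>S i j \<omega>\<bar> \<bar>S j h \<omega>\<bar>) ^ 4 \<le> U1 \<omega>"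
    proof -
      have "h - i < k - i" using h by simp
      from less.hyps[OF this h(1)] show ?thesis using that by blast
    qed
    obtain U2 where U2: "integrable M U2" "integral\<^sup>L M U2 \<le> 228488 * c * (sum u {Suc h..<k})\<^sup>2"
      "\<And>\<omega> j. j \<in> {Suc h..k} \<Longrightarrow> (min \<bar>S (Suc h) j \<omega>\<bar> \<bar>S j k \<omega>\<bar>) ^ 4 \<le> U2 \<omega>"
    proof -
      have "k - Suc h < k - i" "Suc h \<le> k" using h by simp_all
      from less.hyps[OF this] show ?thesis using that by blast
    qed
    let ?V1 = "\<lambda>\<omega>. (S i h \<omega>)\<^sup>2 * (S h k \<omega>)\<^sup>2" and ?V2 = "\<lambda>\<omega>. (S i (Suc h) \<omega>)\<^sup>2 * (S (Suc h) k \<omega>)\<^sup>2"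
    let ?U = "\<lambda>\<omega>. (3/2 * U1 \<omega> + 28561 * ?V1 \<omega>) + (3/2 * U2 \<omega> + 28561 * ?V2 \<omega>)"
    have V: "integrable M ?V1" "integrable M ?V2" using int h by auto
    have prod: "a * b \<le> ?m\<^sup>2 / 4" if "a + b = ?m" "0 \<le> a" "0 \<le> b" for a b
      using zero_le_power2[of "a - b"] that(1)[symmetric] by (simp add: power2_eq_square algebra_simps)
    have EV1: "integral\<^sup>L M ?V1 \<le> c * (?m\<^sup>2 / 4)"
      using h by (intro order_trans[OF mom] mult_left_mono prod uadd unn c0) auto
    have EV2: "integral\<^sup>L M ?V2 \<le> c * (?m\<^sup>2 / 4)"
      using h by (intro order_trans[OF mom] mult_left_mono prod uadd unn c0) auto
    have EU1: "integral\<^sup>L M U1 \<le> 228488 * c * (?m\<^sup>2 / 4)"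
    proof (rule order_trans[OF U1(2)])
      have "(sum u {i..<h})\<^sup>2 \<le> (?m / 2)\<^sup>2" using h(3) unn by (intro power_mono) auto
      then show "228488 * c * (sum u {i..<h})\<^sup>2 \<le> 228488 * c * (?m\<^sup>2 / 4)"
        using c0 by (intro mult_left_mono) (auto simp: power_divide)
    qed
    have EU2: "integral\<^sup>L M U2 \<le> 228488 * c * (?m\<^sup>2 / 4)"
    proof (rule order_trans[OF U2(2)])
      have "(sum u {Suc h..<k})\<^sup>2 \<le> (?m / 2)\<^sup>2" using h2 unn by (intro power_mono) auto
      then show "228488 * c * (sum u {Suc h..<k})\<^sup>2 \<le> 228488 * c * (?m\<^sup>2 / 4)"
        using c0 by (intro mult_left_mono) (auto simp: power_divide)
    qed
    have "integral\<^sup>L M ?U = (3/2 * integral\<^sup>L M U1 + 28561 * integral\<^sup>L M ?V1)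
      + (3/2 * integral\<^sup>L M U2 + 28561 * integral\<^sup>L M ?V2)"
      using U1(1) U2(1) V by simp
    also have "\<dots> \<le> 228488 * c * ?m\<^sup>2"
    proof -
      have "0 \<le> c * ?m\<^sup>2" using c0 by simp
      then show ?thesis
        using EU1 EU2 EV1 EV2 by linarith
    qed
    finally have EU: "integral\<^sup>L M ?U \<le> 228488 * c * ?m\<^sup>2" .
    have nn: "0 \<le> U1 \<omega>" "0 \<le> U2 \<omega>" for \<omega>
    proof -
      have "0 \<le> (min \<bar>x\<bar> \<bar>y\<bar>) ^ 4" for x y :: real by simp
      then show "0 \<le> U1 \<omega>" "0 \<le> U2 \<omega>"
        using U1(3)[of i \<omega>] U2(3)[of k \<omega>] h by (meson atLeastAtMost_iff Suc_leI order_refl order_trans)+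
    qed
    have bound: "(min \<bar>S i j \<omega>\<bar> \<bar>S j k \<omega>\<bar>) ^ 4 \<le> ?U \<omega>" if j: "j \<in> {i..k}" for j \<omega>
    proof (cases "j \<le> h")
      case True
      have "min \<bar>S i j \<omega>\<bar> \<bar>S j k \<omega>\<bar> \<le> min \<bar>S i j \<omega>\<bar> \<bar>S j h \<omega>\<bar> + min \<bar>S i h \<omega>\<bar> \<bar>S h k \<omega>\<bar>"
      proof -
        have "S j h \<omega> + S h k \<omega> = S j k \<omega>" "S i j \<omega> + S j h \<omega> = S i h \<omega>"
          using True j h by (auto intro!: Sadd)
        with min_abs_split[of "S i j \<omega>" "S j h \<omega>" "S h k \<omega>"] show ?thesis by (simp only:)
      qed
      then have "(min \<bar>S i j \<omega>\<bar> \<bar>S j k \<omega>\<bar>) ^ 4 \<le> 3/2 * U1 \<omega> + 28561 * ?V1 \<omega>"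
        by (rule min_power4_step) (rule U1(3), use True j in simp)
      also have "\<dots> \<le> ?U \<omega>" by (simp add: nn)
      finally show ?thesis .
    next
      case False
      \<comment> \<open>Mirror image of the first case: the blocks are read from right to
        left.\<close>
      have "min \<bar>S i j \<omega>\<bar> \<bar>S j k \<omega>\<bar> \<le> min \<bar>S (Suc h) j \<omega>\<bar> \<bar>S j k \<omega>\<bar> + min \<bar>S i (Suc h) \<omega>\<bar> \<bar>S (Suc h) k \<omega>\<bar>"
      proof -
        have "S (Suc h) j \<omega> + S i (Suc h) \<omega> = S i j \<omega>" "S j k \<omega> + S (Suc h) j \<omega> = S (Suc h) k \<omega>"
          using False j h Sadd[of i "Suc h" j \<omega>] Sadd[of "Suc h" j k \<omega>] by auto
        with min_abs_split[of "S j k \<omega>" "S (Suc h) j \<omega>" "S i (Suc h) \<omega>"] show ?thesis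
          by (simp only: min.commute)
      qed
      then have "(min \<bar>S i j \<omega>\<bar> \<bar>S j k \<omega>\<bar>) ^ 4 \<le> 3/2 * U2 \<omega> + 28561 * ?V2 \<omega>"
        by (rule min_power4_step) (rule U2(3), use False j in simp)
      also have "\<dots> \<le> ?U \<omega>" by (simp add: nn)
      finally show ?thesis .
    qed
    have "integrable M ?U" using U1(1) U2(1) V by simp
    then show ?thesis using EU bound by (intro exI[of _ ?U]) blast
  qed
qed

section \<open>Envelope classes and unions\<close>

text \<open>With \<open>n\<close> fixed, a finite \<open>B\<close> can be so large that observations
  rarely leave it and that the centring \<open>sqrt n * E r g\<close> is negligible, for all
  dominated \<open>g\<close> at once. As \<open>B\<close> depends on \<open>n\<close>, it reduces an
  infinite problem to a finite one at each \<open>n\<close> and cannot serve as the approximating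
  set.\<close>

lemma tail_cut:
  fixes f :: "'a \<Rightarrow> real"
  assumes f: "integrable (measure_pmf r) f" and A: "finite A" and d: "\<delta> > 0"
  shows "\<exists>B U. finite B \<and> A \<subseteq> B \<and> integrable (sample r) U \<and> integral\<^sup>L (sample r) U \<le> \<delta> \<and>
    (\<forall>\<omega>. 0 \<le> U \<omega> \<and> (\<forall>g. (\<forall>y. \<bar>g y\<bar> \<le> f y * indicator (- B) y) \<longrightarrow> min 1 \<bar>emp r g n \<omega>\<bar> \<le> U \<omega>))"
proof (cases "n = 0")
  case True
  then show ?thesis
    using A d by (intro exI[of _ A] exI[of _ "\<lambda>_. 0"]) auto
next
  case False
  interpret P: prob_space "sample r" by (rule prob_space_sample)
  have n: "real n > 0" using False by simp
  obtain A1 where A1: "finite A1" "\<And>A'. finite A' \<Longrightarrow> A1 \<subseteq> A' \<Longrightarrow>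
      E r (\<lambda>y. f y * indicator (- A') y) < \<delta> / (2 * sqrt n)"
    using tail_expectation_small[OF f, of "\<delta> / (2 * sqrt n)"] d n by auto
  obtain A2 where A2: "finite A2" "\<And>A'. finite A' \<Longrightarrow> A2 \<subseteq> A' \<Longrightarrow>
      E r (\<lambda>y. 1 * indicator (- A') y) < \<delta> / (2 * n)"
    using tail_expectation_small[of r "\<lambda>_. 1" "\<delta> / (2 * n)"] d n by auto
  define B where "B = A \<union> A1 \<union> A2"
  have B: "finite B" "A \<subseteq> B" using A A1 A2 by (auto simp: B_def)
  have Bf: "E r (\<lambda>y. f y * indicator (- B) y) < \<delta> / (2 * sqrt n)"
    and B1: "E r (indicator (- B)) < \<delta> / (2 * n)"
    using A1(2)[OF B(1)] A2(2)[OF B(1)] by (auto simp: B_def)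
  \<comment> \<open>If some observation lies outside \<open>B\<close>, the count is at least 1 and
    dominates the truncated value; otherwise only the centring is left, bounded by
    \<open>\<delta> / 2\<close>.\<close>
  define U where "U \<omega> = \<delta> / 2 + (\<Sum>i<n. indicator (- B) (\<omega> i))" for \<omega> :: "nat \<Rightarrow> 'a"
  have iB: "integrable (sample r) (\<lambda>\<omega>. indicator (- B) (\<omega> i) :: real)" for i
    by (subst sample_coord_integral) (auto intro!: measure_pmf.integrable_bnd bndI[of _ 1] simp: indicator_def)
  have "integral\<^sup>L (sample r) U = \<delta> / 2 + n * E r (indicator (- B))"
    unfolding U_def using iB P.prob_space
    by (simp add: sample_coord_integral(1)[where \<psi>="indicator (- B)"])
  also have "\<dots> \<le> \<delta> / 2 + n * (\<delta> / (2 * n))"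
    using B1 by (intro add_left_mono mult_left_mono) auto
  also have "\<dots> = \<delta>" using n by simp
  finally have EU: "integral\<^sup>L (sample r) U \<le> \<delta>" .
  have U0: "0 \<le> U \<omega>" for \<omega> unfolding U_def using d by (intro add_nonneg_nonneg sum_nonneg) auto
  have main: "min 1 \<bar>emp r g n \<omega>\<bar> \<le> U \<omega>" if g: "\<And>y. \<bar>g y\<bar> \<le> f y * indicator (- B) y" for g \<omega>
  proof (cases "\<forall>i<n. \<omega> i \<in> B")
    case True
    have "g (\<omega> i) = 0" if "i < n" for i using g[of "\<omega> i"] True that by simp
    then have "emp r g n \<omega> = - (n * E r g / sqrt n)" by (simp add: emp_def)
    also have "n * E r g / sqrt n = sqrt n * E r g"       using real_div_sqrt[of "real n"] by (simp flip: times_divide_eq_left)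
    finally have "\<bar>emp r g n \<omega>\<bar> = sqrt n * \<bar>E r g\<bar>" by (simp add: abs_mult)
    also have "\<dots> \<le> sqrt n * (\<delta> / (2 * sqrt n))"
    proof (rule mult_left_mono)
      have i: "integrable (measure_pmf r) (\<lambda>y. f y * indicator (- B) y)"
        by (intro integrable_real_mult_indicator f) simp
      have "\<bar>E r g\<bar> \<le> E r (\<lambda>y. \<bar>g y\<bar>)" by (rule integral_abs_bound)
      also have "\<dots> \<le> E r (\<lambda>y. f y * indicator (- B) y)"
        using g i by (intro integral_mono) (auto intro!: Bochner_Integration.integrable_bound[OF i] AE_I2 order_trans[OF _ abs_ge_self])
      finally show "\<bar>E r g\<bar> \<le> \<delta> / (2 * sqrt n)" using Bf by simp
    qed simp
    also have "\<dots> = \<delta> / 2" using n by simp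
    also have "\<dots> \<le> U \<omega>" unfolding U_def by (simp add: sum_nonneg)
    finally show ?thesis by simp
  next
    case False
    then obtain i where i: "i < n" "\<omega> i \<notin> B" by auto
    then have "1 \<le> (\<Sum>i<n. indicator (- B) (\<omega> i) :: real)"
      using member_le_sum[of i "{..<n}" "\<lambda>i. indicator (- B) (\<omega> i) :: real"] by simp
    then show ?thesis using d by (simp add: U_def)
  qed
  have "integrable (sample r) U" unfolding U_def[abs_def] using iB by simp
  then show ?thesis
    using B EU U0 main by (intro exI[of _ B] exI[of _ U]) auto
qed

text \<open>For one fixed sample an integrable envelope bounds the whole path, which settles the
  boundedness clause of \<open>Donsker_iff\<close>.\<close>

lemma emp_envelope_bounded:
  fixes f :: "'a \<Rightarrow> real"
  assumes f: "integrable (measure_pmf r) f" and F: "\<And>g y. g \<in> F \<Longrightarrow> \<bar>g y\<bar> \<le> f y"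
  shows "\<exists>B. \<forall>g\<in>F. \<bar>emp r g n \<omega>\<bar> \<le> B"
proof (intro exI ballI)
  fix g assume g: "g \<in> F"
  have "\<bar>E r g\<bar> \<le> E r (\<lambda>y. \<bar>g y\<bar>)" by (rule integral_abs_bound)
  also have "\<dots> \<le> E r f"
    using F[OF g] by (intro integral_mono f) (auto intro!: Bochner_Integration.integrable_bound[OF f] AE_I2 order_trans[OF _ abs_ge_self])
  finally have Eg: "\<bar>E r g\<bar> \<le> E r f" .
  have "\<bar>\<Sum>i<n. g (\<omega> i) - E r g\<bar> \<le> (\<Sum>i<n. \<bar>g (\<omega> i) - E r g\<bar>)" by (rule sum_abs)
  also have "\<dots> \<le> (\<Sum>i<n. f (\<omega> i) + E r f)"
  proof (rule sum_mono)
    fix i show "\<bar>g (\<omega> i) - E r g\<bar> \<le> f (\<omega> i) + E r f" using F[OF g, of "\<omega> i"] Eg by linarith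
  qed
  finally show "\<bar>emp r g n \<omega>\<bar> \<le> (\<Sum>i<n. f (\<omega> i) + E r f) / sqrt n"
    by (simp add: emp_def abs_divide divide_right_mono)
qed

lemma integrable_envelope:
  fixes f :: "'a \<Rightarrow> real"
  assumes f: "integrable (measure_pmf r) f" and g: "\<And>y. \<bar>g y\<bar> \<le> f y"
  shows "integrable (measure_pmf r) g"
  using g by (intro Bochner_Integration.integrable_bound[OF f] AE_I2) (auto intro: order_trans[OF _ abs_ge_self])

text \<open>The origin of the weights \<open>sqrt (pmf r y)\<close>: the second moment of a single
  normalised cell count is at most the mass of the cell.\<close>

lemma emp_point_abs:
  "integrable (sample r) (\<lambda>\<omega>. \<bar>emp r (indicator {y}) n \<omega>\<bar>)"
  "(\<integral>\<omega>. \<bar>emp r (indicator {y}) n \<omega>\<bar> \<partial>sample r) \<le> sqrt (pmf r y)"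
proof -
  interpret P: prob_space "sample r" by (rule prob_space_sample)
  have sq: "(\<lambda>z. (indicator {y} z :: real)\<^sup>2) = indicator {y}" by (auto simp: indicator_def)
  have i: "integrable (measure_pmf r) (\<lambda>z. (indicator {y} z :: real)\<^sup>2)"
    unfolding sq by (rule integrable_finite_support[of "{y}"]) auto
  have "E r (\<lambda>z. (indicator {y} z)\<^sup>2) = pmf r y"
    unfolding sq by (simp add: measure_pmf_single)
  then have le: "(\<integral>\<omega>. (emp r (indicator {y}) n \<omega>)\<^sup>2 \<partial>sample r) \<le> pmf r y"
    using emp_square(2)[OF i, of n] by simp
  note a = P.integral_abs_le_sqrt[OF emp_measurable emp_square(1)[OF i]]
  show "integrable (sample r) (\<lambda>\<omega>. \<bar>emp r (indicator {y}) n \<omega>\<bar>)" by (rule a(1))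
  show "(\<integral>\<omega>. \<bar>emp r (indicator {y}) n \<omega>\<bar> \<partial>sample r) \<le> sqrt (pmf r y)"
    by (rule order_trans[OF a(2)]) (rule real_sqrt_le_mono[OF le])
qed

text \<open>Beyond \<open>A\<close> the error is split at a set \<open>B\<close> depending on
  \<open>n\<close>. On \<open>B - A\<close> the triangle inequality over the points costs at most a
  tail of the weight series, uniformly in \<open>n\<close>; outside \<open>B\<close> the estimate is
  \<open>tail_cut\<close>.\<close>

lemma envelope_class_approximable:
  fixes f :: "'a \<Rightarrow> real"
  assumes f0: "\<And>y. 0 \<le> f y" and s: "(\<lambda>y. f y * sqrt (pmf r y)) summable_on UNIV"
    and f: "integrable (measure_pmf r) f"
  shows "approximable r (envelope_class f)"
  unfolding approximable_def
proof (intro allI impI)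
  fix \<epsilon> :: real assume e: "\<epsilon> > 0"
  let ?s = "\<lambda>y. f y * sqrt (pmf r y)"
  have s0: "0 \<le> ?s y" for y using f0 by simp
  have "(?s has_sum infsum ?s UNIV) UNIV" using s by (rule has_sum_infsum)
  then have "\<forall>\<^sub>F A in finite_subsets_at_top UNIV. dist (sum ?s A) (infsum ?s UNIV) < \<epsilon> / 2"
    unfolding has_sum_def by (rule tendstoD) (use e in simp)
  then obtain A where A: "finite A" "dist (sum ?s A) (infsum ?s UNIV) < \<epsilon> / 2"
    unfolding eventually_finite_subsets_at_top by auto
  have tail: "sum ?s (B - A) \<le> \<epsilon> / 2" if "finite B" "A \<subseteq> B" for B
  proof -
    have "sum ?s B \<le> infsum ?s UNIV"
      by (rule finite_sum_le_infsum[OF s]) (use that s0 in auto)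
    moreover have "sum ?s (B - A) = sum ?s B - sum ?s A" using that by (intro sum_diff) auto
    ultimately show ?thesis using A(2) unfolding dist_real_def by linarith
  qed
  let ?\<pi> = "\<lambda>g y. g y * indicator A y :: real"
  have C: "\<bar>?\<pi> g y\<bar> \<le> sum f A" if "g \<in> envelope_class f" for g y
  proof (cases "y \<in> A")
    case True
    have "\<bar>g y\<bar> \<le> f y" using that by (simp add: envelope_class_def)
    also have "\<dots> \<le> sum f A" using True A(1) f0 by (intro member_le_sum) auto
    finally show ?thesis using True by simp
  qed (use f0 in \<open>auto intro: sum_nonneg\<close>)
  have "outer_close r (envelope_class f) ?\<pi> \<epsilon> n" for n
  proof -
    obtain B U where B: "finite B" "A \<subseteq> B" and U: "integrable (sample r) U" "integral\<^sup>L (sample r) U \<le> \<epsilon> / 2"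
      "\<And>\<omega>. 0 \<le> U \<omega>" "\<And>\<omega> g. (\<And>y. \<bar>g y\<bar> \<le> f y * indicator (- B) y) \<Longrightarrow> min 1 \<bar>emp r g n \<omega>\<bar> \<le> U \<omega>"
      using tail_cut[OF f A(1), of "\<epsilon>/2" n] e by auto
    let ?V = "\<lambda>\<omega>. \<Sum>y\<in>B - A. f y * \<bar>emp r (indicator {y}) n \<omega>\<bar>"
    have iV: "integrable (sample r) ?V"
      by (intro Bochner_Integration.integrable_sum integrable_mult_right emp_point_abs(1))
    have "integral\<^sup>L (sample r) ?V = (\<Sum>y\<in>B - A. f y * (\<integral>\<omega>. \<bar>emp r (indicator {y}) n \<omega>\<bar> \<partial>sample r))"
      by (subst Bochner_Integration.integral_sum) (simp_all add: emp_point_abs(1))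
    also have "\<dots> \<le> sum ?s (B - A)"
      by (intro sum_mono mult_left_mono emp_point_abs f0)
    also have "\<dots> \<le> \<epsilon> / 2" by (rule tail[OF B])
    finally have EV: "integral\<^sup>L (sample r) ?V \<le> \<epsilon> / 2" .
    have V0: "0 \<le> ?V \<omega>" for \<omega> using f0 by (intro sum_nonneg) auto
    have "min 1 \<bar>emp r g n \<omega> - emp r (?\<pi> g) n \<omega>\<bar> \<le> ?V \<omega> + U \<omega>" if g: "g \<in> envelope_class f" for g \<omega>
    proof -
      have gf: "\<bar>g y\<bar> \<le> f y" for y using g by (simp add: envelope_class_def)
      let ?g1 = "\<lambda>y. g y * indicator (B - A) y" and ?g2 = "\<lambda>y. g y * indicator (- B) y"
      have ig: "integrable (measure_pmf r) g" using integrable_envelope[OF f gf] .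
      have i: "integrable (measure_pmf r) (\<lambda>y. g y * indicator X y)" for X
        by (intro integrable_real_mult_indicator ig) simp
      have "emp r g n \<omega> - emp r (?\<pi> g) n \<omega> = emp r (\<lambda>y. g y - ?\<pi> g y) n \<omega>"
        by (rule emp_diff[symmetric, OF ig i])
      also have "(\<lambda>y. g y - ?\<pi> g y) = (\<lambda>y. ?g1 y + ?g2 y)"
        using B(2) by (auto simp: fun_eq_iff indicator_def)
      also have "emp r \<dots> n \<omega> = emp r ?g1 n \<omega> + emp r ?g2 n \<omega>"
        by (rule emp_add[OF i i])
      finally have eq: "emp r g n \<omega> - emp r (?\<pi> g) n \<omega> = emp r ?g1 n \<omega> + emp r ?g2 n \<omega>" .
      have "\<bar>emp r ?g1 n \<omega>\<bar> = \<bar>\<Sum>y\<in>B - A. ?g1 y * emp r (indicator {y}) n \<omega>\<bar>"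
        by (subst emp_finite_support[of "B - A"]) (use B in auto)
      also have "\<dots> \<le> (\<Sum>y\<in>B - A. \<bar>?g1 y * emp r (indicator {y}) n \<omega>\<bar>)" by (rule sum_abs)
      also have "\<dots> \<le> ?V \<omega>"
        using gf by (intro sum_mono) (auto simp: abs_mult intro!: mult_right_mono)
      finally have g1: "\<bar>emp r ?g1 n \<omega>\<bar> \<le> ?V \<omega>" .
      have g2: "min 1 \<bar>emp r ?g2 n \<omega>\<bar> \<le> U \<omega>"
        by (rule U(4)) (use gf in \<open>auto simp: indicator_def\<close>)
      show ?thesis
      proof (rule min_1_triangle[OF _ _ g2])
        show "\<bar>emp r g n \<omega> - emp r (?\<pi> g) n \<omega>\<bar> \<le> \<bar>emp r ?g1 n \<omega>\<bar> + \<bar>emp r ?g2 n \<omega>\<bar>"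
          unfolding eq by (rule abs_triangle_ineq)
        show "min 1 \<bar>emp r ?g1 n \<omega>\<bar> \<le> ?V \<omega>" using g1 by (rule min.coboundedI2)
      qed simp_all
    qed
    moreover have "integral\<^sup>L (sample r) (\<lambda>\<omega>. ?V \<omega> + U \<omega>) \<le> \<epsilon>"
      using Bochner_Integration.integral_add[OF iV U(1)] EV U(2) by linarith
    ultimately show ?thesis
      using iV U(1,3) V0 by (intro exI[of _ "\<lambda>\<omega>. ?V \<omega> + U \<omega>"]) (auto intro!: add_nonneg_nonneg simp del: integral_add)
  qed
  then show "\<exists>A \<pi> C N. finite A \<and> (\<forall>g\<in>envelope_class f. \<forall>y. \<bar>\<pi> g y\<bar> \<le> C \<and> (y \<notin> A \<longrightarrow> \<pi> g y = 0)) \<and>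
    (\<forall>n\<ge>N. outer_close r (envelope_class f) \<pi> \<epsilon> n)"
    using A(1) C by (intro exI[of _ A] exI[of _ ?\<pi>] exI[of _ "sum f A"] exI[of _ 0]) simp
qed

section \<open>Unions of two classes\<close>

lemma approximable_Un:
  assumes "approximable r F3" "approximable r F4"
  shows "approximable r (F3 \<union> F4)"
  unfolding approximable_def
proof (intro allI impI)
  fix \<epsilon> :: real assume "\<epsilon> > 0"
  then have e: "\<epsilon> / 2 > 0" by simp
  obtain A3 \<pi>3 C3 N3 where 3: "finite A3" "\<And>g y. g \<in> F3 \<Longrightarrow> \<bar>\<pi>3 g y\<bar> \<le> C3 \<and> (y \<notin> A3 \<longrightarrow> \<pi>3 g y = 0)"
    "\<And>n. n \<ge> N3 \<Longrightarrow> outer_close r F3 \<pi>3 (\<epsilon> / 2) n"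
    using assms(1)[unfolded approximable_def, rule_format, OF e] by blast
  obtain A4 \<pi>4 C4 N4 where 4: "finite A4" "\<And>g y. g \<in> F4 \<Longrightarrow> \<bar>\<pi>4 g y\<bar> \<le> C4 \<and> (y \<notin> A4 \<longrightarrow> \<pi>4 g y = 0)"
    "\<And>n. n \<ge> N4 \<Longrightarrow> outer_close r F4 \<pi>4 (\<epsilon> / 2) n"
    using assms(2)[unfolded approximable_def, rule_format, OF e] by blast
  let ?\<pi> = "\<lambda>g. if g \<in> F3 then \<pi>3 g else \<pi>4 g"
  have b: "\<bar>?\<pi> g y\<bar> \<le> max C3 C4 \<and> (y \<notin> A3 \<union> A4 \<longrightarrow> ?\<pi> g y = 0)" if "g \<in> F3 \<union> F4" for g y
    using 3(2)[of g y] 4(2)[of g y] that by auto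
  have "outer_close r (F3 \<union> F4) ?\<pi> \<epsilon> n"
    if n: "n \<ge> max N3 N4" for n
  proof -
    obtain U3 where U3: "integrable (sample r) U3" "integral\<^sup>L (sample r) U3 \<le> \<epsilon> / 2"
      "\<And>\<omega>. 0 \<le> U3 \<omega>" "\<And>\<omega> g. g \<in> F3 \<Longrightarrow> min 1 \<bar>emp r g n \<omega> - emp r (\<pi>3 g) n \<omega>\<bar> \<le> U3 \<omega>"
      using 3(3)[of n] n by auto
    obtain U4 where U4: "integrable (sample r) U4" "integral\<^sup>L (sample r) U4 \<le> \<epsilon> / 2"
      "\<And>\<omega>. 0 \<le> U4 \<omega>" "\<And>\<omega> g. g \<in> F4 \<Longrightarrow> min 1 \<bar>emp r g n \<omega> - emp r (\<pi>4 g) n \<omega>\<bar> \<le> U4 \<omega>"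
      using 4(3)[of n] n by auto
    have "min 1 \<bar>emp r g n \<omega> - emp r (?\<pi> g) n \<omega>\<bar> \<le> U3 \<omega> + U4 \<omega>" if "g \<in> F3 \<union> F4" for g \<omega>
    proof (cases "g \<in> F3")
      case True
      then show ?thesis using U3(4)[OF True, of \<omega>] U4(3)[of \<omega>] by (simp add: add_increasing2)
    next
      case False
      then show ?thesis using U4(4)[of g \<omega>] U3(3)[of \<omega>] that by (auto simp: add_increasing)
    qed
    moreover have "integral\<^sup>L (sample r) (\<lambda>\<omega>. U3 \<omega> + U4 \<omega>) \<le> \<epsilon>"
      using Bochner_Integration.integral_add[OF U3(1) U4(1)] U3(2) U4(2) by linarith
    moreover have "integrable (sample r) (\<lambda>\<omega>. U3 \<omega> + U4 \<omega>)" using U3(1) U4(1) by simp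
    moreover have "0 \<le> U3 \<omega> + U4 \<omega>" for \<omega> using U3(3) U4(3) by (rule add_nonneg_nonneg)
    ultimately show ?thesis by (intro exI[of _ "\<lambda>\<omega>. U3 \<omega> + U4 \<omega>"]) blast
  qed
  then show "\<exists>A \<pi> C N. finite A \<and> (\<forall>g\<in>F3 \<union> F4. \<forall>y. \<bar>\<pi> g y\<bar> \<le> C \<and> (y \<notin> A \<longrightarrow> \<pi> g y = 0)) \<and>
    (\<forall>n\<ge>N. outer_close r (F3 \<union> F4) \<pi> \<epsilon> n)"
    using 3(1) 4(1) b
    by (intro exI[of _ "A3 \<union> A4"] exI[of _ ?\<pi>] exI[of _ "max C3 C4"] exI[of _ "max N3 N4"]) blast
qed

lemma Donsker_Un:
  fixes e :: "'a \<Rightarrow> nat" and r :: "'a pmf"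
  assumes e: "inj e"
  shows "Donsker r (F3 \<union> F4) \<longleftrightarrow> Donsker r F3 \<and> Donsker r F4"
proof
  assume "Donsker r (F3 \<union> F4)"
  then show "Donsker r F3 \<and> Donsker r F4"
    unfolding Donsker_iff[OF e]
    using approximable_subset[of r "F3 \<union> F4"] by (meson UnI1 UnI2 Un_upper1 Un_upper2)
next
  assume D: "Donsker r F3 \<and> Donsker r F4"
  have "\<exists>B. \<forall>g\<in>F3 \<union> F4. \<bar>emp r g n \<omega>\<bar> \<le> B" for n \<omega>
  proof -
    obtain B3 B4 where "\<And>g. g \<in> F3 \<Longrightarrow> \<bar>emp r g n \<omega>\<bar> \<le> B3" "\<And>g. g \<in> F4 \<Longrightarrow> \<bar>emp r g n \<omega>\<bar> \<le> B4"
      using D unfolding Donsker_iff[OF e] by meson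
    then show ?thesis by (intro exI[of _ "max B3 B4"]) (auto simp: le_max_iff_disj)
  qed
  then show "Donsker r (F3 \<union> F4)"
    using D approximable_Un[of r F3 F4] unfolding Donsker_iff[OF e] by blast
qed

text \<open>A sign pattern in the class recovers the weighted absolute sum over any finite set \<open>B\<close>, so
  approximability forces the Gaussian limit of that sum to be bounded in probability, uniformly
  in \<open>B\<close>.\<close>

lemma envelope_weights_bounded:
  fixes f :: "'a \<Rightarrow> real" and e :: "'a \<Rightarrow> nat"
  assumes e: "inj e" and f0: "\<And>y. 0 \<le> f y" and ap: "approximable r (envelope_class f)"
  shows "\<exists>c. \<forall>B. finite B \<longrightarrow> (\<Sum>y\<in>B. f y * sqrt (pmf r y * (1 - pmf r y))) \<le> c"
proof -
  interpret P: prob_space "sample r" by (rule prob_space_sample)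
  interpret N: prob_space gauss by (rule prob_space_gauss)
  \<comment> \<open>The tolerance is added to 1/4 in the final comparison; 1/16 gives 5/16, safely
    below the lower estimate 7/10 of \<open>sqrt (2 / pi)\<close>.\<close>
  have "(1/16::real) > 0" by simp
  from ap[unfolded approximable_def, rule_format, OF this] obtain A \<pi> C N where A: "finite A"
    and pi: "\<And>g y. g \<in> envelope_class f \<Longrightarrow> \<bar>\<pi> g y\<bar> \<le> C"
      "\<And>g y. g \<in> envelope_class f \<Longrightarrow> y \<notin> A \<Longrightarrow> \<pi> g y = 0"
    and N: "\<And>n. n \<ge> N \<Longrightarrow> outer_close r (envelope_class f) \<pi> (1/16) n"
    by blast
  have C0: "0 \<le> C" using pi(1)[of f undefined] f0 by (simp add: envelope_class_def)
  have cell: "cell_emp e r n \<omega> (e y) = emp r (indicator {y}) n \<omega>" for n \<omega> y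
  proof -
    have "(\<lambda>z. indicator {e y} (e z)) = (indicator {y} :: 'a \<Rightarrow> real)"
      using e by (auto simp: fun_eq_iff indicator_def inj_eq)
    then show ?thesis by (simp add: cell_emp_def)
  qed
  have cell_pmf: "cell e r (e y) = pmf r y" for y
    unfolding cell_def by (rule pmf_map_inj'[OF e])
  define \<sigma> where "\<sigma> y = sqrt (pmf r y * (1 - pmf r y))" for y
  \<comment> \<open>The first summand bounds the mean of \<open>X\<close> below; 2 is the excess of
    \<open>S\<close> over \<open>X\<close> from which on \<open>\<phi>\<close> equals 1.\<close>
  define c where "c = (\<Sum>y\<in>A. C) + 2"
  let ?W = "bridge_step (cell e r)"
  have WE: "integrable gauss (\<lambda>\<omega>. (?W \<omega> (e y))\<^sup>2)" "(\<integral>\<omega>. (?W \<omega> (e y))\<^sup>2 \<partial>gauss) = (\<sigma> y)\<^sup>2"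
    "integrable gauss (\<lambda>\<omega>. \<bar>?W \<omega> (e y)\<bar>)" "(\<integral>\<omega>. \<bar>?W \<omega> (e y)\<bar> \<partial>gauss) = sqrt (2 / pi) * \<sigma> y" for y
    using bridge_step_moments[where \<rho>="cell e r" and j="e y", OF cell_nonneg sum_cell_le] pmf_le_1[of r y]
    by (auto simp: cell_pmf \<sigma>_def)
  have s0: "0 \<le> \<sigma> y" "\<sigma> y \<le> 1" for y
    using pmf_le_1[of r y] by (auto simp: \<sigma>_def intro: mult_le_one)
  have pi_const: "7/10 \<le> sqrt (2 / pi)"
  proof (rule real_le_rsqrt)
    have "(7/10)\<^sup>2 * pi \<le> (7/10)\<^sup>2 * 4" using pi_less_4 by (intro mult_left_mono) auto
    then show "(7/10)\<^sup>2 \<le> 2 / pi" by (simp add: field_simps power2_eq_square)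
  qed
  have pi_le_1: "sqrt (2 / pi) \<le> 1" using pi_gt3 by simp
  \<comment> \<open>Points with \<open>\<sigma> y = 0\<close> are set aside, as the majorant below
    divides by \<open>\<sigma> y\<close>; they contribute nothing to the sum.\<close>
  have pos: "(\<Sum>y\<in>B. f y * \<sigma> y) \<le> 3 * c" if B: "finite B" "\<And>y. y \<in> B \<Longrightarrow> \<sigma> y > 0" for B
  proof -
    define S where "S v = (\<Sum>y\<in>B. f y * \<bar>v (e y)\<bar>)" for v :: "nat \<Rightarrow> real"
    define X where "X v = (\<Sum>y\<in>A. C * \<bar>v (e y)\<bar>)" for v :: "nat \<Rightarrow> real"
    \<comment> \<open>\<open>X\<close> bounds the empirical process of the approximant and 1 is the
      truncation level, so \<open>\<phi>\<close> is a continuous stand-in for the event that the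
      approximation error exceeds 1.\<close>
    define \<phi> where "\<phi> v = min 1 (max 0 (S v - X v - 1))" for v
    have cont: "continuous_on UNIV \<phi>"
      unfolding \<phi>_def S_def X_def
      by (intro continuous_intros continuous_on_product_coordinates)
    have \<phi>01: "0 \<le> \<phi> v" "\<phi> v \<le> 1" for v by (auto simp: \<phi>_def)
    have "(\<lambda>n. \<integral>\<omega>. \<phi> (cell_emp e r n \<omega>) \<partial>sample r) \<longlonglongrightarrow> (\<integral>\<omega>. \<phi> (?W \<omega>) \<partial>gauss)"
    proof (rule cell_emp_CLT[where B=1 and k="Suc (\<Sum>y\<in>A \<union> B. e y)"])
      show "\<phi> v = \<phi> w" if vw: "\<And>j. j < Suc (\<Sum>y\<in>A \<union> B. e y) \<Longrightarrow> v j = w j" for v w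
      proof -
        have "v (e y) = w (e y)" if "y \<in> A \<union> B" for y
          using that A B(1) by (intro vw) (simp add: member_le_sum less_Suc_eq_le)
        then show ?thesis by (simp add: \<phi>_def S_def X_def)
      qed
    qed (use cont \<phi>01 in auto)
    moreover have "(\<integral>\<omega>. \<phi> (cell_emp e r n \<omega>) \<partial>sample r) \<le> 1/16" if n: "n \<ge> N" for n
    proof -
      obtain U where U: "integrable (sample r) U" "integral\<^sup>L (sample r) U \<le> 1/16" "\<And>\<omega>. 0 \<le> U \<omega>"
        "\<And>\<omega> g. g \<in> envelope_class f \<Longrightarrow> min 1 \<bar>emp r g n \<omega> - emp r (\<pi> g) n \<omega>\<bar> \<le> U \<omega>"
        using N[OF n] by blast
      have "\<phi> (cell_emp e r n \<omega>) \<le> U \<omega>" for \<omega>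
      proof (cases "S (cell_emp e r n \<omega>) - X (cell_emp e r n \<omega>) \<le> 1")
        case True
        then show ?thesis using U(3)[of \<omega>] by (simp add: \<phi>_def)
      next
        case False
        define g where "g y = (if y \<in> B then f y * sgn (emp r (indicator {y}) n \<omega>) else 0)" for y
        have g: "g \<in> envelope_class f"
          using f0 by (auto simp: envelope_class_def g_def abs_mult abs_sgn_eq)
        have "emp r g n \<omega> = (\<Sum>y\<in>B. g y * emp r (indicator {y}) n \<omega>)"
          by (rule emp_finite_support[OF B(1)]) (simp add: g_def)
        also have "\<dots> = S (cell_emp e r n \<omega>)"
          unfolding S_def cell g_def by (intro sum.cong) (auto simp: abs_sgn mult.commute)
        finally have eg: "emp r g n \<omega> = S (cell_emp e r n \<omega>)" .
        have "\<bar>emp r (\<pi> g) n \<omega>\<bar> = \<bar>\<Sum>y\<in>A. \<pi> g y * emp r (indicator {y}) n \<omega>\<bar>"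
          using emp_finite_support[OF A pi(2)[OF g]] by simp
        also have "\<dots> \<le> (\<Sum>y\<in>A. \<bar>\<pi> g y * emp r (indicator {y}) n \<omega>\<bar>)" by (rule sum_abs)
        also have "\<dots> \<le> X (cell_emp e r n \<omega>)"
          unfolding X_def cell using pi(1)[OF g] by (intro sum_mono) (simp add: abs_mult mult_right_mono)
        finally have "1 \<le> \<bar>emp r g n \<omega> - emp r (\<pi> g) n \<omega>\<bar>" using eg False by linarith
        then have "1 \<le> U \<omega>" using U(4)[OF g, of \<omega>] by simp
        then show ?thesis using \<phi>01 order_trans by blast
      qed
      then have "(\<integral>\<omega>. \<phi> (cell_emp e r n \<omega>) \<partial>sample r) \<le> integral\<^sup>L (sample r) U"
        using measurable_compose[OF cell_emp_vector_measurable continuous_borel_measurable_nat[OF cont]] \<phi>01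
        by (intro integral_mono U(1) P.integrable_const_bound[of _ 1]) auto
      then show ?thesis using U(2) by linarith
    qed
    ultimately have E\<phi>: "(\<integral>\<omega>. \<phi> (?W \<omega>) \<partial>gauss) \<le> 1/16"
      by (intro LIMSEQ_le_const2[of _ _ "1/16"]) auto
    have i\<phi>: "integrable gauss (\<lambda>\<omega>. \<phi> (?W \<omega>))"
      using measurable_compose[OF bridge_step_vector_measurable continuous_borel_measurable_nat[OF cont]] \<phi>01
      by (intro N.integrable_const_bound[of _ 1]) auto
    \<comment> \<open>A small probability of large \<open>S\<close> does not by itself bound the
      mean of \<open>S\<close>. Where \<open>\<phi>\<close> is 1, the arithmetic-geometric mean
      inequality \<open>\<bar>w\<bar> \<le> w\<^sup>2 / (4 * s) + s\<close> is used; its mean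
      contributions are \<open>s / 4\<close> and \<open>s\<close> times the small mean of
      \<open>\<phi>\<close>, proportional to the weight that is to be bounded.\<close>
    let ?R = "\<lambda>\<omega>. X (?W \<omega>) + 2 + (\<Sum>y\<in>B. f y * ((?W \<omega> (e y))\<^sup>2 / (4 * \<sigma> y) + \<sigma> y * \<phi> (?W \<omega>)))"
    have bound: "S (?W \<omega>) \<le> ?R \<omega>" for \<omega>
    proof (cases "S (?W \<omega>) \<le> X (?W \<omega>) + 2")
      case True
      moreover have "0 \<le> (\<Sum>y\<in>B. f y * ((?W \<omega> (e y))\<^sup>2 / (4 * \<sigma> y) + \<sigma> y * \<phi> (?W \<omega>)))"
        using f0 s0 \<phi>01 by (intro sum_nonneg mult_nonneg_nonneg add_nonneg_nonneg divide_nonneg_nonneg) auto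
      ultimately show ?thesis by linarith
    next
      case False
      then have \<phi>1: "\<phi> (?W \<omega>) = 1" by (simp add: \<phi>_def)
      have "S (?W \<omega>) \<le> (\<Sum>y\<in>B. f y * ((?W \<omega> (e y))\<^sup>2 / (4 * \<sigma> y) + \<sigma> y * \<phi> (?W \<omega>)))"
        unfolding S_def
      proof (intro sum_mono mult_left_mono f0)
        fix y assume y: "y \<in> B"
        have "0 \<le> (\<bar>?W \<omega> (e y)\<bar> - 2 * \<sigma> y)\<^sup>2" by simp
        then have "4 * \<sigma> y * \<bar>?W \<omega> (e y)\<bar> \<le> (?W \<omega> (e y))\<^sup>2 + 4 * \<sigma> y * \<sigma> y"
          by (simp add: power2_diff) (simp add: power2_eq_square algebra_simps)
        then show "\<bar>?W \<omega> (e y)\<bar> \<le> (?W \<omega> (e y))\<^sup>2 / (4 * \<sigma> y) + \<sigma> y * \<phi> (?W \<omega>)"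
          using B(2)[OF y] by (simp add: \<phi>1 field_simps)
      qed
      moreover have "0 \<le> X (?W \<omega>)" unfolding X_def using C0 by (intro sum_nonneg) auto
      ultimately show ?thesis by linarith
    qed
    let ?a = "\<Sum>y\<in>B. f y * \<sigma> y"
    have iS: "integrable gauss (\<lambda>\<omega>. S (?W \<omega>))" and ES: "(\<integral>\<omega>. S (?W \<omega>) \<partial>gauss) = sqrt (2 / pi) * ?a"
      unfolding S_def using WE by (auto simp: sum_distrib_left mult_ac)
    have iX: "integrable gauss (\<lambda>\<omega>. X (?W \<omega>))" and EX: "(\<integral>\<omega>. X (?W \<omega>) \<partial>gauss) = (\<Sum>y\<in>A. C * (sqrt (2 / pi) * \<sigma> y))"
      unfolding X_def using WE by auto
    have EX': "(\<integral>\<omega>. X (?W \<omega>) \<partial>gauss) \<le> (\<Sum>y\<in>A. C)"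
      unfolding EX using C0 s0 pi_le_1 by (intro sum_mono mult_left_le mult_le_one) auto
    have iQ: "integrable gauss (\<lambda>\<omega>. f y * ((?W \<omega> (e y))\<^sup>2 / (4 * \<sigma> y) + \<sigma> y * \<phi> (?W \<omega>)))" for y
      using WE i\<phi> by auto
    have EQ: "(\<integral>\<omega>. f y * ((?W \<omega> (e y))\<^sup>2 / (4 * \<sigma> y) + \<sigma> y * \<phi> (?W \<omega>)) \<partial>gauss) \<le> 5/16 * (f y * \<sigma> y)"
      if y: "y \<in> B" for y
    proof -
      have "(\<integral>\<omega>. f y * ((?W \<omega> (e y))\<^sup>2 / (4 * \<sigma> y) + \<sigma> y * \<phi> (?W \<omega>)) \<partial>gauss) =
        f y * ((\<sigma> y)\<^sup>2 / (4 * \<sigma> y) + \<sigma> y * (\<integral>\<omega>. \<phi> (?W \<omega>) \<partial>gauss))"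
        using WE i\<phi> by simp
      also have "\<dots> \<le> f y * (\<sigma> y / 4 + \<sigma> y * (1/16))"
        using E\<phi> f0 s0 B(2)[OF y] by (intro mult_left_mono add_mono) (auto simp: power2_eq_square)
      also have "\<dots> = 5/16 * (f y * \<sigma> y)" by simp
      finally show ?thesis .
    qed
    have "(\<integral>\<omega>. S (?W \<omega>) \<partial>gauss) \<le> (\<integral>\<omega>. ?R \<omega> \<partial>gauss)"
      using iS iX iQ bound by (intro integral_mono) auto
    also have "\<dots> = (\<integral>\<omega>. X (?W \<omega>) \<partial>gauss) + 2 + (\<Sum>y\<in>B. \<integral>\<omega>. f y * ((?W \<omega> (e y))\<^sup>2 / (4 * \<sigma> y) + \<sigma> y * \<phi> (?W \<omega>)) \<partial>gauss)"
      using iX iQ N.prob_space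
      by (subst Bochner_Integration.integral_add Bochner_Integration.integral_sum; simp)+
    also have "\<dots> \<le> c + (\<Sum>y\<in>B. 5/16 * (f y * \<sigma> y))"
      using EX' EQ by (intro add_mono sum_mono) (auto simp: c_def)
    also have "\<dots> = c + 5/16 * ?a" by (simp add: sum_distrib_left)
    \<comment> \<open>With \<open>7/10 \<le> sqrt (2 / pi)\<close> this leaves
      \<open>(7/10 - 5/16) * ?a \<le> c\<close>, whence the factor 3.\<close>
    finally have "sqrt (2 / pi) * ?a \<le> c + 5/16 * ?a" unfolding ES .
    moreover have "0 \<le> ?a" using f0 s0 by (intro sum_nonneg) auto
    then have "7/10 * ?a \<le> sqrt (2 / pi) * ?a" using pi_const by (rule mult_right_mono[rotated])
    moreover have "0 \<le> c" unfolding c_def using C0 by (simp add: sum_nonneg)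
    ultimately show ?thesis by linarith
  qed
  have "(\<Sum>y\<in>B. f y * \<sigma> y) \<le> 3 * c" if "finite B" for B
  proof -
    have "(\<Sum>y\<in>B. f y * \<sigma> y) = (\<Sum>y\<in>{y\<in>B. \<sigma> y > 0}. f y * \<sigma> y)"
      using that s0 by (intro sum.mono_neutral_right) (auto simp: order.order_iff_strict)
    also have "\<dots> \<le> 3 * c" using that by (intro pos) auto
    finally show ?thesis .
  qed
  then show ?thesis unfolding \<sigma>_def by blast
qed

text \<open>The factor \<open>1 - pmf r y\<close> is at least 1/2 except at no more than one point,
  and a single term does not affect summability.\<close>

lemma summable_weights:
  fixes f :: "'a \<Rightarrow> real"
  assumes f0: "\<And>y. 0 \<le> f y"
    and c: "\<And>B. finite B \<Longrightarrow> (\<Sum>y\<in>B. f y * sqrt (pmf r y * (1 - pmf r y))) \<le> c"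
  shows "(\<lambda>y. f y * sqrt (pmf r y)) summable_on UNIV"
proof -
  let ?big = "{y. pmf r y > 1/2}"
  have "\<exists>y0. ?big \<subseteq> {y0}"
  proof (rule ccontr)
    assume n: "\<not> ?thesis"
    then obtain y1 where y1: "y1 \<in> ?big" by blast
    obtain y2 where y2: "y2 \<in> ?big" "y2 \<noteq> y1" using n by blast
    have "sum (pmf r) {y1, y2} \<le> 1"
      by (simp add: measure_measure_pmf_finite[symmetric] del: sum.insert)
    then show False using y1 y2 by simp
  qed
  then obtain y0 where sub: "?big \<subseteq> {y0}" ..
  have y0: "pmf r y \<le> 1/2" if "y \<noteq> y0" for y
  proof (rule ccontr)
    assume "\<not> ?thesis"
    then have "y \<in> ?big" by simp
    then show False using sub that by blast
  qed
  have le: "f y * sqrt (pmf r y) \<le> 2 * (f y * sqrt (pmf r y * (1 - pmf r y)))" if "y \<noteq> y0" for y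
  proof -
    have "1/2 \<le> sqrt (1 - pmf r y)"
      using y0[OF that] by (intro real_le_rsqrt) (simp add: power2_eq_square)
    then have "sqrt (pmf r y) * 1 \<le> sqrt (pmf r y) * (2 * sqrt (1 - pmf r y))"
      by (intro mult_left_mono) auto
    then have "f y * sqrt (pmf r y) \<le> f y * (sqrt (pmf r y) * (2 * sqrt (1 - pmf r y)))"
      using f0 by (intro mult_left_mono) auto
    then show ?thesis by (simp add: real_sqrt_mult mult_ac)
  qed
  show ?thesis
  proof (rule nonneg_bdd_above_summable_on)
    show "bdd_above (sum (\<lambda>y. f y * sqrt (pmf r y)) ` {F. F \<subseteq> UNIV \<and> finite F})"
    proof (rule bdd_aboveI2)
      fix F assume "F \<in> {F. F \<subseteq> (UNIV :: 'a set) \<and> finite F}"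
      then have F: "finite F" by simp
      have "(\<Sum>y\<in>F. f y * sqrt (pmf r y)) \<le> (\<Sum>y\<in>insert y0 (F - {y0}). f y * sqrt (pmf r y))"
        using F f0 by (intro sum_mono2) auto
      also have "\<dots> = f y0 * sqrt (pmf r y0) + (\<Sum>y\<in>F - {y0}. f y * sqrt (pmf r y))"
        using F by (subst sum.insert) auto
      also have "(\<Sum>y\<in>F - {y0}. f y * sqrt (pmf r y)) \<le> (\<Sum>y\<in>F - {y0}. 2 * (f y * sqrt (pmf r y * (1 - pmf r y))))"
        by (intro sum_mono le) auto
      also have "\<dots> \<le> 2 * c"
        unfolding sum_distrib_left[symmetric] using F by (intro mult_left_mono c) auto
      finally show "(\<Sum>y\<in>F. f y * sqrt (pmf r y)) \<le> f y0 * sqrt (pmf r y0) + 2 * c" by simp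
    qed
  qed (use f0 in auto)
qed

lemma Donsker_envelope_class:
  fixes f :: "'a \<Rightarrow> real" and e :: "'a \<Rightarrow> nat"
  assumes e: "inj e" and f0: "\<And>y. 0 \<le> f y"
  shows "Donsker r (envelope_class f) \<longleftrightarrow> (\<lambda>y. f y * sqrt (pmf r y)) summable_on UNIV"
proof
  assume "Donsker r (envelope_class f)"
  then obtain c where "\<And>B. finite B \<Longrightarrow> (\<Sum>y\<in>B. f y * sqrt (pmf r y * (1 - pmf r y))) \<le> c"
    using envelope_weights_bounded[where f=f and r=r, OF e f0] unfolding Donsker_iff[OF e] by blast
  then show "(\<lambda>y. f y * sqrt (pmf r y)) summable_on UNIV"
    by (rule summable_weights[OF f0])
next
  assume s: "(\<lambda>y. f y * sqrt (pmf r y)) summable_on UNIV"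
  have f: "integrable (measure_pmf r) f"
    unfolding integrable_pmf_iff_summable
  proof (rule summable_on_comparison_test[OF s])
    fix y
    have "pmf r y = sqrt (pmf r y) * sqrt (pmf r y)" by simp
    also have "\<dots> \<le> sqrt (pmf r y) * 1" by (intro mult_left_mono) (auto simp: pmf_le_1)
    finally show "f y * pmf r y \<le> f y * sqrt (pmf r y)" using f0 by (intro mult_left_mono) auto
  qed (use f0 in auto)
  have env: "\<bar>g y\<bar> \<le> f y" if "g \<in> envelope_class f" for g y
    using that by (simp add: envelope_class_def)
  have b: "\<exists>B. \<forall>g\<in>envelope_class f. \<bar>emp r g n \<omega>\<bar> \<le> B" for n \<omega>
    by (rule emp_envelope_bounded[OF f]) (rule env)
  have i: "integrable (measure_pmf r) g" if "g \<in> envelope_class f" for g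
    by (rule integrable_envelope[OF f env[OF that]])
  show "Donsker r (envelope_class f)"
    unfolding Donsker_iff[OF e]
    using envelope_class_approximable[OF f0 s f] b i by blast
qed

section \<open>Tail classes\<close>

definition tail_fun :: "(nat \<Rightarrow> 'a) \<Rightarrow> ('a \<Rightarrow> real) \<Rightarrow> nat \<Rightarrow> 'a \<Rightarrow> real" where
  "tail_fun x f k y = f y * indicator (- (x ` {..<k})) y"

lemma tail_class_eq: "tail_class x f = range (tail_fun x f)"
proof -
  have "tail_fun x f 0 = f" by (simp add: tail_fun_def fun_eq_iff)
  then have "f \<in> range (tail_fun x f)" by (metis rangeI)
  moreover have "{\<lambda>y. f y * indicator (- (x ` {..<n})) y | n. True} = range (tail_fun x f)"
    by (auto simp: tail_fun_def[abs_def])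
  ultimately show ?thesis unfolding tail_class_def by (metis insert_absorb insert_is_Un)
qed

lemma tail_fun_square: "(tail_fun x f k y)\<^sup>2 = (f y)\<^sup>2 * indicator (- (x ` {..<k})) y"
  by (simp add: tail_fun_def power_mult_distrib indicator_def)

lemma tail_fun_square_integrable:
  assumes "integrable (measure_pmf r) (\<lambda>y. (f y)\<^sup>2)"
  shows "integrable (measure_pmf r) (\<lambda>y. (tail_fun x f k y)\<^sup>2)"
  unfolding tail_fun_square by (intro integrable_real_mult_indicator assms) simp

lemma tail_fun_diff: "i \<le> j \<Longrightarrow> tail_fun x f i y - tail_fun x f j y = f y * indicator (x ` {..<j} - x ` {..<i}) y"
  by (auto simp: tail_fun_def indicator_def)

lemma tail_fun_diff_support:
  "i \<le> j \<Longrightarrow> y \<notin> x ` {..<j} \<Longrightarrow> tail_fun x f i y - tail_fun x f j y = 0"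
  by (simp add: tail_fun_diff)

lemma tail_fun_diff_square_integrable:
  "i \<le> j \<Longrightarrow> integrable (measure_pmf r) (\<lambda>y. (tail_fun x f i y - tail_fun x f j y)\<^sup>2)"
  by (rule integrable_finite_support[of "x ` {..<j}"]) (auto simp: tail_fun_diff_support)

text \<open>Increments over disjoint index ranges have disjoint supports, so second moments add up.
  This additivity supplies the weights \<open>u\<close> for the fluctuation inequality.\<close>

lemma expectation_tail_fun_diff_square:
  assumes "i \<le> j"
  shows "E r (\<lambda>y. (tail_fun x f i y - tail_fun x f j y)\<^sup>2) =
    (\<Sum>l=i..<j. E r (\<lambda>y. (tail_fun x f l y - tail_fun x f (Suc l) y)\<^sup>2))"
  using assms
proof (induction j rule: dec_induct)
  case (step j)
  have "(tail_fun x f i y - tail_fun x f (Suc j) y)\<^sup>2 =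
    (tail_fun x f i y - tail_fun x f j y)\<^sup>2 + (tail_fun x f j y - tail_fun x f (Suc j) y)\<^sup>2" for y
  proof -
    have "(tail_fun x f i y - tail_fun x f j y) * (tail_fun x f j y - tail_fun x f (Suc j) y) = 0"
      using step(1) by (auto simp: tail_fun_diff indicator_def)
    then show ?thesis by (simp add: power2_eq_square algebra_simps)
  qed
  then show ?case
    using step tail_fun_diff_square_integrable[of i j r x f] tail_fun_diff_square_integrable[of j "Suc j" r x f]
    by simp
qed simp

text \<open>Markov's inequality in pointwise form: it converts control of a fourth moment into an
  integrable majorant of \<open>a\<close> itself. \<open>abs_le_square\<close> does the same for
  second moments.\<close>

lemma abs_le_power4:
  fixes a \<delta> :: real
  assumes d: "\<delta> > 0" and a: "0 \<le> a"
  shows "a \<le> \<delta> + a ^ 4 / \<delta> ^ 3"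
proof (cases "a \<le> \<delta>")
  case True
  have "0 \<le> a ^ 4 / \<delta> ^ 3" using d a by (intro divide_nonneg_pos zero_le_power zero_less_power)
  then show ?thesis using True by linarith
next
  case False
  have "a * \<delta> ^ 3 \<le> a * a ^ 3" using False d a by (intro mult_left_mono power_mono) linarith+
  also have "a * a ^ 3 = a ^ 4" by (simp only: power3_eq_cube power4_eq_xxxx mult.assoc)
  finally have "a \<le> a ^ 4 / \<delta> ^ 3" by (simp only: pos_le_divide_eq[OF zero_less_power[OF d]])
  then show ?thesis using d by linarith
qed

lemma abs_le_square:
  fixes a \<delta> :: real
  assumes d: "\<delta> > 0"
  shows "\<bar>a\<bar> \<le> \<delta> + a\<^sup>2 / \<delta>"
proof (cases "\<bar>a\<bar> \<le> \<delta>")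
  case True
  have "0 \<le> a\<^sup>2 / \<delta>" using d by (intro divide_nonneg_pos zero_le_power2)
  then show ?thesis using True by linarith
next
  case False
  have "\<bar>a\<bar> * \<delta> \<le> \<bar>a\<bar> * \<bar>a\<bar>" using False by (intro mult_left_mono) linarith+
  also have "\<bar>a\<bar> * \<bar>a\<bar> = a\<^sup>2" by (simp only: abs_mult_self_eq power2_eq_square)
  finally have "\<bar>a\<bar> \<le> a\<^sup>2 / \<delta>" by (simp only: pos_le_divide_eq[OF d])
  then show ?thesis using d by linarith
qed

text \<open>Tails from a late index \<open>N\<close> on vanish on a large finite set and fall to
  \<open>tail_cut\<close>. Those between \<open>m\<close> and \<open>N\<close> differ from the tail
  at \<open>m\<close> by partial sums of increments with disjoint supports: the fluctuation
  inequality controls the smaller side of every cut, and the total sum then controls the larger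
  one.\<close>

lemma tail_maximal_inequality:
  fixes f :: "'a \<Rightarrow> real" and x :: "nat \<Rightarrow> 'a" and r :: "'a pmf" and m n :: nat
  assumes enum: "range x = UNIV" and f0: "\<And>y. 0 \<le> f y"
    and f2: "integrable (measure_pmf r) (\<lambda>y. (f y)\<^sup>2)" and d: "\<delta> > 0"
  defines "v \<equiv> E r (\<lambda>y. (tail_fun x f m y)\<^sup>2)"
  shows "\<exists>U. integrable (sample r) U \<and>
    integral\<^sup>L (sample r) U \<le> 4 * \<delta> + 2741856 * v\<^sup>2 / \<delta> ^ 3 + 2 * v / \<delta> \<and>
    (\<forall>\<omega>. 0 \<le> U \<omega> \<and> (\<forall>k\<ge>m. min 1 \<bar>emp r (tail_fun x f k) n \<omega>\<bar> \<le> U \<omega>))"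
proof -
  interpret P: prob_space "sample r" by (rule prob_space_sample)
  let ?t = "tail_fun x f"
  have f1: "integrable (measure_pmf r) f" by (rule integrable_of_square[OF f2])
  obtain B Ut where B: "finite B" and Ut: "integrable (sample r) Ut" "integral\<^sup>L (sample r) Ut \<le> \<delta>"
    "\<And>\<omega>. 0 \<le> Ut \<omega>" "\<And>\<omega> g. (\<And>y. \<bar>g y\<bar> \<le> f y * indicator (- B) y) \<Longrightarrow> min 1 \<bar>emp r g n \<omega>\<bar> \<le> Ut \<omega>"
    using tail_cut[OF f1 finite.emptyI d, of n] by auto
  have "\<exists>N\<ge>m. B \<subseteq> x ` {..<N}"
  proof -
    obtain J where J: "finite J" "B = x ` J"
      using finite_subset_image[OF B, of x UNIV] enum by auto
    then obtain N where "J \<subseteq> {..<N}" using finite_nat_bounded[of J] by auto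
    then show ?thesis using J(2) by (intro exI[of _ "max m N"]) auto
  qed
  then obtain N where N: "m \<le> N" "B \<subseteq> x ` {..<N}" by blast
  note it2 = tail_fun_square_integrable[where x=x and f=f, OF f2]
  have it: "integrable (measure_pmf r) (?t k)" for k
    using integrable_of_square[OF it2] .
  define D where "D l \<omega> = emp r (\<lambda>y. ?t l y - ?t (Suc l) y) n \<omega>" for l \<omega>
  define u where "u l = E r (\<lambda>y. (?t l y - ?t (Suc l) y)\<^sup>2)" for l
  have S: "(\<Sum>l=i..<j. D l \<omega>) = emp r (\<lambda>y. ?t i y - ?t j y) n \<omega>" if "i \<le> j" for i j \<omega>
  proof -
    have "(\<Sum>l=i..<j. D l \<omega>) = (\<Sum>l=i..<j. emp r (?t l) n \<omega> - emp r (?t (Suc l)) n \<omega>)"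
      by (simp add: D_def emp_diff it)
    also have "\<dots> = emp r (?t i) n \<omega> - emp r (?t j) n \<omega>"
      using sum_Suc_diff'[OF that, of "\<lambda>l. - emp r (?t l) n \<omega>"] by simp
    finally show ?thesis by (simp add: emp_diff it)
  qed
  have b: "bnd (\<lambda>y. ?t i y - ?t j y)" if "i \<le> j" for i j
    by (rule bnd_finite_support[of "x ` {..<j}"]) (use that in \<open>auto simp: tail_fun_diff_support\<close>)
  have disj: "(?t i y - ?t j y) * (?t j y - ?t k y) = 0" if "i \<le> j" "j \<le> k" for i j k y
    using that by (auto simp: tail_fun_diff indicator_def)
  have usum: "E r (\<lambda>y. (?t i y - ?t j y)\<^sup>2) = (\<Sum>l=i..<j. u l)" if "i \<le> j" for i j
    unfolding u_def by (rule expectation_tail_fun_diff_square[OF that])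
  have "\<exists>U. integrable (sample r) U \<and> integral\<^sup>L (sample r) U \<le> 228488 * 12 * (\<Sum>l=m..<N. u l)\<^sup>2 \<and>
    (\<forall>\<omega>. \<forall>j\<in>{m..N}. (min \<bar>\<Sum>l=m..<j. D l \<omega>\<bar> \<bar>\<Sum>l=j..<N. D l \<omega>\<bar>) ^ 4 \<le> U \<omega>)"
  proof (rule fluctuation_inequality)
    show "0 \<le> u l" for l by (simp add: u_def)
    show "integrable (sample r) (\<lambda>\<omega>. (\<Sum>l=i..<j. D l \<omega>)\<^sup>2 * (\<Sum>l=j..<k. D l \<omega>)\<^sup>2)" if "i \<le> j" "j \<le> k" for i j k
      unfolding S[OF that(1)] S[OF that(2)]
      by (rule emp_disjoint_product_moment(1)[OF b b disj]) (use that in auto)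
    show "(\<integral>\<omega>. (\<Sum>l=i..<j. D l \<omega>)\<^sup>2 * (\<Sum>l=j..<k. D l \<omega>)\<^sup>2 \<partial>sample r) \<le> 12 * ((\<Sum>l=i..<j. u l) * (\<Sum>l=j..<k. u l))"
      if "i \<le> j" "j \<le> k" for i j k
      unfolding S[OF that(1)] S[OF that(2)]
      using emp_disjoint_product_moment(2)[OF b[OF that(1)] b[OF that(2)] disj[OF that], of r n]
      by (simp add: usum[OF that(1)] usum[OF that(2)] mult.assoc)
  qed (use N in auto)
  then obtain U0 where U0: "integrable (sample r) U0"
    "integral\<^sup>L (sample r) U0 \<le> 2741856 * (\<Sum>l=m..<N. u l)\<^sup>2"
    "\<And>\<omega> j. j \<in> {m..N} \<Longrightarrow> (min \<bar>\<Sum>l=m..<j. D l \<omega>\<bar> \<bar>\<Sum>l=j..<N. D l \<omega>\<bar>) ^ 4 \<le> U0 \<omega>"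
    by auto
  have U00: "0 \<le> U0 \<omega>" for \<omega>
  proof -
    have "0 \<le> (min \<bar>p\<bar> \<bar>q\<bar>) ^ 4" for p q :: real by simp
    then show ?thesis using U0(3)[of m \<omega>] N(1) by (meson atLeastAtMost_iff order_refl order_trans)
  qed
  have v0: "0 \<le> v" by (simp add: v_def)
  have uv: "(\<Sum>l=m..<N. u l) \<le> v"
  proof -
    have "E r (\<lambda>y. (?t m y - ?t N y)\<^sup>2) \<le> E r (\<lambda>y. (?t m y)\<^sup>2)"
      using it2 tail_fun_diff_square_integrable[OF N(1)] N(1)
      by (intro integral_mono) (auto simp: tail_fun_diff, auto simp: tail_fun_def indicator_def)
    then show ?thesis by (simp add: usum[OF N(1)] v_def)
  qed
  have u0: "0 \<le> (\<Sum>l=m..<N. u l)" by (auto simp: u_def intro: sum_nonneg)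
  let ?Sm = "\<lambda>\<omega>. emp r (\<lambda>y. ?t m y - ?t N y) n \<omega>" and ?M = "\<lambda>\<omega>. emp r (?t m) n \<omega>"
  \<comment> \<open>\<open>3 * \<delta>\<close> comes from the three pointwise Markov estimates, for
    the minimum, \<open>?Sm\<close> and \<open>?M\<close>; \<open>tail_cut\<close> adds the fourth
    \<open>\<delta>\<close>. The constant 2741856 is \<open>12 * 228488\<close>.\<close>
  let ?U = "\<lambda>\<omega>. 3 * \<delta> + U0 \<omega> / \<delta> ^ 3 + (?Sm \<omega>)\<^sup>2 / \<delta> + (?M \<omega>)\<^sup>2 / \<delta> + Ut \<omega>"
  note Sm = emp_square[OF tail_fun_diff_square_integrable[OF N(1), of r x f], of n]
  note Mm = emp_square[OF it2, of m n]
  have iU: "integrable (sample r) ?U" using U0(1) Sm(1) Mm(1) Ut(1) by simp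
  have "integral\<^sup>L (sample r) ?U = 3 * \<delta> + integral\<^sup>L (sample r) U0 / \<delta> ^ 3
      + (\<integral>\<omega>. (?Sm \<omega>)\<^sup>2 \<partial>sample r) / \<delta> + (\<integral>\<omega>. (?M \<omega>)\<^sup>2 \<partial>sample r) / \<delta> + integral\<^sup>L (sample r) Ut"
    using U0(1) Sm(1) Mm(1) Ut(1) P.prob_space by simp
  also have "\<dots> \<le> 3 * \<delta> + 2741856 * v\<^sup>2 / \<delta> ^ 3 + v / \<delta> + v / \<delta> + \<delta>"
  proof (intro add_mono divide_right_mono order_refl Ut(2))
    show "integral\<^sup>L (sample r) U0 \<le> 2741856 * v\<^sup>2"
      using uv u0 by (intro order_trans[OF U0(2)] mult_left_mono power_mono) auto
    show "(\<integral>\<omega>. (?Sm \<omega>)\<^sup>2 \<partial>sample r) \<le> v"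
      using Sm(2) uv unfolding usum[OF N(1)] by linarith
    show "(\<integral>\<omega>. (?M \<omega>)\<^sup>2 \<partial>sample r) \<le> v" using Mm(2) unfolding v_def .
  qed (use d in auto)
  also have "\<dots> = 4 * \<delta> + 2741856 * v\<^sup>2 / \<delta> ^ 3 + 2 * v / \<delta>" by (simp add: field_simps)
  finally have EU: "integral\<^sup>L (sample r) ?U \<le> 4 * \<delta> + 2741856 * v\<^sup>2 / \<delta> ^ 3 + 2 * v / \<delta>" .
  have nonneg: "0 \<le> U0 \<omega> / \<delta> ^ 3" "0 \<le> (?Sm \<omega>)\<^sup>2 / \<delta>" "0 \<le> (?M \<omega>)\<^sup>2 / \<delta>" for \<omega>
    using U00 d by auto
  have U_nonneg: "0 \<le> ?U \<omega>" for \<omega>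
    using nonneg[of \<omega>] Ut(3)[of \<omega>] d by linarith
  have main: "min 1 \<bar>emp r (?t k) n \<omega>\<bar> \<le> ?U \<omega>" if k: "k \<ge> m" for k \<omega>
  proof (cases "k \<le> N")
    case False
    have "min 1 \<bar>emp r (?t k) n \<omega>\<bar> \<le> Ut \<omega>"
    proof (rule Ut(4))
      have "B \<subseteq> x ` {..<k}" using N(2) False by (intro order_trans[OF N(2) image_mono]) auto
      then show "\<bar>?t k y\<bar> \<le> f y * indicator (- B) y" for y
        using f0[of y] by (auto simp only: tail_fun_def indicator_def split: if_split) (auto simp: subset_iff)
    qed
    then show ?thesis using nonneg[of \<omega>] d by linarith
  next
    case True
    let ?Sk = "emp r (\<lambda>y. ?t m y - ?t k y) n \<omega>" and ?Rk = "emp r (\<lambda>y. ?t k y - ?t N y) n \<omega>"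
    have sk: "?Sk = ?M \<omega> - emp r (?t k) n \<omega>" and rk: "?Rk = emp r (?t k) n \<omega> - emp r (?t N) n \<omega>"
      and sm: "?Sm \<omega> = ?M \<omega> - emp r (?t N) n \<omega>"
      by (simp_all add: emp_diff it)
    have "(min \<bar>?Sk\<bar> \<bar>?Rk\<bar>) ^ 4 \<le> U0 \<omega>"
      using U0(3)[of k \<omega>] k True by (simp only: S atLeastAtMost_iff simp_thms)
    then have "(min \<bar>?Sk\<bar> \<bar>?Rk\<bar>) ^ 4 / \<delta> ^ 3 \<le> U0 \<omega> / \<delta> ^ 3"
      using d by (intro divide_right_mono) auto
    moreover have "min \<bar>?Sk\<bar> \<bar>?Rk\<bar> \<le> \<delta> + (min \<bar>?Sk\<bar> \<bar>?Rk\<bar>) ^ 4 / \<delta> ^ 3"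
      by (rule abs_le_power4[OF d]) simp
    ultimately have 1: "min \<bar>?Sk\<bar> \<bar>?Rk\<bar> \<le> \<delta> + U0 \<omega> / \<delta> ^ 3" by (rule order_trans[rotated, OF add_left_mono])
    \<comment> \<open>If the minimum is \<open>\<bar>?Rk\<bar>\<close>, the bound follows from
      \<open>?Sk = ?Sm \<omega> - ?Rk\<close>.\<close>
    have "\<bar>?Sk\<bar> \<le> min \<bar>?Sk\<bar> \<bar>?Rk\<bar> + \<bar>?Sm \<omega>\<bar>"
      unfolding sk rk sm by (cases "\<bar>?Sk\<bar> \<le> \<bar>?Rk\<bar>") (simp_all add: sk rk)
    moreover have "\<bar>?Sm \<omega>\<bar> \<le> \<delta> + (?Sm \<omega>)\<^sup>2 / \<delta>" by (rule abs_le_square[OF d])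
    moreover have "\<bar>?M \<omega>\<bar> \<le> \<delta> + (?M \<omega>)\<^sup>2 / \<delta>" by (rule abs_le_square[OF d])
    ultimately have "\<bar>emp r (?t k) n \<omega>\<bar> \<le> 3 * \<delta> + U0 \<omega> / \<delta> ^ 3 + (?Sm \<omega>)\<^sup>2 / \<delta> + (?M \<omega>)\<^sup>2 / \<delta>"
      using 1 sk by linarith
    then show ?thesis using Ut(3)[of \<omega>] by (intro min.coboundedI2) linarith
  qed
  show ?thesis using iU EU U_nonneg main by (intro exI[of _ ?U]) blast
qed

text \<open>All but the first \<open>m\<close> tails are replaced by 0, so the approximating map has
  finite range and \<open>approximableI\<close> takes care of the truncation to a finite
  set.\<close>

lemma tail_class_approximable:
  fixes f :: "'a \<Rightarrow> real" and x :: "nat \<Rightarrow> 'a"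
  assumes enum: "range x = UNIV" and f0: "\<And>y. 0 \<le> f y"
    and f2: "integrable (measure_pmf r) (\<lambda>y. (f y)\<^sup>2)"
  shows "approximable r (tail_class x f)"
proof (rule approximableI)
  let ?t = "tail_fun x f"
  note it2 = tail_fun_square_integrable[where x=x and f=f, OF f2]
  show "integrable (measure_pmf r) g" if "g \<in> tail_class x f" for g
    using that integrable_of_square[OF it2] by (auto simp: tail_class_eq)
  fix \<epsilon> :: real assume e: "\<epsilon> > 0"
  define \<delta> where "\<delta> = \<epsilon> / 8"
  have d: "\<delta> > 0" using e by (simp add: \<delta>_def)
  \<comment> \<open>The coefficient of the tail second moment in the maximal inequality, once that
    moment is below 1 and its square can be replaced by itself; \<open>4 * \<delta>\<close> takes
    the other half of \<open>\<epsilon>\<close>.\<close>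
  define K where "K = 2741856 / \<delta> ^ 3 + 2 / \<delta>"
  have K: "K > 0" using d by (simp add: K_def add_pos_pos)
  have "min 1 (\<epsilon> / 2 / K) > 0" using e K by simp
  from tail_expectation_small[OF f2 this] obtain A where A: "finite A"
    "\<And>A'. finite A' \<Longrightarrow> A \<subseteq> A' \<Longrightarrow> E r (\<lambda>y. (f y)\<^sup>2 * indicator (- A') y) < min 1 (\<epsilon> / 2 / K)"
    by blast
  obtain J where J: "finite J" "A = x ` J"
    using finite_subset_image[OF A(1), of x UNIV] enum by auto
  then obtain m where "J \<subseteq> {..<m}" using finite_nat_bounded[of J] by auto
  then have "A \<subseteq> x ` {..<m}" using J(2) by auto
  then have vm: "E r (\<lambda>y. (?t m y)\<^sup>2) < min 1 (\<epsilon> / 2 / K)"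
    unfolding tail_fun_square by (intro A(2)) auto
  let ?v = "E r (\<lambda>y. (?t m y)\<^sup>2)"
  have v0: "0 \<le> ?v" by simp
  have "?v\<^sup>2 \<le> ?v" using vm v0 by (simp add: power2_eq_square mult_left_le)
  then have "2741856 * ?v\<^sup>2 / \<delta> ^ 3 + 2 * ?v / \<delta> \<le> 2741856 * ?v / \<delta> ^ 3 + 2 * ?v / \<delta>"
    using d by (intro add_right_mono divide_right_mono mult_left_mono) auto
  also have "\<dots> = ?v * K" by (simp add: K_def distrib_left mult.commute)
  also have "\<dots> \<le> \<epsilon> / 2" using vm K by (simp add: pos_less_divide_eq less_imp_le)
  finally have small: "4 * \<delta> + 2741856 * ?v\<^sup>2 / \<delta> ^ 3 + 2 * ?v / \<delta> \<le> \<epsilon>"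
    by (simp add: \<delta>_def)
  define \<pi> where "\<pi> g = (if g \<in> ?t ` {..<m} then g else (\<lambda>_. 0))" for g
  have "outer_close r (tail_class x f) \<pi> \<epsilon> n" for n
  proof -
    obtain U where U: "integrable (sample r) U"
      "integral\<^sup>L (sample r) U \<le> 4 * \<delta> + 2741856 * ?v\<^sup>2 / \<delta> ^ 3 + 2 * ?v / \<delta>"
      "\<And>\<omega>. 0 \<le> U \<omega>" "\<And>\<omega> k. k \<ge> m \<Longrightarrow> min 1 \<bar>emp r (?t k) n \<omega>\<bar> \<le> U \<omega>"
      using tail_maximal_inequality[where m=m and n=n and f=f, OF enum f0 f2 d] by blast
    have "min 1 \<bar>emp r g n \<omega> - emp r (\<pi> g) n \<omega>\<bar> \<le> U \<omega>" if g: "g \<in> tail_class x f" for g \<omega>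
    proof (cases "g \<in> ?t ` {..<m}")
      case True
      then show ?thesis using U(3) by (simp add: \<pi>_def)
    next
      case False
      obtain k where k: "g = ?t k" using g by (auto simp: tail_class_eq)
      then have "m \<le> k" using False by (metis imageI lessThan_iff not_le)
      then show ?thesis using U(4) False by (simp add: \<pi>_def k)
    qed
    then show ?thesis using U small by (intro exI[of _ U]) auto
  qed
  moreover have "finite (\<pi> ` tail_class x f)"
    by (rule finite_subset[of _ "insert (\<lambda>_. 0) (?t ` {..<m})"]) (auto simp: \<pi>_def)
  moreover have "\<forall>h\<in>\<pi> ` tail_class x f. integrable (measure_pmf r) (\<lambda>y. (h y)\<^sup>2)"
    using it2 by (auto simp: \<pi>_def)
  ultimately show "\<exists>\<pi> N. finite (\<pi> ` tail_class x f) \<and>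
      (\<forall>h\<in>\<pi> ` tail_class x f. integrable (measure_pmf r) (\<lambda>y. (h y)\<^sup>2)) \<and>
      (\<forall>n\<ge>N. outer_close r (tail_class x f) \<pi> \<epsilon> n)"
    by blast
qed

text \<open>Necessity is read off the single member \<open>f\<close> by the converse of the central
  limit theorem; in the other direction \<open>f\<close> also serves as an integrable
  envelope.\<close>

lemma Donsker_tail_class:
  fixes f :: "'a \<Rightarrow> real" and x :: "nat \<Rightarrow> 'a" and e :: "'a \<Rightarrow> nat"
  assumes e: "inj e" and enum: "range x = UNIV" and f0: "\<And>y. 0 \<le> f y"
  shows "Donsker r (tail_class x f) \<longleftrightarrow> (\<lambda>y. (f y)\<^sup>2 * pmf r y) summable_on UNIV"
  unfolding integrable_pmf_iff_summable[symmetric]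
proof
  assume "Donsker r (tail_class x f)"
  then show "integrable (measure_pmf r) (\<lambda>y. (f y)\<^sup>2)"
    by (rule Donsker_square_integrable) (simp add: tail_class_def)
next
  assume f2: "integrable (measure_pmf r) (\<lambda>y. (f y)\<^sup>2)"
  have f1: "integrable (measure_pmf r) f" by (rule integrable_of_square[OF f2])
  have env: "\<bar>g y\<bar> \<le> f y" if "g \<in> tail_class x f" for g y
    using that f0[of y] by (auto simp: tail_class_eq tail_fun_def indicator_def)
  have b: "\<exists>B. \<forall>g\<in>tail_class x f. \<bar>emp r g n \<omega>\<bar> \<le> B" for n \<omega>
    by (rule emp_envelope_bounded[OF f1]) (rule env)
  have i: "integrable (measure_pmf r) g" if "g \<in> tail_class x f" for g
    by (rule integrable_envelope[OF f1 env[OF that]])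
  show "Donsker r (tail_class x f)"
    unfolding Donsker_iff[OF e]
    using tail_class_approximable[OF enum f0 f2] b i by blast
qed

theorem lemma3p1:
  fixes x :: "nat \<Rightarrow> 'a" and r :: "'a pmf" and f :: "'a \<Rightarrow> real"
    and F3 F4 :: "('a \<Rightarrow> real) set"
  assumes enum: "range x = UNIV"
    and pos: "\<And>y. f y > 0"
  shows "(Donsker r (envelope_class f) \<longleftrightarrow> (\<lambda>y. f y * sqrt (pmf r y)) summable_on UNIV)
    \<and> (Donsker r (tail_class x f) \<longleftrightarrow> (\<lambda>y. (f y)\<^sup>2 * pmf r y) summable_on UNIV)
    \<and> (Donsker r (F3 \<union> F4) \<longleftrightarrow> Donsker r F3 \<and> Donsker r F4)"
proof -
  \<comment> \<open>\<open>inv x\<close> picks one index for each point and is injective even if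
    \<open>x\<close> repeats points; it is the labelling by natural numbers that the cells
    require.\<close>
  have e: "inj (inv x)" by (rule surj_imp_inj_inv[OF enum])
  have f0: "0 \<le> f y" for y using pos[of y] by simp
  show ?thesis
    using Donsker_envelope_class[where f=f, OF e f0] Donsker_tail_class[where f=f, OF e enum f0]
      Donsker_Un[OF e] by blast
qed

end
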